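(* Define \begin{align*} \vartheta_8(a_0,\dots,a_7)&:=\frac{1}{8J_4}\Big[a_0\overline{J}_{4,8}\overline{J}_{28,64}+a_1q^4\overline{J}_{0,8}\overline{J}_{52,64}+a_2q\overline{J}_{4,8}\overline{J}_{20,64}+a_3q\overline{J}_{0,8}\overline{J}_{28,64}\\ &\qquad+a_4q^2\overline{J}_{0,8}\overline{J}_{20,64}+a_5q^6\overline{J}_{4,8}\overline{J}_{60,64}+a_6q^3\overline{J}_{4,8}\overline{J}_{52,64}+a_7q^7\overline{J}_{0,8}\overline{J}_{60,64}\Big], \end{align*} \[ G_8(b_0,b_1,b_2,b_3):=b_0\big(1+q^2g(q^2;q^{16})\big)+b_1\big(-1+q^2g(-q^2;q^{16})\big)+b_2q^5g(q^6;q^{16})+b_3q^5g(-q^6;q^{16}). \] Then \begin{align*} D(0,8)&=\vartheta_8(-9,7,-3,5,-1,-1,5,-3)+G_8(1,-1,0,0),\\ D(1,8)=D(7,8)&=\vartheta_8(7,-5,-3,1,3,-1,-3,1)+\tfrac12G_8(-1,1,1,1),\\ D(2,8)=D(6,8)&=\vartheta_8(-1,-1,5,-3,-1,-1,5,-3)+G_8(0,0,0,-1),\\ D(3,8)=D(5,8)&=\vartheta_8(-1,3,-3,1,-5,7,-3,1)+\tfrac12G_8(1,1,-1,1),\\ D(4,8)&=\vartheta_8(-1,-1,5,-3,7,-9,-3,5)+G_8(-1,-1,0,0). \end{align*}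
   Context: Throughout, $q$ is a complex number with $0<|q|<1$. Write $(x)_n=(x;q)_n=\prod_{i=0}^{n-1}(1-q^ix)$ and $(x)_\infty=(x;q)_\infty=\prod_{i\ge0}(1-q^ix)$. Let $j(x;q)=(x)_\infty(q/x)_\infty(q)_\infty=\sum_{n\in\mathbb Z}(-1)^nq^{\binom n2}x^n$. For integers $a$ and $m\ge1$: $J_{a,m}=j(q^a;q^m)$, $\overline{J}_{a,m}=j(-q^a;q^m)$, and $J_m=J_{m,3m}=\prod_{i\ge1}(1-q^{mi})$. The universal mock theta function is $g(x;q)=x^{-1}\big(-1+\sum_{n\ge0}\frac{q^{n^2}}{(x)_{n+1}(q/x)_n}\big)$. Ranks: define integers $N(m,n)$ ($m\in\mathbb Z$, $n\ge0$) by $\sum_{n\ge0}\sum_{m\in\mathbb Z}N(m,n)z^mq^n=\sum_{n\ge0}\frac{q^{n^2}}{(zq)_n(z^{-1}q)_n}$; for $n\ge1$, $N(m,n)$ is the number of partitions of $n$ with rank (largest part minus number of parts) equal to $m$, and $N(m,0)=\delta_{m,0}$. For $M\ge1$ and an integer $a$, $N(a,M;n)=\sum_{m\equiv a \pmod M}N(m,n)$. Let $p(n)$ be the number of partitions of $n$ ($p(0)=1$). The rank deviation is $D(a,M)=\sum_{n\ge0}\big(N(a,M;n)-p(n)/M\big)q^n$. *)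

theory Defs
  imports "HOL-Analysis.Analysis"
begin

definition qpoch :: "complex \<Rightarrow> complex \<Rightarrow> nat \<Rightarrow> complex" where
  "qpoch x q n = (\<Prod>i<n. 1 - q ^ i * x)"

definition qpoch_inf :: "complex \<Rightarrow> complex \<Rightarrow> complex" where
  "qpoch_inf x q = (\<Prod>i. 1 - q ^ i * x)"

definition jfun :: "complex \<Rightarrow> complex \<Rightarrow> complex" where
  "jfun x q = qpoch_inf x q * qpoch_inf (q / x) q * qpoch_inf q q"

definition Jam :: "complex \<Rightarrow> int \<Rightarrow> nat \<Rightarrow> complex" where
  "Jam q a m = jfun (q powi a) (q ^ m)"

definition Jbar :: "complex \<Rightarrow> int \<Rightarrow> nat \<Rightarrow> complex" where
  "Jbar q a m = jfun (- (q powi a)) (q ^ m)"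

definition Jm :: "complex \<Rightarrow> nat \<Rightarrow> complex" where
  "Jm q m = Jam q (int m) (3 * m)"

definition gmock :: "complex \<Rightarrow> complex \<Rightarrow> complex" where
  "gmock x q = inverse x *
     (-1 + (\<Sum>n. q ^ (n\<^sup>2) / (qpoch x q (Suc n) * qpoch (q / x) q n)))"

definition partitions :: "nat \<Rightarrow> nat list set" where
  "partitions n = {xs. sorted_wrt (\<ge>) xs \<and> 0 \<notin> set xs \<and> sum_list xs = n}"

definition prank :: "nat list \<Rightarrow> int" where
  "prank xs = int (Max (insert 0 (set xs))) - int (length xs)"

definition Nrank :: "int \<Rightarrow> nat \<Rightarrow> nat" where
  "Nrank m n = card {xs \<in> partitions n. prank xs = m}"

definition NrankMod :: "int \<Rightarrow> nat \<Rightarrow> nat \<Rightarrow> nat" where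
  "NrankMod a M n = card {xs \<in> partitions n. prank xs mod int M = a mod int M}"

definition pcount :: "nat \<Rightarrow> nat" where
  "pcount n = card (partitions n)"

definition rank_dev :: "complex \<Rightarrow> int \<Rightarrow> nat \<Rightarrow> complex" where
  "rank_dev q a M = (\<Sum>n. (of_nat (NrankMod a M n) - of_nat (pcount n) / of_nat M) * q ^ n)"

definition theta8 :: "complex \<Rightarrow> complex \<Rightarrow> complex \<Rightarrow> complex \<Rightarrow> complex \<Rightarrow> complex
    \<Rightarrow> complex \<Rightarrow> complex \<Rightarrow> complex \<Rightarrow> complex" where
  "theta8 q a0 a1 a2 a3 a4 a5 a6 a7 = 1 / (8 * Jm q 4) *
     (a0 * Jbar q 4 8 * Jbar q 28 64 + a1 * q ^ 4 * Jbar q 0 8 * Jbar q 52 64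
      + a2 * q * Jbar q 4 8 * Jbar q 20 64 + a3 * q * Jbar q 0 8 * Jbar q 28 64
      + a4 * q ^ 2 * Jbar q 0 8 * Jbar q 20 64 + a5 * q ^ 6 * Jbar q 4 8 * Jbar q 60 64
      + a6 * q ^ 3 * Jbar q 4 8 * Jbar q 52 64 + a7 * q ^ 7 * Jbar q 0 8 * Jbar q 60 64)"

definition G8 :: "complex \<Rightarrow> complex \<Rightarrow> complex \<Rightarrow> complex \<Rightarrow> complex \<Rightarrow> complex" where
  "G8 q b0 b1 b2 b3 =
     b0 * (1 + q ^ 2 * gmock (q ^ 2) (q ^ 16)) + b1 * (-1 + q ^ 2 * gmock (- (q ^ 2)) (q ^ 16))
     + b2 * q ^ 5 * gmock (q ^ 6) (q ^ 16) + b3 * q ^ 5 * gmock (- (q ^ 6)) (q ^ 16)"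

end

theory Submission
  imports Defs "HOL-Complex_Analysis.Complex_Analysis"
begin

text \<open>
  The rank generating function is \<open>R(z) = (1 - z)(1 + z g(z;q))\<close>; classifying partitions by their largest
  part gives a series that the Rogers-Fine identity turns into the one defining \<open>g\<close>. By a roots-of-unity filter,
  \<open>D(a,8)\<close> is the combination \<open>1/8 \<Sum> w\<^bsup>-aj\<^esup> R(w\<^sup>j)\<close>, \<open>1 \<le> j \<le> 7\<close>, with \<open>w\<close> a primitive eighth root of unity.

  The values \<open>R(w\<^sup>j)\<close> come from one identity in a free variable: \<open>g(z;q)\<close> is a combination of
  \<open>g(-q\<^sup>kz\<^sup>4;q\<^bsup>16\<^esup>)\<close>, \<open>k = 2, 6, 10, 14\<close>, plus a theta quotient. The functional equation
  \<open>g(qz;q) = -z - z\<^sup>2 - z\<^sup>3 g(z;q)\<close> shows that the difference of the two sides, times \<open>(z;q)\<^sub>\<infinity>(q/z;q)\<^sub>\<infinity>\<close>, is a function \<open>h\<close>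
  with \<open>h(qz) = z\<^sup>2 h(z)\<close>; the theta quotient is chosen so that its remaining poles cancel, and then \<open>h\<close> is bounded on the
  punctured plane and vanishes by Liouville's theorem. At \<open>z\<^sup>8 = 1\<close> the theta quotient is evaluated with the triple product,
  even/odd splittings and the product formula for two theta functions.
\<close>

section \<open>Infinite q-products\<close>

text \<open>The term \<open>j = 0\<close> of the filter is the generating function of
  \<open>p(n)\<close> divided by 8, exactly what the deviation subtracts; so \<open>z = 1\<close>, a
  pole of \<open>g\<close>, never occurs. At the remaining roots the arguments depend only on
  \<open>e = z^4\<close>, which is 1 or -1, and the reflection \<open>x -> q^16/x\<close> folds the
  exponents 10 and 14 onto 6 and 2. This is why just the four values of \<open>g\<close> in
  \<open>G8\<close> survive.

  Poles are avoided by working with numerators: \<open>Gam\<close> is \<open>g\<close> times its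
  denominator, holomorphic away from 0.

  The numerator of the theta quotient has to satisfy \<open>f(qz) = f(z) / (q z^2)\<close>. By
  comparison of Laurent coefficients these functions form a two-dimensional space, spanned by
  \<open>j(-q z^2; q^2)\<close> and \<open>z j(-q^2 z^2; q^2)\<close>. Only two constants are free,
  and they must cancel the poles at all four solutions of \<open>q^2 z^4 = -1\<close>.

  The delicate evaluation is at a primitive eighth root, where \<open>j(z; q)\<close> enters as a
  linear combination of two theta values instead of an eta quotient. There the quotient is not
  computed but verified after multiplication by its denominator, through quadratic relations between
  theta functions.\<close>

lemma qpoch_0 [simp]: "qpoch x q 0 = 1"
  by (simp add: qpoch_def)

lemma qpoch_Suc: "qpoch x q (Suc n) = qpoch x q n * (1 - q ^ n * x)"
  by (simp add: qpoch_def)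

lemma qpoch_Suc_shift: "qpoch x q (Suc n) = (1 - x) * qpoch (q * x) q n"
  by (simp add: qpoch_def prod.lessThan_Suc_shift mult_ac del: prod.lessThan_Suc)

lemma convergent_prod_qpoch:
  assumes "norm q < 1"
  shows "convergent_prod (\<lambda>i. 1 - q ^ i * x :: complex)"
proof -
  have "summable (\<lambda>i. norm (q ^ i * x))"
    using assms by (auto simp: norm_mult norm_power intro!: summable_mult2 summable_geometric)
  then show ?thesis
    by (intro abs_convergent_prod_imp_convergent_prod) (simp add: abs_convergent_prod_conv_summable)
qed

lemma qpoch_tendsto:
  assumes "norm q < 1"
  shows "(\<lambda>n. qpoch x q n) \<longlonglongrightarrow> qpoch_inf x q"
  unfolding qpoch_def qpoch_inf_def
  using convergent_prod_LIMSEQ[OF convergent_prod_qpoch[OF assms]]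
  by (simp add: LIMSEQ_lessThan_iff_atMost)

lemma qpoch_inf_eq_0_iff:
  assumes "norm q < 1"
  shows "qpoch_inf x q = 0 \<longleftrightarrow> (\<exists>i. q ^ i * x = 1)"
  using has_prod_eq_0_iff[OF convergent_prod_has_prod[OF convergent_prod_qpoch[OF assms, of x]]]
  by (auto simp: qpoch_inf_def intro: rangeI)

lemma qpoch_inf_0 [simp]: "qpoch_inf 0 q = 1"
  by (simp add: qpoch_inf_def)

lemma qpoch_inf_shift:
  assumes "norm q < 1"
  shows "qpoch_inf x q = (1 - x) * qpoch_inf (q * x) q"
proof (rule LIMSEQ_unique)
  show "(\<lambda>n. qpoch x q (Suc n)) \<longlonglongrightarrow> qpoch_inf x q"
    using qpoch_tendsto[OF assms] by (rule LIMSEQ_Suc)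
  show "(\<lambda>n. qpoch x q (Suc n)) \<longlonglongrightarrow> (1 - x) * qpoch_inf (q * x) q"
    unfolding qpoch_Suc_shift by (intro tendsto_intros qpoch_tendsto assms)
qed

lemma qpoch_inf_shift_Suc:
  assumes "norm q < 1"
  shows "qpoch_inf (x * q ^ n) q = (1 - x * q ^ n) * qpoch_inf (x * q ^ Suc n) q"
  using qpoch_inf_shift[OF assms, of "x * q ^ n"] by (simp add: mult_ac)

lemma qpoch_inf_split:
  assumes "norm q < 1"
  shows "qpoch_inf x q = qpoch x q n * qpoch_inf (x * q ^ n) q"
proof (induction n)
  case (Suc n)
  then show ?case
    using qpoch_inf_shift_Suc[OF assms, of x n] by (simp add: qpoch_Suc mult_ac)
qed simp

lemma norm_power_less_1:
  fixes q :: complex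
  assumes "norm q < 1" "m > 0"
  shows "norm (q ^ m) < 1"
  using assms by (simp add: norm_power power_Suc_less_one power_strict_mono[of "norm q" 1 m, simplified])

text \<open>Sorting the factors by the residue of the exponent modulo \<open>m\<close> is exact on
  the first \<open>m * n\<close> factors; then \<open>n\<close> tends to infinity.\<close>

lemma qpoch_inf_dissect:
  assumes "norm q < 1" "m > 0"
  shows "qpoch_inf x q = (\<Prod>j<m. qpoch_inf (x * q ^ j) (q ^ m))"
proof (rule LIMSEQ_unique)
  have eq: "qpoch x q (m * n) = (\<Prod>j<m. qpoch (x * q ^ j) (q ^ m) n)" for n
  proof (induction n)
    case (Suc n)
    have "qpoch x q (m * n + k) = qpoch x q (m * n) * (\<Prod>j<k. 1 - q ^ (m * n + j) * x)" for k
      by (induction k) (auto simp: qpoch_Suc mult_ac)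
    from this[of m] have "qpoch x q (m * Suc n) = qpoch x q (m * n) * (\<Prod>j<m. 1 - q ^ (m * n + j) * x)"
      by (simp add: add.commute)
    then show ?case
      unfolding Suc.IH qpoch_Suc prod.distrib
      by (simp add: power_add power_mult mult_ac)
  qed simp
  have "strict_mono (\<lambda>n. m * n)"
    using assms by (auto simp: strict_mono_def)
  from LIMSEQ_subseq_LIMSEQ[OF qpoch_tendsto[OF assms(1)] this]
  show "(\<lambda>n. qpoch x q (m * n)) \<longlonglongrightarrow> qpoch_inf x q"
    by (simp add: o_def)
  show "(\<lambda>n. qpoch x q (m * n)) \<longlonglongrightarrow> (\<Prod>j<m. qpoch_inf (x * q ^ j) (q ^ m))"
    unfolding eq by (intro tendsto_prod qpoch_tendsto norm_power_less_1 assms)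
qed

text \<open>Each factor is at most \<open>exp (norm q ^ i * norm x)\<close>, and the exponents form
  a geometric series. As the bound grows with \<open>norm x\<close>, it serves all tails at
  \<open>x * q ^ n\<close> at once.\<close>

lemma norm_qpoch_inf_le:
  assumes "norm q < 1"
  shows "norm (qpoch_inf x q) \<le> exp (norm x / (1 - norm q))"
proof (rule LIMSEQ_le_const2)
  show "(\<lambda>n. norm (qpoch x q n)) \<longlonglongrightarrow> norm (qpoch_inf x q)"
    by (intro tendsto_norm qpoch_tendsto assms)
  have "norm (qpoch x q n) \<le> exp (norm x / (1 - norm q))" for n
  proof -
    have "norm (qpoch x q n) \<le> (\<Prod>i<n. exp (norm q ^ i * norm x))"
      unfolding qpoch_def prod_norm[symmetric]
    proof (intro prod_mono conjI norm_ge_zero)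
      fix i
      have "norm (1 - q ^ i * x) \<le> 1 + norm q ^ i * norm x"
        using norm_triangle_ineq4[of 1 "q ^ i * x"] by (simp add: norm_mult norm_power)
      also have "\<dots> \<le> exp (norm q ^ i * norm x)"
        by (rule exp_ge_add_one_self)
      finally show "norm (1 - q ^ i * x) \<le> exp (norm q ^ i * norm x)" .
    qed
    also have "\<dots> = exp ((\<Sum>i<n. norm q ^ i) * norm x)"
      by (simp add: exp_sum sum_distrib_right)
    also have "\<dots> \<le> exp (1 / (1 - norm q) * norm x)"
    proof -
      have "(\<Sum>i<n. norm q ^ i) \<le> (\<Sum>i. norm q ^ i)"
        using assms by (intro sum_le_suminf summable_geometric) auto
      also have "\<dots> = 1 / (1 - norm q)"
        using assms by (intro suminf_geometric) auto
      finally show ?thesis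
        by (simp only: exp_le_cancel_iff mult_right_mono norm_ge_zero)
    qed
    finally show ?thesis by simp
  qed
  then show "\<exists>N. \<forall>n\<ge>N. norm (qpoch x q n) \<le> exp (norm x / (1 - norm q))"
    by blast
qed

lemma uniform_limit_qpoch:
  assumes "norm q < 1" "compact A"
  shows "uniform_limit A (\<lambda>n x. qpoch x q n) (\<lambda>x. qpoch_inf x q) sequentially"
proof -
  obtain C where C: "norm x \<le> C" if "x \<in> A" for x
    using compact_imp_bounded[OF assms(2)] by (auto simp: bounded_iff)
  have "uniformly_convergent_on A (\<lambda>n x. qpoch x q n)"
    unfolding qpoch_def
  proof (rule uniformly_convergent_on_prod')
    show "uniformly_convergent_on A (\<lambda>N x. \<Sum>n<N. norm (1 - q ^ n * x - 1))"
    proof (rule Weierstrass_m_test')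
      show "summable (\<lambda>n. norm q ^ n * C)"
        using assms(1) by (intro summable_mult2 summable_geometric) auto
      show "norm (norm (1 - q ^ n * x - 1)) \<le> norm q ^ n * C" if "x \<in> A" for n x
        using C[OF that] by (simp add: norm_mult norm_power mult_left_mono)
    qed
  qed (use assms in \<open>auto intro!: continuous_intros\<close>)
  then obtain l where l: "uniform_limit A (\<lambda>n x. qpoch x q n) l sequentially"
    by (auto simp: uniformly_convergent_on_def)
  have "l x = qpoch_inf x q" if "x \<in> A" for x
    using tendsto_uniform_limitI[OF l that] qpoch_tendsto[OF assms(1)] LIMSEQ_unique by blast
  with l show ?thesis
    by (metis (mono_tags, lifting) uniform_limit_cong')
qed

lemma holomorphic_qpoch_inf:
  assumes "norm q < 1"
  shows "(\<lambda>x. qpoch_inf x q) holomorphic_on UNIV"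
proof (rule holomorphic_uniform_sequence)
  show "(\<lambda>x. qpoch x q n) holomorphic_on UNIV" for n
    unfolding qpoch_def by (intro holomorphic_intros)
  show "\<exists>d>0. cball x d \<subseteq> UNIV \<and>
          uniform_limit (cball x d) (\<lambda>n x. qpoch x q n) (\<lambda>x. qpoch_inf x q) sequentially" for x
    using uniform_limit_qpoch[OF assms compact_cball] by (intro exI[of _ 1]) auto
qed auto

lemma holomorphic_qpoch_inf' [holomorphic_intros]:
  assumes "norm q < 1" "f holomorphic_on A"
  shows "(\<lambda>z. qpoch_inf (f z) q) holomorphic_on A"
  using holomorphic_on_compose_gen[OF assms(2) holomorphic_qpoch_inf[OF assms(1)]]
  by (simp add: o_def)

section \<open>Jacobi's triple product\<close>

text \<open>The \<open>div\<close> is exact, for negative \<open>k\<close> too, because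
  \<open>k * (k - 1)\<close> is even.\<close>

definition jterm :: "complex \<Rightarrow> complex \<Rightarrow> int \<Rightarrow> complex" where
  "jterm x q k = (-1) powi k * q powi (k * (k - 1) div 2) * x powi k"

lemma triangular_step: "(k + 1) * k div 2 = k * (k - 1) div 2 + (k::int)"
proof -
  have "(k + 1) * k = k * (k - 1) + 2 * k"
    by (simp add: algebra_simps)
  then show ?thesis by simp
qed

lemma jterm_step:
  assumes "q \<noteq> 0" "x \<noteq> 0"
  shows "jterm x q (k + 1) = - (q powi k) * x * jterm x q k"
proof -
  have "(k + 1) * (k + 1 - 1) div 2 = k * (k - 1) div 2 + k"
    using triangular_step[of k] by simp
  then show ?thesis
    using assms by (simp add: jterm_def power_int_add)
qed

lemma jterm_step_down:
  assumes "q \<noteq> 0" "x \<noteq> 0"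
  shows "jterm x q (k - 1) = - (q powi (1 - k)) / x * jterm x q k"
  using jterm_step[OF assms, of "k - 1"] assms
  by (simp add: field_simps power_int_diff)

lemma powi_1_plus_nat: "(q::complex) powi (1 + int n) = q ^ Suc n"
  by (metis of_nat_Suc power_int_of_nat add.commute)

lemma abs_summable_jterm:
  assumes "q \<noteq> 0" "norm q < 1" "x \<noteq> 0"
  shows "(\<lambda>k. norm (jterm x q k)) summable_on UNIV"
proof -
  have ev: "\<exists>N. \<forall>n\<ge>N. norm q ^ n * c < 1/2" for c :: real
  proof -
    have "(\<lambda>n. norm q ^ n * c) \<longlonglongrightarrow> 0 * c"
      using assms by (intro tendsto_mult LIMSEQ_power_zero tendsto_const) auto
    then have "\<forall>\<^sub>F n in sequentially. norm q ^ n * c < 1/2"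
      by (intro order_tendstoD) auto
    then show ?thesis by (simp add: eventually_sequentially)
  qed
  have "summable (\<lambda>n. norm (jterm x q (int n)))"
  proof -
    obtain N where N: "norm q ^ n * norm x < 1/2" if "n \<ge> N" for n
      using ev by blast
    show ?thesis
    proof (rule summable_ratio_test)
      fix n assume "n \<ge> N"
      have "norm (jterm x q (int (Suc n))) = norm q ^ n * norm x * norm (jterm x q (int n))"
        using jterm_step[OF assms(1,3), of "int n"]
        by (simp add: norm_mult norm_power add.commute)
      also have "\<dots> \<le> 1/2 * norm (jterm x q (int n))"
        using N[OF \<open>n \<ge> N\<close>] by (intro mult_right_mono) auto
      finally show "norm (norm (jterm x q (int (Suc n)))) \<le> 1/2 * norm (norm (jterm x q (int n)))"
        by simp
    qed simp
  qed
  then have 1: "(\<lambda>k. norm (jterm x q k)) summable_on range int"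
    by (subst summable_on_reindex) (auto simp: o_def summable_on_UNIV_nonneg_real_iff)
  have "summable (\<lambda>n. norm (jterm x q (- int n)))"
  proof -
    obtain N where N: "norm q ^ n * (norm q / norm x) < 1/2" if "n \<ge> N" for n
      using ev by blast
    show ?thesis
    proof (rule summable_ratio_test)
      fix n assume "n \<ge> N"
      have "norm (jterm x q (- int (Suc n))) = norm q ^ n * (norm q / norm x) * norm (jterm x q (- int n))"
      proof -
        have eq: "- int (Suc n) = - int n - 1" by simp
        show ?thesis
          unfolding eq jterm_step_down[OF assms(1,3)]
          by (simp add: norm_mult norm_divide norm_power powi_1_plus_nat)
      qed
      also have "\<dots> \<le> 1/2 * norm (jterm x q (- int n))"
        using N[OF \<open>n \<ge> N\<close>] by (intro mult_right_mono) auto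
      finally show "norm (norm (jterm x q (- int (Suc n)))) \<le> 1/2 * norm (norm (jterm x q (- int n)))"
        by simp
    qed simp
  qed
  then have 2: "(\<lambda>k. norm (jterm x q k)) summable_on range (\<lambda>n. - int n)"
    by (subst summable_on_reindex) (auto simp: o_def inj_on_def summable_on_UNIV_nonneg_real_iff)
  have "k \<in> range int \<union> range (\<lambda>n. - int n)" for k :: int
    by (cases k rule: int_cases2) auto
  then have "UNIV = range int \<union> range (\<lambda>n. - int n)"
    by blast
  with summable_on_union[OF 1 2] show ?thesis by simp
qed

text \<open>Tannery's theorem, transported to sums over all integers along the enumeration
  \<open>int_decode\<close>.\<close>

lemma has_sum_int_dominated:
  fixes f :: "nat \<Rightarrow> int \<Rightarrow> complex"
  assumes "\<And>N. (f N has_sum S N) UNIV" "\<And>k. (\<lambda>N. f N k) \<longlonglongrightarrow> g k"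
    and "\<And>N k. norm (f N k) \<le> h k" "h summable_on UNIV" "S \<longlonglongrightarrow> L"
  shows "(g has_sum L) UNIV"
proof -
  have bij: "bij_betw int_decode UNIV UNIV"
    by (rule bij_int_decode)
  have sS: "(\<lambda>k. f N (int_decode k)) sums S N" for N
    using assms(1) has_sum_reindex_bij_betw[OF bij, of "f N"] by (intro has_sum_imp_sums) simp
  have sh: "summable (\<lambda>k. h (int_decode k))"
    using assms(4) has_sum_reindex_bij_betw[OF bij, of h]
    by (intro summable_on_imp_summable) (auto simp: summable_on_def)
  have "\<forall>\<^sub>F (k, N) in at_top \<times>\<^sub>F sequentially. norm (f N (int_decode k)) \<le> h (int_decode k)"
    using assms(3) by (intro always_eventually) auto
  then have T: "summable (\<lambda>k. norm (g (int_decode k)))"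
       "(\<lambda>N. \<Sum>k. f N (int_decode k)) \<longlonglongrightarrow> (\<Sum>k. g (int_decode k))"
    using tannerys_theorem[where a = "\<lambda>k N. f N (int_decode k)" and F = sequentially
        and b = "\<lambda>k. g (int_decode k)" and M = "\<lambda>k. h (int_decode k)"] assms sh
    by auto
  have "(\<Sum>k. g (int_decode k)) = L"
    using T(2) assms(5) sums_unique[OF sS, symmetric] by (simp add: LIMSEQ_unique)
  moreover have "((\<lambda>k. g (int_decode k)) has_sum (\<Sum>k. g (int_decode k))) UNIV"
    using norm_summable_imp_has_sum[OF T(1)] summable_norm_cancel[OF T(1)] by blast
  ultimately show ?thesis
    using has_sum_reindex_bij_betw[OF bij, of g] by simp
qed

text \<open>The value 0 at negative \<open>k\<close> turns finite sums into sums over all integers,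
  so that index shifts produce no boundary terms.\<close>

definition recip_qfac :: "complex \<Rightarrow> int \<Rightarrow> complex" where
  "recip_qfac q k = (if k < 0 then 0 else 1 / qpoch q q (nat k))"

lemma power_ne_1: "norm q < 1 \<Longrightarrow> n > 0 \<Longrightarrow> (q::complex) ^ n \<noteq> 1"
  using norm_power_less_1[of q n] by force

lemma qpoch_self_nz:
  assumes "norm q < 1"
  shows "qpoch q q n \<noteq> 0"
proof -
  have "q ^ i * q \<noteq> 1" for i
    using power_ne_1[OF assms, of "Suc i"] by (simp add: mult.commute)
  then show ?thesis
    by (auto simp: qpoch_def eq_commute[of "1 :: complex"])
qed

lemma qpoch_inf_self_nz:
  assumes "norm q < 1"
  shows "qpoch_inf q q \<noteq> 0"
  using power_ne_1[OF assms, of "Suc _"] by (simp add: qpoch_inf_eq_0_iff[OF assms] mult.commute)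

text \<open>It also holds across \<open>k = 0\<close>, where the factor \<open>1 - q powi 0\<close>
  vanishes.\<close>

lemma recip_qfac_step:
  assumes "norm q < 1"
  shows "recip_qfac q (k - 1) = (1 - q powi k) * recip_qfac q k"
proof (cases "k \<le> 0")
  case True
  then show ?thesis by (cases "k = 0") (auto simp: recip_qfac_def)
next
  case False
  then obtain n where "k = int (Suc n)"
    by (metis gr0_implies_Suc not_le zero_less_imp_eq_int)
  then show ?thesis
    using qpoch_self_nz[OF assms, of n] qpoch_self_nz[OF assms, of "Suc n"]
    by (simp add: recip_qfac_def qpoch_Suc powi_1_plus_nat field_simps nat_add_distrib)
qed

text \<open>The bracket is the Gaussian binomial coefficient of \<open>2 * N\<close> over
  \<open>N + k\<close>.\<close>

definition fin_jterm :: "complex \<Rightarrow> complex \<Rightarrow> nat \<Rightarrow> int \<Rightarrow> complex" where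
  "fin_jterm x q N k =
     jterm x q k * (qpoch q q (2 * N) * recip_qfac q (int N + k) * recip_qfac q (int N - k))"

text \<open>The finite form of the triple product. Passing from \<open>N\<close> to
  \<open>N + 1\<close> multiplies the product by two linear factors, which on the series side
  becomes a three-term recurrence in \<open>k\<close>.\<close>

lemma has_sum_fin_jterm:
  assumes q: "q \<noteq> 0" "norm q < 1" and x: "x \<noteq> 0"
  shows "(fin_jterm x q N has_sum (qpoch x q N * qpoch (q / x) q N)) UNIV"
proof (induction N)
  case 0
  have "fin_jterm x q 0 k = 0" if "k \<noteq> 0" for k
    using that by (cases "k < 0") (auto simp: fin_jterm_def recip_qfac_def)
  moreover have "fin_jterm x q 0 0 = 1"
    by (simp add: fin_jterm_def recip_qfac_def jterm_def)
  ultimately show ?case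
    by (intro has_sum_finite_neutralI[of "{0}"]) auto
next
  case (Suc N)
  let ?f = "fin_jterm x q N"
  let ?S = "qpoch x q N * qpoch (q / x) q N"
  have up: "((\<lambda>k. ?f (k + 1)) has_sum ?S) UNIV"
    using Suc.IH by (subst has_sum_reindex_bij_witness[of UNIV "\<lambda>k. k - 1" "\<lambda>k. k + 1" UNIV ?f]) auto
  have down: "((\<lambda>k. ?f (k - 1)) has_sum ?S) UNIV"
    using Suc.IH by (subst has_sum_reindex_bij_witness[of UNIV "\<lambda>k. k + 1" "\<lambda>k. k - 1" UNIV ?f]) auto
  \<comment> \<open>The coefficients are those of the expanded product of
    \<open>1 - q ^ N * x\<close> and \<open>1 - q ^ (N + 1) / x\<close>; the powers of
    \<open>x\<close> are absorbed by shifting \<open>k\<close>.\<close>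
  have "((\<lambda>k. (1 + q ^ (2 * N + 1)) * ?f k + (- (q ^ N * x)) * ?f (k - 1)
           + (- (q ^ (N + 1) / x)) * ?f (k + 1))
         has_sum ((1 + q ^ (2 * N + 1)) * ?S + (- (q ^ N * x)) * ?S + (- (q ^ (N + 1) / x)) * ?S)) UNIV"
    by (intro has_sum_add has_sum_cmult_right Suc.IH up down)
  also have "(\<lambda>k. (1 + q ^ (2 * N + 1)) * ?f k + (- (q ^ N * x)) * ?f (k - 1)
           + (- (q ^ (N + 1) / x)) * ?f (k + 1)) = fin_jterm x q (Suc N)"
  proof
    fix k
    \<comment> \<open>All factors separating the two levels have the form \<open>1 - A\<close>,
      \<open>1 - A / q\<close>, \<open>1 - B\<close>, \<open>1 - B / q\<close>, and
      \<open>A * B\<close> is free of \<open>k\<close>; the recurrence becomes an identity in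
      \<open>A\<close>, \<open>B\<close> and \<open>q\<close>.\<close>
    define A where "A = q powi (int (Suc N) + k)"
    define B where "B = q powi (int (Suc N) - k)"
    define r where "r = recip_qfac q (int (Suc N) + k)"
    define s where "s = recip_qfac q (int (Suc N) - k)"
    define t where "t = jterm x q k"
    define F where "F = qpoch q q (2 * N)"
    have AB: "A * B = q ^ (2 * N + 2)"
      unfolding A_def B_def using q
      by (simp add: power_int_add[symmetric] flip: power_int_of_nat)
    have r1: "recip_qfac q (int N + k) = (1 - A) * r"
      using recip_qfac_step[OF q(2), of "int (Suc N) + k"] by (simp add: A_def r_def)
    have r2: "recip_qfac q (int N + (k - 1)) = (1 - A / q) * ((1 - A) * r)"
    proof -
      have "int N + (k - 1) = int N + k - 1" "q powi (int N + k) = A / q"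
        using q by (simp_all add: A_def power_int_add)
      then show ?thesis
        using recip_qfac_step[OF q(2), of "int N + k"] r1 by metis
    qed
    have s1: "recip_qfac q (int N - k) = (1 - B) * s"
      using recip_qfac_step[OF q(2), of "int (Suc N) - k"] by (simp add: B_def s_def)
    have s2: "recip_qfac q (int N - (k + 1)) = (1 - B / q) * ((1 - B) * s)"
    proof -
      have "int N - (k + 1) = int N - k - 1" "q powi (int N - k) = B / q"
        using q by (simp_all add: B_def power_int_add power_int_diff)
      then show ?thesis
        using recip_qfac_step[OF q(2), of "int N - k"] s1 by metis
    qed
    have t1: "q ^ N * x * jterm x q (k - 1) = - B * t"
    proof -
      have "B = q ^ N * q powi (1 - k)"
        using q by (simp add: B_def power_int_add power_int_diff)
      then show ?thesis
        using x by (simp add: jterm_step_down[OF q(1) x] t_def)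
    qed
    have t2: "q ^ (N + 1) / x * jterm x q (k + 1) = - A * t"
    proof -
      have "A = q ^ (N + 1) * q powi k"
        using q by (simp add: A_def power_int_add)
      then show ?thesis
        using x by (simp add: jterm_step[OF q(1) x] t_def)
    qed
    have "(1 + q ^ (2 * N + 1)) * ?f k + (- (q ^ N * x)) * ?f (k - 1) + (- (q ^ (N + 1) / x)) * ?f (k + 1)
      = (1 + A * B / q) * (t * (F * ((1 - A) * r) * ((1 - B) * s)))
        + B * t * (F * ((1 - A / q) * ((1 - A) * r)) * s)
        + A * t * (F * r * ((1 - B / q) * ((1 - B) * s)))"
    proof -
      have e1: "(1 + q ^ (2 * N + 1)) * ?f k = (1 + A * B / q) * (t * (F * ((1 - A) * r) * ((1 - B) * s)))"
        unfolding fin_jterm_def r1 s1 t_def F_def AB using q by simp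
      have s': "recip_qfac q (int N - (k - 1)) = s"
        unfolding s_def by (rule arg_cong[where f = "recip_qfac q"]) simp
      have r': "recip_qfac q (int N + (k + 1)) = r"
        unfolding r_def by (rule arg_cong[where f = "recip_qfac q"]) simp
      have "(- (q ^ N * x)) * ?f (k - 1)
          = - (q ^ N * x * jterm x q (k - 1)) * (F * ((1 - A / q) * ((1 - A) * r)) * s)"
        unfolding fin_jterm_def r2 s' F_def by simp
      then have e2: "(- (q ^ N * x)) * ?f (k - 1) = B * t * (F * ((1 - A / q) * ((1 - A) * r)) * s)"
        unfolding t1 by simp
      have "(- (q ^ (N + 1) / x)) * ?f (k + 1)
          = - (q ^ (N + 1) / x * jterm x q (k + 1)) * (F * r * ((1 - B / q) * ((1 - B) * s)))"
        unfolding fin_jterm_def s2 r' F_def by simp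
      then have e3: "(- (q ^ (N + 1) / x)) * ?f (k + 1) = A * t * (F * r * ((1 - B / q) * ((1 - B) * s)))"
        unfolding t2 by simp
      show ?thesis unfolding e1 e2 e3 ..
    qed
    also have "\<dots> = t * (F * (1 - A * B / q) * (1 - A * B) * r * s)"
      using q by (simp add: field_simps)
    also have "\<dots> = fin_jterm x q (Suc N) k"
      unfolding fin_jterm_def t_def F_def AB r_def s_def using q
      by (simp add: qpoch_Suc mult_ac)
    finally show "(1 + q ^ (2 * N + 1)) * ?f k + (- (q ^ N * x)) * ?f (k - 1)
           + (- (q ^ (N + 1) / x)) * ?f (k + 1) = fin_jterm x q (Suc N) k" .
  qed
  also have "(1 + q ^ (2 * N + 1)) * ?S + (- (q ^ N * x)) * ?S + (- (q ^ (N + 1) / x)) * ?S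
      = qpoch x q (Suc N) * qpoch (q / x) q (Suc N)"
    using x by (simp add: qpoch_Suc field_simps power_add mult_2 mult_2_right)
  finally show ?case .
qed

text \<open>In the finite form the Gaussian binomials stay bounded and tend to \<open>1 / E\<close>,
  so the limit may be taken termwise. Multiplying by \<open>E\<close> supplies the third factor of
  \<open>jfun\<close>.\<close>

theorem jacobi_triple_product:
  assumes q: "q \<noteq> 0" "norm q < 1" and x: "x \<noteq> 0"
  shows "(jterm x q has_sum jfun x q) UNIV"
proof -
  define E where "E = qpoch_inf q q"
  have E: "E \<noteq> 0"
    unfolding E_def by (rule qpoch_inf_self_nz[OF q(2)])
  have lim: "(\<lambda>n. qpoch q q n) \<longlonglongrightarrow> E"
    unfolding E_def by (rule qpoch_tendsto[OF q(2)])
  obtain C where C: "norm (qpoch q q n) \<le> C" for n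
    using convergent_imp_Bseq[OF convergentI[OF lim]] by (auto simp: Bseq_def)
  have "(\<lambda>n. 1 / qpoch q q n) \<longlonglongrightarrow> 1 / E"
    by (intro tendsto_intros lim E)
  then have "Bseq (\<lambda>n. 1 / qpoch q q n)"
    by (intro convergent_imp_Bseq convergentI)
  then obtain D where "\<forall>n. norm (1 / qpoch q q n) \<le> D"
    unfolding Bseq_def by blast
  then have D: "norm (1 / qpoch q q n) \<le> D" for n
    by blast
  have C0: "C \<ge> 0" using C[of 0] norm_ge_zero order_trans by blast
  have D0: "D \<ge> 0" using D[of 0] norm_ge_zero order_trans by blast
  have D': "norm (recip_qfac q k) \<le> D" for k
    using D D0 by (auto simp: recip_qfac_def)
  have "((\<lambda>k. jterm x q k * (E * (1 / E) * (1 / E)))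
      has_sum (qpoch_inf x q * qpoch_inf (q / x) q)) UNIV"
  proof (rule has_sum_int_dominated)
    show "(fin_jterm x q N has_sum (qpoch x q N * qpoch (q / x) q N)) UNIV" for N
      by (rule has_sum_fin_jterm[OF assms])
    have rl: "(\<lambda>N. recip_qfac q (int N + k)) \<longlonglongrightarrow> 1 / E" for k
    proof -
      have nl: "filterlim (\<lambda>N. nat (int N + k)) sequentially sequentially"
        unfolding filterlim_at_top
      proof
        fix Z :: nat
        show "\<forall>\<^sub>F N in sequentially. Z \<le> nat (int N + k)"
          using eventually_ge_at_top[of "Z + nat \<bar>k\<bar>"] by eventually_elim linarith
      qed
      have "(\<lambda>N. 1 / qpoch q q (nat (int N + k))) \<longlonglongrightarrow> 1 / E"
        by (intro tendsto_intros E filterlim_compose[OF lim nl])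
      moreover have "\<forall>\<^sub>F N in sequentially. 1 / qpoch q q (nat (int N + k)) = recip_qfac q (int N + k)"
        using eventually_ge_at_top[of "nat \<bar>k\<bar>"] by eventually_elim (auto simp: recip_qfac_def)
      ultimately show ?thesis
        by (rule Lim_transform_eventually)
    qed
    have l2: "(\<lambda>N. qpoch q q (2 * N)) \<longlonglongrightarrow> E"
      using LIMSEQ_subseq_LIMSEQ[OF lim, of "\<lambda>N. 2 * N"] by (simp add: strict_mono_def o_def)
    show "(\<lambda>N. fin_jterm x q N k) \<longlonglongrightarrow> jterm x q k * (E * (1 / E) * (1 / E))" for k
      unfolding fin_jterm_def using rl[of k] rl[of "- k"]
      by (intro tendsto_intros l2) auto
    show "norm (fin_jterm x q N k) \<le> norm (jterm x q k) * (C * D * D)" for N k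
      unfolding fin_jterm_def norm_mult
      by (intro mult_mono mult_nonneg_nonneg norm_ge_zero C D' C0 D0 order_refl)
    show "(\<lambda>k. norm (jterm x q k) * (C * D * D)) summable_on UNIV"
      by (intro summable_on_cmult_left abs_summable_jterm assms)
    show "(\<lambda>N. qpoch x q N * qpoch (q / x) q N) \<longlonglongrightarrow> qpoch_inf x q * qpoch_inf (q / x) q"
      by (intro tendsto_intros qpoch_tendsto q)
  qed
  from has_sum_cmult_left[OF this, of E] show ?thesis
    using E by (simp add: jfun_def E_def mult_ac)
qed

section \<open>The universal mock theta function\<close>

text \<open>Up to the infinite product at \<open>x\<close>, tails play the role of reciprocals of
  \<open>qpoch x q n\<close>, but they are entire in \<open>x\<close>.\<close>

definition qtail :: "complex \<Rightarrow> complex \<Rightarrow> nat \<Rightarrow> complex" where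
  "qtail x q n = qpoch_inf (x * q ^ n) q"

lemma qtail_step:
  "norm q < 1 \<Longrightarrow> qtail x q n = (1 - x * q ^ n) * qtail x q (Suc n)"
  unfolding qtail_def by (rule qpoch_inf_shift_Suc)

lemma qtail_mult: "qtail (x * q) q n = qtail x q (Suc n)"
  by (simp add: qtail_def mult_ac)

lemma qtail_divide: "q \<noteq> 0 \<Longrightarrow> qtail (x / q) q (Suc n) = qtail x q n"
  by (simp add: qtail_def)

lemma norm_qtail_le:
  assumes "norm q < 1"
  shows "norm (qtail x q n) \<le> exp (norm x / (1 - norm q))"
proof -
  have "norm (x * q ^ n) \<le> norm x"
    using assms by (simp add: norm_mult norm_power mult_left_le power_le_one)
  then have "norm (x * q ^ n) / (1 - norm q) \<le> norm x / (1 - norm q)"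
    using assms by (intro divide_right_mono) auto
  then show ?thesis
    unfolding qtail_def using norm_qpoch_inf_le[OF assms, of "x * q ^ n"] by (meson exp_le_cancel_iff order_trans)
qed

text \<open>This is \<open>jfun\<close> without its factor constant in \<open>x\<close>: same zeros,
  same functional equations.\<close>

definition ptheta :: "complex \<Rightarrow> complex \<Rightarrow> complex" where
  "ptheta x q = qpoch_inf x q * qpoch_inf (q / x) q"

lemma jfun_ptheta: "jfun x q = ptheta x q * qpoch_inf q q"
  by (simp add: jfun_def ptheta_def)

lemma ptheta_qtail: "ptheta x q = qtail x q 0 * qtail (1 / x) q 1"
  by (simp add: ptheta_def qtail_def)

lemma ptheta_shift:
  assumes "norm q < 1" "q \<noteq> 0" "x \<noteq> 0"
  shows "ptheta (q * x) q = - ptheta x q / x"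
proof -
  have "ptheta (q * x) q = qtail x q 1 * qtail (1 / x) q 0"
    using assms by (simp add: ptheta_def qtail_def mult_ac)
  moreover have "qtail (1 / x) q 0 = (1 - 1 / x) * qtail (1 / x) q 1"
    using qtail_step[OF assms(1), of "1 / x" 0] by simp
  moreover have "ptheta x q = (1 - x) * qtail x q 1 * qtail (1 / x) q 1"
    using qtail_step[OF assms(1), of x 0] by (simp add: ptheta_qtail)
  ultimately show ?thesis
    using assms by (simp add: divide_simps) (simp add: algebra_simps)
qed

lemma ptheta_inverse:
  assumes "norm q < 1" "q \<noteq> 0" "x \<noteq> 0"
  shows "ptheta (1 / x) q = ptheta (q * x) q"
  using assms by (simp add: ptheta_def mult_ac)

lemma ptheta_reflect:
  assumes "q \<noteq> 0" "x \<noteq> 0"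
  shows "ptheta (q / x) q = ptheta x q"
  using assms by (simp add: ptheta_def mult_ac)

lemma ptheta_1 [simp]: "norm q < 1 \<Longrightarrow> ptheta 1 q = 0"
  using qpoch_inf_shift[of q 1] by (simp add: ptheta_def)

text \<open>\<open>Phi\<close> and \<open>Gam\<close> are \<open>1 + x g(x;q)\<close> and \<open>g(x;q)\<close> multiplied by \<open>ptheta x q\<close>, which clears all poles.
  \<open>Phi\<close> is manifestly invariant under \<open>x \<rightarrow> 1/x\<close> and \<open>Gam\<close> under \<open>x \<rightarrow> q/x\<close>.\<close>

definition Phi :: "complex \<Rightarrow> complex \<Rightarrow> complex" where
  "Phi x q = (\<Sum>n. q ^ (n\<^sup>2) * (qtail x q (Suc n) * qtail (1 / x) q (Suc n)))"

definition Gam :: "complex \<Rightarrow> complex \<Rightarrow> complex" where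
  "Gam x q = (\<Sum>n. q ^ (n\<^sup>2 + n) * (qtail x q (Suc n) * qtail (1 / x) q (Suc (Suc n))))"

lemma power_square_le:
  fixes r :: real
  assumes "0 \<le> r" "r < 1"
  shows "r ^ (n\<^sup>2) \<le> r ^ n"
  using assms by (intro power_decreasing) (auto simp: power2_eq_square)

lemma norm_power_square_le:
  assumes "norm q < 1"
  shows "norm (q ^ (n\<^sup>2) :: complex) \<le> norm q ^ n"
  unfolding norm_power using assms by (intro power_square_le) auto

lemma summable_bounded_coeff:
  fixes c u :: "nat \<Rightarrow> complex"
  assumes "norm q < 1" "\<And>n. norm (c n) \<le> norm (q::complex) ^ n" "\<And>n. norm (u n) \<le> C"
  shows "summable (\<lambda>n. c n * u n)"
proof (rule summable_comparison_test')
  show "summable (\<lambda>n. norm q ^ n * C)"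
    using assms(1) by (intro summable_mult2 summable_geometric) auto
  show "norm (c n * u n) \<le> norm q ^ n * C" if "n \<ge> 0" for n
    unfolding norm_mult by (intro mult_mono assms) auto
qed

lemma norm_qtail_mult_le:
  assumes "norm q < 1"
  shows "norm (qtail x q m * qtail y q n)
         \<le> exp (norm x / (1 - norm q)) * exp (norm y / (1 - norm q))"
  unfolding norm_mult by (intro mult_mono norm_qtail_le assms) auto

lemma norm_power_Gam_le:
  assumes "norm q < 1"
  shows "norm (q ^ (n\<^sup>2 + n) :: complex) \<le> norm q ^ n"
  unfolding norm_power using assms by (intro power_decreasing) auto

lemma summable_Phi:
  assumes "norm q < 1"
  shows "summable (\<lambda>n. q ^ (n\<^sup>2) * (qtail x q (Suc n) * qtail y q (Suc n)))"
  by (rule summable_bounded_coeff[OF assms norm_power_square_le[OF assms] norm_qtail_mult_le[OF assms]])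

lemma summable_Gam:
  assumes "norm q < 1"
  shows "summable (\<lambda>n. q ^ (n\<^sup>2 + n) * (qtail x q (Suc n) * qtail y q (Suc (Suc n))))"
  by (rule summable_bounded_coeff[OF assms norm_power_Gam_le[OF assms] norm_qtail_mult_le[OF assms]])

lemma Phi_inverse: "Phi (1 / x) q = Phi x q"
  by (simp add: Phi_def mult_ac)

lemma Gam_reflect:
  assumes "q \<noteq> 0"
  shows "Gam (q / x) q = Gam x q"
proof -
  have "qtail (q / x) q (Suc n) = qtail (1 / x) q (Suc (Suc n))" for n
    using qtail_mult[of "1 / x" q] by simp
  moreover have "qtail (1 / (q / x)) q (Suc (Suc n)) = qtail x q (Suc n)" for n
    using qtail_divide[OF assms, of x "Suc n"] by simp
  ultimately show ?thesis
    by (simp add: Gam_def mult_ac)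
qed

text \<open>The difference of the two series telescopes: peeling one factor off either tail writes
  its terms as \<open>w n - w (Suc n)\<close>, and \<open>w 0\<close> is
  \<open>ptheta x q\<close>.\<close>

lemma Phi_Gam:
  assumes "norm q < 1" "x \<noteq> 0"
  shows "Phi x q = ptheta x q + x * Gam x q"
proof -
  define w where "w n = q ^ (n\<^sup>2) * (qtail x q n * qtail (1 / x) q (Suc n))" for n
  have "summable w"
    unfolding w_def
    by (rule summable_bounded_coeff[OF assms(1) norm_power_square_le[OF assms(1)] norm_qtail_mult_le[OF assms(1)]])
  then have "(\<lambda>n. w n - w (Suc n)) sums (w 0 - 0)"
    by (intro telescope_sums' summable_LIMSEQ_zero)
  moreover have "(\<lambda>n. q ^ (n\<^sup>2) * (qtail x q (Suc n) * qtail (1 / x) q (Suc n))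
      - x * (q ^ (n\<^sup>2 + n) * (qtail x q (Suc n) * qtail (1 / x) q (Suc (Suc n)))))
      sums (Phi x q - x * Gam x q)"
    unfolding Phi_def Gam_def
    by (intro sums_diff sums_mult summable_sums summable_Phi summable_Gam assms)
  moreover have "q ^ (n\<^sup>2) * (qtail x q (Suc n) * qtail (1 / x) q (Suc n))
      - x * (q ^ (n\<^sup>2 + n) * (qtail x q (Suc n) * qtail (1 / x) q (Suc (Suc n))))
      = w n - w (Suc n)" for n
  proof -
    have "q ^ ((Suc n)\<^sup>2) = q ^ (n\<^sup>2) * q ^ n * q ^ n * q"
      by (simp add: power2_eq_square power_add)
    then show ?thesis
      unfolding w_def qtail_step[OF assms(1), of x n] qtail_step[OF assms(1), of "1 / x" "Suc n"]
      using assms(2) by (simp add: power_add field_simps)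
  qed
  ultimately have "Phi x q - x * Gam x q = w 0"
    using sums_unique2 by force
  then show ?thesis
    by (simp add: w_def ptheta_qtail algebra_simps)
qed

text \<open>Two reflections compose to a shift. \<open>Gam (q * x)\<close> is
  \<open>Gam (1 / x)\<close>, which \<open>Phi_Gam\<close> relates to \<open>Phi (1 / x)\<close>;
  this is \<open>Phi x\<close>, and \<open>Phi_Gam\<close> leads back to
  \<open>Gam x\<close>.\<close>

lemma Gam_shift:
  assumes "norm q < 1" "q \<noteq> 0" "x \<noteq> 0"
  shows "Gam (q * x) q = x\<^sup>2 * Gam x q + (1 + x) * ptheta x q"
proof -
  have "Phi (1 / x) q = ptheta (q * x) q + 1 / x * Gam (q * x) q"
    using Phi_Gam[OF assms(1), of "1 / x"] Gam_reflect[OF assms(2), of "1 / x"] assms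
    by (simp add: ptheta_inverse)
  then have "1 / x * Gam (q * x) q = ptheta x q + x * Gam x q + ptheta x q / x"
    unfolding Phi_inverse Phi_Gam[OF assms(1,3)] ptheta_shift[OF assms] by (simp add: algebra_simps)
  then show ?thesis
    using assms(3) by (simp add: field_simps power2_eq_square)
qed

text \<open>Cauchy's identity, the Durfee square count of partitions. It yields
  \<open>Gam 1 q\<close>, the numerator of \<open>g\<close> at its pole 1. Putting a variable
  \<open>x\<close> into one tail gives a sum with \<open>f x = f (x * q)\<close>, hence
  \<open>f 1\<close> is the limit of \<open>f\<close> along powers of \<open>q\<close>.\<close>

lemma cauchy_durfee:
  assumes "norm q < 1"
  shows "Phi 1 q = qpoch_inf q q"
proof -
  define f where "f x = (\<Sum>n. (q ^ (n\<^sup>2) * x ^ n) * (qtail 1 q (Suc n) * qtail x q (Suc n)))" for x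
  have coeff: "norm (q ^ (n\<^sup>2) * x ^ n) \<le> norm q ^ n" if "norm x \<le> 1" for n and x :: complex
  proof -
    have "norm (q ^ (n\<^sup>2)) * norm x ^ n \<le> norm q ^ n * 1"
      using that by (intro mult_mono norm_power_square_le assms power_le_one) auto
    then show ?thesis by (simp add: norm_mult norm_power)
  qed
  have qx: "norm (x * q) \<le> 1" if "norm x \<le> 1" for x
    using mult_mono[OF that less_imp_le[OF assms]] by (simp add: norm_mult)
  have f_shift: "f x = f (x * q)" if x: "norm x \<le> 1" for x
  proof -
    define w where "w n = (q ^ (n\<^sup>2) * x ^ n) * (qtail 1 q n * qtail x q (Suc n))" for n
    have "summable w"
      unfolding w_def
      by (rule summable_bounded_coeff[OF assms coeff[OF x] norm_qtail_mult_le[OF assms]])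
    then have "(\<lambda>n. w n - w (Suc n)) sums (w 0 - 0)"
      by (intro telescope_sums' summable_LIMSEQ_zero)
    moreover have "w 0 = 0"
      using qtail_step[OF assms, of 1 0] by (simp add: w_def)
    moreover have "(\<lambda>n. (q ^ (n\<^sup>2) * x ^ n) * (qtail 1 q (Suc n) * qtail x q (Suc n))
        - (q ^ (n\<^sup>2) * (x * q) ^ n) * (qtail 1 q (Suc n) * qtail (x * q) q (Suc n)))
        sums (f x - f (x * q))"
      unfolding f_def
      by (intro sums_diff summable_sums summable_bounded_coeff[OF assms coeff norm_qtail_mult_le[OF assms]] x qx)
    moreover have "(q ^ (n\<^sup>2) * x ^ n) * (qtail 1 q (Suc n) * qtail x q (Suc n))
        - (q ^ (n\<^sup>2) * (x * q) ^ n) * (qtail 1 q (Suc n) * qtail (x * q) q (Suc n)) = w n - w (Suc n)" for n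
    proof -
      have "q ^ ((Suc n)\<^sup>2) = q ^ (n\<^sup>2) * q ^ n * q ^ n * q"
        by (simp add: power2_eq_square power_add)
      then show ?thesis
        unfolding w_def qtail_mult qtail_step[OF assms, of 1 n] qtail_step[OF assms, of x "Suc n"]
        by (simp add: power_mult_distrib algebra_simps)
    qed
    ultimately show ?thesis
      using sums_unique2 by force
  qed
  have qk: "norm (q ^ k) \<le> 1" for k
    using assms by (simp add: norm_power power_le_one)
  have const: "f (q ^ k) = f 1" for k
    by (induction k) (use f_shift[OF qk] in \<open>auto simp: mult.commute\<close>)
  \<comment> \<open>At \<open>x = 0\<close> only the summand \<open>n = 0\<close> survives, with
    \<open>0 ^ 0 = 1\<close>.\<close>
  have "(\<lambda>k. f (q ^ k)) \<longlonglongrightarrow> (\<Sum>n. (q ^ (n\<^sup>2) * 0 ^ n) * (qtail 1 q (Suc n) * 1))"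
  proof -
    define C where "C = exp (1 / (1 - norm q)) * exp (1 / (1 - norm q))"
    have q0: "(\<lambda>k. q ^ k) \<longlonglongrightarrow> 0"
      using assms by (rule LIMSEQ_power_zero)
    have cont: "isCont (\<lambda>x. qpoch_inf x q) 0"
      using holomorphic_on_imp_continuous_on[OF holomorphic_qpoch_inf[OF assms]]
      by (simp add: continuous_on_eq_continuous_at)
    have bound: "norm ((q ^ (n\<^sup>2) * (q ^ k) ^ n) * (qtail 1 q (Suc n) * qtail (q ^ k) q (Suc n))) \<le> norm q ^ n * C" for k n
    proof -
      have "norm (qtail (q ^ k) q (Suc n)) \<le> exp (1 / (1 - norm q))"
        using norm_qtail_le[OF assms, of "q ^ k"] qk[of k] assms
        by (meson divide_right_mono diff_ge_0_iff_ge exp_le_cancel_iff less_imp_le order_trans)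
      then have "norm (qtail 1 q (Suc n) * qtail (q ^ k) q (Suc n)) \<le> C"
        unfolding C_def norm_mult using norm_qtail_le[OF assms, of 1]
        by (intro mult_mono) auto
      then show ?thesis
        unfolding norm_mult[of "q ^ (n\<^sup>2) * (q ^ k) ^ n"] by (intro mult_mono coeff qk) auto
    qed
    have "((\<lambda>k. \<Sum>n. (q ^ (n\<^sup>2) * (q ^ k) ^ n) * (qtail 1 q (Suc n) * qtail (q ^ k) q (Suc n)))
       \<longlongrightarrow> (\<Sum>n. (q ^ (n\<^sup>2) * 0 ^ n) * (qtail 1 q (Suc n) * 1))) sequentially"
    proof (rule tannerys_theorem[THEN conjunct2, THEN conjunct2])
      show "\<forall>\<^sub>F (n, k) in at_top \<times>\<^sub>F sequentially.
         norm ((q ^ (n\<^sup>2) * (q ^ k) ^ n) * (qtail 1 q (Suc n) * qtail (q ^ k) q (Suc n))) \<le> norm q ^ n * C"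
        using bound by (intro always_eventually) auto
      show "summable (\<lambda>n. norm q ^ n * C)"
        using assms(1) by (intro summable_mult2 summable_geometric) auto
      show "(\<lambda>k. (q ^ (n\<^sup>2) * (q ^ k) ^ n) * (qtail 1 q (Suc n) * qtail (q ^ k) q (Suc n)))
          \<longlonglongrightarrow> (q ^ (n\<^sup>2) * 0 ^ n) * (qtail 1 q (Suc n) * 1)" for n
      proof -
        have "(\<lambda>k. qpoch_inf (q ^ k * q ^ Suc n) q) \<longlonglongrightarrow> qpoch_inf 0 q"
          by (rule isCont_tendsto_compose[OF cont]) (use tendsto_mult[OF q0 tendsto_const] in force)
        then have "(\<lambda>k. qtail (q ^ k) q (Suc n)) \<longlonglongrightarrow> 1"
          by (simp add: qtail_def)
        then show ?thesis
          by (intro tendsto_intros q0)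
      qed
    qed auto
    then show ?thesis
      by (simp add: f_def)
  qed
  moreover have "(\<Sum>n. (q ^ (n\<^sup>2) * 0 ^ n) * (qtail 1 q (Suc n) * 1)) = qpoch_inf q q"
  proof -
    have "(\<lambda>n. (q ^ (n\<^sup>2) * 0 ^ n) * (qtail 1 q (Suc n) * 1)) sums (\<Sum>n\<in>{0}. (q ^ (n\<^sup>2) * 0 ^ n) * (qtail 1 q (Suc n) * 1))"
      by (rule sums_finite) auto
    then show ?thesis
      by (simp add: sums_iff qtail_def)
  qed
  ultimately have "f 1 = qpoch_inf q q"
    unfolding const by (simp add: LIMSEQ_const_iff)
  then show ?thesis
    by (simp add: f_def Phi_def)
qed

text \<open>Multiplication by \<open>ptheta x q\<close> cancels the finite products in each summand
  and leaves tails, giving \<open>Phi\<close>; the \<open>-1\<close> in the definition of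
  \<open>gmock\<close> removes the \<open>ptheta\<close> of \<open>Phi_Gam\<close>.\<close>

lemma gmock_eq:
  assumes "norm q < 1" "x \<noteq> 0" "ptheta x q \<noteq> 0"
  shows "gmock x q = Gam x q / ptheta x q"
proof -
  have "q ^ (n\<^sup>2) / (qpoch x q (Suc n) * qpoch (q / x) q n)
      = (q ^ (n\<^sup>2) * (qtail x q (Suc n) * qtail (1 / x) q (Suc n))) / ptheta x q" for n
  proof -
    have "ptheta x q = (qpoch x q (Suc n) * qpoch (q / x) q n) * (qtail x q (Suc n) * qtail (1 / x) q (Suc n))"
      unfolding ptheta_def qtail_def
      using qpoch_inf_split[OF assms(1), of x "Suc n"] qpoch_inf_split[OF assms(1), of "q / x" n]
      by (simp add: mult_ac)
    with assms(3) show ?thesis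
      by (auto simp: field_simps)
  qed
  then have "(\<Sum>n. q ^ (n\<^sup>2) / (qpoch x q (Suc n) * qpoch (q / x) q n)) = Phi x q / ptheta x q"
    unfolding Phi_def using summable_Phi[OF assms(1), of x "1 / x"] by (simp add: suminf_divide)
  then show ?thesis
    using assms by (simp add: gmock_def Phi_Gam field_simps)
qed

section \<open>Holomorphy in the punctured plane\<close>

lemma holomorphic_suminf_bounded:
  fixes c :: "nat \<Rightarrow> complex" and u :: "nat \<Rightarrow> complex \<Rightarrow> complex"
  assumes "open S" "norm q < 1" "\<And>n. norm (c n) \<le> norm (q::complex) ^ n"
    and "\<And>n. u n holomorphic_on S"
    and "\<And>K. compact K \<Longrightarrow> K \<subseteq> S \<Longrightarrow> \<exists>C. \<forall>n. \<forall>x\<in>K. norm (u n x) \<le> C"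
  shows "(\<lambda>x. \<Sum>n. c n * u n x) holomorphic_on S"
proof (rule holomorphic_uniform_sequence[OF assms(1)])
  show "(\<lambda>x. \<Sum>k<n. c k * u k x) holomorphic_on S" for n
    by (intro holomorphic_intros assms)
  fix x assume "x \<in> S"
  then obtain d where d: "d > 0" "cball x d \<subseteq> S"
    using assms(1) open_contains_cball by blast
  then obtain C where C: "\<And>n y. y \<in> cball x d \<Longrightarrow> norm (u n y) \<le> C"
    using assms(5)[OF compact_cball] by metis
  have "uniform_limit (cball x d) (\<lambda>n y. \<Sum>k<n. c k * u k y) (\<lambda>y. \<Sum>n. c n * u n y) sequentially"
  proof (rule Weierstrass_m_test)
    show "summable (\<lambda>n. norm q ^ n * C)"
      using assms(2) by (intro summable_mult2 summable_geometric) auto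
    show "norm (c n * u n y) \<le> norm q ^ n * C" if "y \<in> cball x d" for n y
      unfolding norm_mult using C[OF that] by (intro mult_mono assms) auto
  qed
  with d show "\<exists>d>0. cball x d \<subseteq> S \<and>
      uniform_limit (cball x d) (\<lambda>n y. \<Sum>k<n. c k * u k y) (\<lambda>y. \<Sum>n. c n * u n y) sequentially"
    by blast
qed

lemma holomorphic_qtail:
  assumes "norm q < 1" "f holomorphic_on A"
  shows "(\<lambda>x. qtail (f x) q n) holomorphic_on A"
  unfolding qtail_def by (intro holomorphic_intros assms)

lemma qtail_mult_bounded_on_compact:
  assumes "norm q < 1" "compact K" "K \<subseteq> - {0}"
  shows "\<exists>C. \<forall>n. \<forall>x\<in>K. norm (qtail x q (m n) * qtail (1 / x) q (k n)) \<le> C"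
proof -
  define g where "g x = exp (norm x / (1 - norm q)) * exp (norm (1 / x) / (1 - norm q))" for x :: complex
  have "continuous_on K g"
    unfolding g_def using assms by (intro continuous_intros) auto
  then have "bounded (g ` K)"
    by (intro compact_imp_bounded compact_continuous_image assms)
  then obtain C where "\<forall>x\<in>K. norm (g x) \<le> C"
    by (auto simp: bounded_iff)
  then have "\<forall>x\<in>K. g x \<le> C"
    using abs_le_D1 by force
  then have "norm (qtail x q (m n) * qtail (1 / x) q (k n)) \<le> C" if "x \<in> K" for x n
    using norm_qtail_mult_le[OF assms(1), of x "m n" "1 / x" "k n"] that
    unfolding g_def by (meson order_trans)
  then show ?thesis by blast
qed

lemma holomorphic_Gam:
  assumes "norm q < 1"
  shows "(\<lambda>x. Gam x q) holomorphic_on - {0}"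
  unfolding Gam_def
proof (rule holomorphic_suminf_bounded[OF _ assms norm_power_Gam_le[OF assms]])
  show "(\<lambda>x. qtail x q (Suc n) * qtail (1 / x) q (Suc (Suc n))) holomorphic_on - {0}" for n
    by (intro holomorphic_intros holomorphic_qtail assms) auto
qed (use qtail_mult_bounded_on_compact[OF assms] in auto)

lemma holomorphic_ptheta:
  assumes "norm q < 1"
  shows "(\<lambda>x. ptheta x q) holomorphic_on - {0}"
  unfolding ptheta_def by (intro holomorphic_intros assms) auto

section \<open>Quasi-periodic functions on the punctured plane\<close>

text \<open>A simple zero of \<open>g\<close> shared by \<open>f\<close> is a removable singularity
  of \<open>f / g\<close>; the right value there is the quotient of the derivatives.\<close>

lemma holomorphic_quotient_extend:
  assumes "open S" "f holomorphic_on S" "g holomorphic_on S"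
    and zeros: "\<And>z. z \<in> S \<Longrightarrow> g z = 0 \<Longrightarrow> f z = 0 \<and> deriv g z \<noteq> 0"
  obtains h where "h holomorphic_on S" "\<And>z. z \<in> S \<Longrightarrow> f z = h z * g z"
proof -
  define h where "h z = (if g z = 0 then deriv f z / deriv g z else f z / g z)" for z
  have "h field_differentiable at z" if z: "z \<in> S" for z
  proof -
    define U where "U = {w \<in> S. g w \<noteq> 0}"
    have "U = S \<inter> g -` (- {0})"
      by (auto simp: U_def)
    then have "open U"
      using continuous_open_preimage[OF holomorphic_on_imp_continuous_on[OF assms(3)] assms(1)] by auto
    have "f holomorphic_on U" "g holomorphic_on U"
      using assms by (auto simp: U_def intro: holomorphic_on_subset)
    then have "(\<lambda>w. f w / g w) holomorphic_on U"
      by (intro holomorphic_intros) (auto simp: U_def)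
    then have hU: "h holomorphic_on U"
      by (rule holomorphic_transform) (auto simp: U_def h_def)
    show ?thesis
    proof (cases "g z = 0")
      case False
      then show ?thesis
        using holomorphic_on_imp_differentiable_at[OF hU \<open>open U\<close>, of z] z by (simp add: U_def)
    next
      case True
      have fz: "f z = 0" and gz: "deriv g z \<noteq> 0"
        using zeros[OF z True] by auto
      have lf: "((\<lambda>w. (f w - f z) / (w - z)) \<longlongrightarrow> deriv f z) (at z)"
        using holomorphic_derivI[OF assms(2,1) z] by (simp add: has_field_derivative_iff)
      have lg: "((\<lambda>w. (g w - g z) / (w - z)) \<longlongrightarrow> deriv g z) (at z)"
        using holomorphic_derivI[OF assms(3,1) z] by (simp add: has_field_derivative_iff)
      have "\<forall>\<^sub>F w in at z. (g w - g z) / (w - z) \<noteq> 0"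
        using tendsto_imp_eventually_ne[OF lg gz] .
      moreover have "\<forall>\<^sub>F w in at z. w \<in> S"
        using assms(1) z by (simp add: eventually_at_in_open')
      ultimately have ev: "\<forall>\<^sub>F w in at z. w \<in> U"
        by eventually_elim (auto simp: U_def True)
      then obtain d where d: "d > 0" "\<And>w. w \<noteq> z \<Longrightarrow> dist w z < d \<Longrightarrow> w \<in> U"
        by (auto simp: eventually_at)
      have lim: "(h \<longlongrightarrow> h z) (at z)"
      proof (rule Lim_transform_eventually)
        show "((\<lambda>w. ((f w - f z) / (w - z)) / ((g w - g z) / (w - z))) \<longlongrightarrow> h z) (at z)"
          using tendsto_divide[OF lf lg gz] True by (simp add: h_def)
        have "\<forall>\<^sub>F w in at z. w \<noteq> z"
          by (simp add: eventually_at_filter)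
        with ev show "\<forall>\<^sub>F w in at z. ((f w - f z) / (w - z)) / ((g w - g z) / (w - z)) = h w"
          by eventually_elim (auto simp: h_def U_def fz True)
      qed
      have "h holomorphic_on ball z d"
      proof (rule no_isolated_singularity'[where K = "{z}"])
        show "h holomorphic_on ball z d - {z}"
          by (rule holomorphic_on_subset[OF hU]) (auto intro: d simp: dist_commute)
        show "(h \<longlongrightarrow> h w) (at w within ball z d)" if "w \<in> {z}" for w
          using lim that by (auto intro: tendsto_within_subset)
      qed auto
      with d show ?thesis
        by (auto intro: holomorphic_on_imp_differentiable_at)
    qed
  qed
  then have "h holomorphic_on S"
    by (auto simp: holomorphic_on_def intro: field_differentiable_at_within)
  moreover have "f z = h z * g z" if "z \<in> S" for z
    using zeros[OF that] by (auto simp: h_def)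
  ultimately show ?thesis
    using that by blast
qed

text \<open>The multiplier \<open>z\<^sup>2\<close> makes \<open>h\<close> decrease towards both punctures, so that Liouville's theorem applies.\<close>

lemma quasiperiodic_negative_degree_eq_0:
  assumes q: "q \<noteq> 0" "norm q < 1" and h: "h holomorphic_on - {0}"
    and shift: "\<And>z. z \<noteq> 0 \<Longrightarrow> h (q * z) = z\<^sup>2 * h z"
    and z: "z \<noteq> 0"
  shows "h z = 0"
proof -
  have cont: "continuous_on {w. norm q \<le> norm w \<and> norm w \<le> 1} h"
    using holomorphic_on_imp_continuous_on[OF h] by (rule continuous_on_subset) (use q in auto)
  have "{w::complex. norm q \<le> norm w \<and> norm w \<le> 1} = cball 0 1 - ball 0 (norm q)"
    by auto
  then have "compact {w::complex. norm q \<le> norm w \<and> norm w \<le> 1}"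
    by (simp add: compact_diff)
  then have "bounded (h ` {w. norm q \<le> norm w \<and> norm w \<le> 1})"
    using cont by (intro compact_imp_bounded compact_continuous_image)
  then obtain M where M: "norm (h w) \<le> M" if "norm q \<le> norm w" "norm w \<le> 1" for w
    by (auto simp: bounded_iff)
  \<comment> \<open>Inwards from the annulus between \<open>norm q\<close> and 1, each step
    multiplies by a square of norm at most 1.\<close>
  have inner: "norm (h w) \<le> M" if "norm q ^ Suc n \<le> norm w" "norm w \<le> norm q ^ n" for n w
    using that
  proof (induction n arbitrary: w)
    case 0
    then show ?case using M by simp
  next
    case (Suc n)
    have qn: "norm q ^ n \<le> 1"
      using q by (simp add: power_le_one)
    have "0 < norm q ^ Suc (Suc n)"
      using q by simp
    with Suc.prems have w0: "w \<noteq> 0"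
      by auto
    have *: "norm q ^ Suc n \<le> norm (w / q)" "norm (w / q) \<le> norm q ^ n"
      using Suc.prems q by (simp_all add: norm_divide field_simps)
    have "h w = (w / q)\<^sup>2 * h (w / q)"
      using shift[of "w / q"] w0 q by simp
    then have "norm (h w) = norm (w / q) ^ 2 * norm (h (w / q))"
      by (simp add: norm_mult norm_power)
    also have "\<dots> \<le> 1 * M"
      using * qn by (intro mult_mono Suc.IH power_le_one) auto
    finally show ?case by simp
  qed
  have unit: "norm (h w) \<le> M" if "w \<noteq> 0" "norm w \<le> 1" for w
  proof -
    have "\<exists>n. norm q ^ n < norm w"
      using real_arch_pow_inv[of "norm w" "norm q"] that q by auto
    then obtain n where n: "norm q ^ n < norm w" "\<And>k. k < n \<Longrightarrow> \<not> norm q ^ k < norm w"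
      using exists_least_iff[of "\<lambda>n. norm q ^ n < norm w"] by blast
    have "n \<noteq> 0"
      using n(1) that(2) by (intro notI) simp
    then obtain k where "n = Suc k"
      using not0_implies_Suc by blast
    then show ?thesis
      using n(1) n(2)[of k] by (intro inner[of k]) auto
  qed
  \<comment> \<open>Outwards, each step divides by \<open>w\<^sup>2\<close> with
    \<open>norm w > 1\<close>.\<close>
  have outer: "norm (h w) \<le> M" if "w \<noteq> 0" "norm (q ^ n * w) \<le> 1" for n w
    using that
  proof (induction n arbitrary: w)
    case 0
    then show ?case using unit by simp
  next
    case (Suc n)
    show ?case
    proof (cases "norm w \<le> 1")
      case True
      then show ?thesis using unit Suc.prems by simp
    next
      case False
      have "norm (h (q * w)) \<le> M"
        using Suc.prems q by (intro Suc.IH) (auto simp: mult_ac)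
      moreover have "norm (h (q * w)) = norm w ^ 2 * norm (h w)"
        using shift[OF Suc.prems(1)] by (simp add: norm_mult norm_power)
      moreover have "1 * norm (h w) \<le> norm w ^ 2 * norm (h w)"
        using False by (intro mult_right_mono one_le_power) auto
      ultimately show ?thesis by simp
    qed
  qed
  have bound: "norm (h w) \<le> M" if w: "w \<noteq> 0" for w
  proof -
    obtain n where "norm q ^ n < 1 / norm w"
      using real_arch_pow_inv[of "1 / norm w" "norm q"] w q by auto
    then have "norm (q ^ n * w) \<le> 1"
      using w by (simp add: norm_mult norm_power field_simps)
    then show ?thesis
      using outer w by blast
  qed
  have "\<exists>g. g holomorphic_on UNIV \<and> (\<forall>z \<in> UNIV - {0}. g z = h z)"
    using h bound by (subst holomorphic_on_extend_bounded)
      (auto simp: Compl_eq_Diff_UNIV[symmetric] eventually_at_filter intro!: exI[of _ M] always_eventually)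
  then obtain g where g: "g holomorphic_on UNIV" "\<And>w. w \<noteq> 0 \<Longrightarrow> g w = h w"
    by auto
  have "norm (g w) \<le> max M (norm (g 0))" for w
    using bound[of w] g(2)[of w] by (cases "w = 0") auto
  then have "bounded (range g)"
    by (auto simp: bounded_iff)
  then obtain c where c: "g w = c" for w
    using Liouville_theorem[OF g(1)] by (auto simp: constant_on_def)
  \<comment> \<open>The point 2 serves since its multiplier differs from 1, so that a constant
    obeying the shift relation is 0.\<close>
  have "c = 2\<^sup>2 * c"
    using shift[of 2] g(2)[of 2] g(2)[of "q * 2"] q by (simp add: c)
  then have "c = 0"
    by simp
  then show ?thesis
    using g(2)[OF z] c by simp
qed

section \<open>Theta functions and eta products\<close>

lemma jfun_shift:
  assumes "norm q < 1" "q \<noteq> 0" "x \<noteq> 0"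
  shows "jfun (q * x) q = - jfun x q / x"
  by (simp add: jfun_ptheta ptheta_shift[OF assms])

lemma jfun_reflect:
  assumes "q \<noteq> 0" "x \<noteq> 0"
  shows "jfun (q / x) q = jfun x q"
  by (simp add: jfun_ptheta ptheta_reflect[OF assms])

lemma has_sum_int_even_odd:
  fixes f :: "int \<Rightarrow> 'a :: topological_comm_monoid_add"
  assumes "((\<lambda>k. f (2 * k)) has_sum a) UNIV" "((\<lambda>k. f (2 * k + 1)) has_sum b) UNIV"
  shows "(f has_sum (a + b)) UNIV"
proof -
  have "(f has_sum a) (range (\<lambda>k. 2 * k))"
    using assms(1) by (subst has_sum_reindex) (auto simp: inj_on_def o_def)
  moreover have "(f has_sum b) (range (\<lambda>k. 2 * k + 1))"
    using assms(2) by (subst has_sum_reindex) (auto simp: inj_on_def o_def)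
  moreover have "range (\<lambda>k::int. 2 * k) \<inter> range (\<lambda>k. 2 * k + 1) = {}"
    by auto presburger
  ultimately have "(f has_sum (a + b)) (range (\<lambda>k. 2 * k) \<union> range (\<lambda>k. 2 * k + 1))"
    by (rule has_sum_Un_disjoint)
  moreover have "n \<in> range (\<lambda>k. 2 * k) \<union> range (\<lambda>k. 2 * k + 1)" for n :: int
    by (cases "even n") (auto elim!: evenE oddE)
  then have "range (\<lambda>k. 2 * k) \<union> range (\<lambda>k. 2 * k + 1) = (UNIV :: int set)"
    by blast
  ultimately show ?thesis by simp
qed

lemma triangular_even: "2 * k * (2 * k - 1) div 2 = 4 * (k * (k - 1) div 2) + (k::int)"
proof -
  have "even (k * (k - 1))" by simp
  then obtain t where t: "k * (k - 1) = 2 * t" by (elim evenE)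
  have "2 * k * (2 * k - 1) = 2 * (4 * t + k)"
    using t by (simp add: algebra_simps)
  then show ?thesis using t by simp
qed

lemma triangular_odd: "(2 * k + 1) * (2 * k + 1 - 1) div 2 = 4 * (k * (k - 1) div 2) + 3 * (k::int)"
proof -
  have "even (k * (k - 1))" by simp
  then obtain t where t: "k * (k - 1) = 2 * t" by (elim evenE)
  have "(2 * k + 1) * (2 * k + 1 - 1) = 2 * (4 * t + 3 * k)"
    using t by (simp add: algebra_simps)
  then show ?thesis using t by simp
qed

text \<open>Even indices carry no sign, whereas \<open>jterm\<close> at the new argument brings
  \<open>(-1) powi k\<close>; this forces the minus sign inside.\<close>

lemma jterm_even:
  assumes "q \<noteq> 0" "x \<noteq> 0"
  shows "jterm x q (2 * k) = jterm (- (q * x\<^sup>2)) (q ^ 4) k"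
proof -
  have "(-1 :: complex) powi k * (-1) powi k = 1"
    by (simp flip: power_int_mult_distrib)
  then show ?thesis
    unfolding jterm_def triangular_even using assms
    by (simp add: power_int_add power_int_mult power_int_mult_distrib
        minus_mult_left[symmetric] power_int_minus_left flip: power_int_mult_distrib)
qed

lemma jterm_odd:
  assumes "q \<noteq> 0" "x \<noteq> 0"
  shows "jterm x q (2 * k + 1) = - x * jterm (- (q ^ 3 * x\<^sup>2)) (q ^ 4) k"
proof -
  have "(-1 :: complex) powi k * (-1) powi k = 1"
    by (simp flip: power_int_mult_distrib)
  moreover have "(- (q ^ 3 * x\<^sup>2)) powi k = (-1) powi k * (q powi (3 * k) * x powi (2 * k))"
    using power_int_mult_distrib[of "-1" "q ^ 3 * x\<^sup>2" k]
    by (simp add: power_int_mult_distrib power_int_mult)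
  ultimately show ?thesis
    unfolding jterm_def triangular_odd using assms
    by (simp add: power_int_add power_int_mult)
qed

lemma jfun_even_odd:
  assumes "q \<noteq> 0" "norm q < 1" "x \<noteq> 0"
  shows "jfun x q = jfun (- (q * x\<^sup>2)) (q ^ 4) - x * jfun (- (q ^ 3 * x\<^sup>2)) (q ^ 4)"
proof -
  have "(jterm (- (q * x\<^sup>2)) (q ^ 4) has_sum jfun (- (q * x\<^sup>2)) (q ^ 4)) UNIV"
    using assms by (intro jacobi_triple_product norm_power_less_1) auto
  then have e: "((\<lambda>k. jterm x q (2 * k)) has_sum jfun (- (q * x\<^sup>2)) (q ^ 4)) UNIV"
    using assms by (simp add: jterm_even)
  have "(jterm (- (q ^ 3 * x\<^sup>2)) (q ^ 4) has_sum jfun (- (q ^ 3 * x\<^sup>2)) (q ^ 4)) UNIV"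
    using assms by (intro jacobi_triple_product norm_power_less_1) auto
  from has_sum_cmult_right[OF this, of "- x"]
  have o: "((\<lambda>k. jterm x q (2 * k + 1)) has_sum (- x * jfun (- (q ^ 3 * x\<^sup>2)) (q ^ 4))) UNIV"
    using assms by (simp add: jterm_odd)
  have "(jterm x q has_sum (jfun (- (q * x\<^sup>2)) (q ^ 4) + (- x * jfun (- (q ^ 3 * x\<^sup>2)) (q ^ 4)))) UNIV"
    by (rule has_sum_int_even_odd[OF e o])
  from has_sum_unique[OF jacobi_triple_product[OF assms] this] show ?thesis
    by simp
qed

text \<open>Without the factor \<open>q\<^bsup>1/24\<^esup>\<close> of Dedekind's function: \<open>eta (q\<^sup>m)\<close> is \<open>J\<^sub>m\<close>.\<close>

definition eta :: "complex \<Rightarrow> complex" where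
  "eta q = qpoch_inf q q"

lemma eta_nz: "norm q < 1 \<Longrightarrow> eta q \<noteq> 0"
  unfolding eta_def by (rule qpoch_inf_self_nz)

lemma qpoch_inf_mult_neg:
  assumes "norm q < 1"
  shows "qpoch_inf x q * qpoch_inf (- x) q = qpoch_inf (x\<^sup>2) (q\<^sup>2)"
proof (rule LIMSEQ_unique)
  show "(\<lambda>n. qpoch x q n * qpoch (- x) q n) \<longlonglongrightarrow> qpoch_inf x q * qpoch_inf (- x) q"
    by (intro tendsto_intros qpoch_tendsto assms)
  have "qpoch x q n * qpoch (- x) q n = qpoch (x\<^sup>2) (q\<^sup>2) n" for n
    unfolding qpoch_def prod.distrib[symmetric]
    by (intro prod.cong) (auto simp: algebra_simps power2_eq_square power_mult_distrib)
  then show "(\<lambda>n. qpoch x q n * qpoch (- x) q n) \<longlonglongrightarrow> qpoch_inf (x\<^sup>2) (q\<^sup>2)"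
    using norm_power_less_1[OF assms, of 2] by (simp add: qpoch_tendsto)
qed

lemma qpoch_inf_dissect_2:
  assumes "norm q < 1"
  shows "qpoch_inf x q = qpoch_inf x (q\<^sup>2) * qpoch_inf (x * q) (q\<^sup>2)"
  using qpoch_inf_dissect[OF assms, of 2 x] by (simp add: lessThan_nat_numeral numeral_2_eq_2)

lemma eta_odd:
  assumes "norm q < 1"
  shows "qpoch_inf q (q\<^sup>2) * eta (q\<^sup>2) = eta q"
  using qpoch_inf_dissect_2[OF assms, of q] by (simp add: eta_def power2_eq_square)

lemma eta_neg:
  assumes "norm q < 1"
  shows "eta q * qpoch_inf (- q) q = eta (q\<^sup>2)"
  using qpoch_inf_mult_neg[OF assms, of q] by (simp add: eta_def)

lemma qpoch_inf_neg_eta: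
  assumes "norm q < 1"
  shows "qpoch_inf (- q) q = eta (q\<^sup>2) / eta q"
  using eta_neg[OF assms] eta_nz[OF assms] by (simp add: field_simps)

lemma qpoch_inf_odd_eta:
  assumes "norm q < 1"
  shows "qpoch_inf q (q\<^sup>2) = eta q / eta (q\<^sup>2)"
  using eta_odd[OF assms] eta_nz[OF norm_power_less_1[OF assms, of 2]] by (simp add: field_simps)

lemma qpoch_inf_neg_odd_eta:
  assumes "norm q < 1"
  shows "qpoch_inf (- q) (q\<^sup>2) = eta (q\<^sup>2) ^ 2 / (eta q * eta (q ^ 4))"
proof -
  have "qpoch_inf q (q\<^sup>2) * qpoch_inf (- q) (q\<^sup>2) = qpoch_inf (q\<^sup>2) ((q\<^sup>2)\<^sup>2)"
    using norm_power_less_1[OF assms, of 2] by (simp add: qpoch_inf_mult_neg)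
  also have "\<dots> = eta (q\<^sup>2) / eta (q ^ 4)"
    using qpoch_inf_odd_eta[OF norm_power_less_1[OF assms, of 2]] by (simp flip: power_mult)
  finally have "eta q / eta (q\<^sup>2) * qpoch_inf (- q) (q\<^sup>2) = eta (q\<^sup>2) / eta (q ^ 4)"
    unfolding qpoch_inf_odd_eta[OF assms] .
  moreover have "eta q \<noteq> 0" "eta (q\<^sup>2) \<noteq> 0" "eta (q ^ 4) \<noteq> 0"
    using norm_power_less_1[OF assms] by (auto intro!: eta_nz assms)
  ultimately show ?thesis
    by (simp add: divide_simps power2_eq_square mult_ac)
qed

text \<open>Once the factor \<open>1 + u\<close> is split off, the two products have the opposite
  arguments \<open>q * u\<close> and \<open>- (q * u)\<close>, so they merge into one product in
  \<open>q\<^sup>2\<close>.\<close>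

lemma jfun_neg_imaginary_unit:
  assumes q: "norm q < 1" and u: "u\<^sup>2 = -1"
  shows "jfun (- u) q = (1 + u) * eta (q ^ 4) * eta q / eta (q\<^sup>2)"
proof -
  have u0: "u \<noteq> 0" using u by auto
  have "q / (- u) = q * u"
    using u u0 by (simp add: field_simps power2_eq_square)
  then have "jfun (- u) q = (1 + u) * (qpoch_inf (q * u) q * qpoch_inf (- (q * u)) q) * eta q"
    using qpoch_inf_shift[OF q, of "- u"] by (simp add: jfun_def eta_def mult_ac)
  also have "qpoch_inf (q * u) q * qpoch_inf (- (q * u)) q = qpoch_inf (- (q\<^sup>2)) (q\<^sup>2)"
    using qpoch_inf_mult_neg[OF q, of "q * u"] u by (simp add: power_mult_distrib)
  also have "\<dots> = eta (q ^ 4) / eta (q\<^sup>2)"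
    using qpoch_inf_neg_eta[OF norm_power_less_1[OF q, of 2]] by (simp flip: power_mult)
  finally show ?thesis by simp
qed

text \<open>Here the two arguments are opposite from the start.\<close>

lemma jfun_neg_imaginary_unit_mult:
  assumes q: "norm q < 1" "q \<noteq> 0" and u: "u\<^sup>2 = -1"
  shows "jfun (- (q * u)) (q\<^sup>2) = eta (q ^ 4) ^ 2 / eta (q ^ 8)"
proof -
  have u0: "u \<noteq> 0" using u by auto
  have q2: "norm (q\<^sup>2) < 1" "norm (q ^ 4) < 1" "norm (q ^ 8) < 1"
    using q by (auto intro: norm_power_less_1)
  have "q\<^sup>2 / (- (q * u)) = q * u"
    using u u0 q by (simp add: field_simps power2_eq_square)
  then have "jfun (- (q * u)) (q\<^sup>2) = (qpoch_inf (q * u) (q\<^sup>2) * qpoch_inf (- (q * u)) (q\<^sup>2)) * eta (q\<^sup>2)"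
    by (simp add: jfun_def eta_def mult_ac)
  also have "qpoch_inf (q * u) (q\<^sup>2) * qpoch_inf (- (q * u)) (q\<^sup>2) = qpoch_inf (- (q\<^sup>2)) ((q\<^sup>2)\<^sup>2)"
    using qpoch_inf_mult_neg[OF q2(1), of "q * u"] u by (simp add: power_mult_distrib)
  also have "\<dots> = eta (q ^ 4) ^ 2 / (eta (q\<^sup>2) * eta (q ^ 8))"
    using qpoch_inf_neg_odd_eta[OF q2(1)] by (simp flip: power_mult)
  finally show ?thesis
    using eta_nz[OF q2(1)] by simp
qed

section \<open>Dissection of the universal mock theta function\<close>

lemma ptheta_dissect_4:
  assumes "q \<noteq> 0" "norm q < 1" "x \<noteq> 0"
  shows "ptheta x q = ptheta x (q ^ 4) * ptheta (x * q) (q ^ 4) * ptheta (x * q\<^sup>2) (q ^ 4) * ptheta (x * q ^ 3) (q ^ 4)"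
proof -
  have "{..<4::nat} = {0, 1, 2, 3}" by auto
  then have d: "qpoch_inf y q = qpoch_inf y (q ^ 4) * qpoch_inf (y * q) (q ^ 4)
      * qpoch_inf (y * q\<^sup>2) (q ^ 4) * qpoch_inf (y * q ^ 3) (q ^ 4)" for y
    using qpoch_inf_dissect[OF assms(2), of 4 y] by (simp add: mult_ac)
  \<comment> \<open>The residue classes of the product at \<open>q / x\<close> occur in reverse
    order.\<close>
  have e: "q ^ 4 / (x * q ^ 3) = q / x" "q ^ 4 / (x * q\<^sup>2) = q / x * q"
    "q ^ 4 / (x * q) = q / x * q\<^sup>2" "q ^ 4 / x = q / x * q ^ 3"
    using assms by (simp_all add: field_simps eval_nat_numeral)
  show ?thesis
    unfolding ptheta_def e d[of x] d[of "q / x"] by (simp only: mult_ac)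
qed

lemma ptheta_nz:
  assumes "norm q < 1" "q \<noteq> 0" "x \<noteq> 0" "\<And>n. x \<noteq> q powi n"
  shows "ptheta x q \<noteq> 0"
proof
  assume "ptheta x q = 0"
  then consider i where "q ^ i * x = 1" | i where "q ^ i * (q / x) = 1"
    by (auto simp: ptheta_def qpoch_inf_eq_0_iff[OF assms(1)])
  then show False
  proof cases
    case 1
    then have "x = q powi (- int i)"
      using assms by (simp add: field_simps power_int_minus)
    then show False using assms(4) by blast
  next
    case 2
    then have "x = q ^ Suc i"
      using assms by (simp add: field_simps)
    then have "x = q powi int (Suc i)"
      by (simp only: power_int_of_nat)
    then show False using assms(4) by blast
  qed
qed

locale nome =
  fixes q :: complex
  assumes q0: "q \<noteq> 0" and q1: "norm q < 1"
begin

lemma norm_pow: "n > 0 \<Longrightarrow> norm (q ^ n) < 1"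
  using norm_power_less_1[OF q1] .

lemma pow_nz: "q ^ n \<noteq> 0"
  using q0 by simp

definition P :: "nat \<Rightarrow> complex \<Rightarrow> complex" where
  "P j z = ptheta (- (q ^ j * z ^ 4)) (q ^ 16)"

definition G :: "nat \<Rightarrow> complex \<Rightarrow> complex" where
  "G j z = Gam (- (q ^ j * z ^ 4)) (q ^ 16)"

text \<open>The common denominator of the four mock theta terms: its dissection modulo 4 is the
  product of the four \<open>P\<close>.\<close>

definition D :: "complex \<Rightarrow> complex" where
  "D z = ptheta (- (q ^ 2 * z ^ 4)) (q ^ 4)"

text \<open>The two coefficients are forced by the requirement that \<open>defect\<close> vanish where \<open>D\<close> does.\<close>

definition thetapart :: "complex \<Rightarrow> complex" where
  "thetapart z =
     - (eta (q ^ 4) ^ 5 / (eta (q ^ 8) ^ 2 * eta (q ^ 2))) * jfun (- (q * z\<^sup>2)) (q\<^sup>2)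
     + eta (q ^ 4) * eta (q ^ 8) ^ 3 / eta (q ^ 16) ^ 2 * z * jfun (- (q\<^sup>2 * z\<^sup>2)) (q\<^sup>2)"

text \<open>\<open>defect z = 0\<close> is the dissection of \<open>g(z;q)\<close> into \<open>g(-q\<^sup>kz\<^sup>4;q\<^bsup>16\<^esup>)\<close>, \<open>k = 2, 6, 10, 14\<close>,
  multiplied by \<open>ptheta z q * D z\<close>. The powers of \<open>z\<close> make the four terms permute under \<open>z \<rightarrow> qz\<close>.\<close>

definition defect :: "complex \<Rightarrow> complex" where
  "defect z = Gam z q * D z + ptheta z q * D z / z ^ 2
     + ptheta z q * (q ^ 2 * z ^ 3 * G 2 z * P 6 z * P 10 z * P 14 z
                   - q ^ 5 * G 6 z * P 2 z * P 10 z * P 14 z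
                   + q ^ 5 / z ^ 3 * G 10 z * P 2 z * P 6 z * P 14 z
                   - q ^ 2 / z ^ 6 * G 14 z * P 2 z * P 6 z * P 10 z)
     - thetapart z / (z * eta q * eta (q ^ 4))"

lemma arg_mult: "- (q ^ k * z ^ 4 * q ^ m) = - (q ^ (k + m) * z ^ 4)"
  by (simp add: power_add)

lemma arg_shift: "- (q ^ k * (q * z) ^ 4) = - (q ^ (k + 4) * z ^ 4)"
  by (simp add: power_add power_mult_distrib)

lemma D_prod: "z \<noteq> 0 \<Longrightarrow> D z = P 2 z * P 6 z * P 10 z * P 14 z"
  using ptheta_dissect_4[OF pow_nz norm_pow, of 4 "- (q ^ 2 * z ^ 4)"] q0
  by (simp add: D_def P_def arg_mult flip: power_mult)

lemma P_shift:
  "P 2 (q * z) = P 6 z" "P 6 (q * z) = P 10 z" "P 10 (q * z) = P 14 z"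
  by (simp_all add: P_def arg_shift)

lemma G_shift:
  "G 2 (q * z) = G 6 z" "G 6 (q * z) = G 10 z" "G 10 (q * z) = G 14 z"
  by (simp_all add: G_def arg_shift)

lemma arg_wrap: "- (q ^ 14 * (q * z) ^ 4) = q ^ 16 * (- (q ^ 2 * z ^ 4))"
  by (simp add: power_mult_distrib flip: power_add)

lemma P_wrap: "z \<noteq> 0 \<Longrightarrow> P 14 (q * z) = P 2 z / (q ^ 2 * z ^ 4)"
  unfolding P_def arg_wrap using ptheta_shift[OF norm_pow pow_nz, of 16 "- (q ^ 2 * z ^ 4)"] q0
  by simp

text \<open>The exponent 18 is 2 plus one full period 16. Among the four \<open>G\<close> only this
  one picks up the inhomogeneous term of \<open>Gam_shift\<close>.\<close>

lemma G_wrap: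
  "z \<noteq> 0 \<Longrightarrow> G 14 (q * z) = q ^ 4 * z ^ 8 * G 2 z + (1 - q ^ 2 * z ^ 4) * P 2 z"
  unfolding P_def G_def arg_wrap using Gam_shift[OF norm_pow pow_nz, of 16 "- (q ^ 2 * z ^ 4)"] q0
  by (simp add: power_mult_distrib flip: power_mult)

lemma D_shift: "z \<noteq> 0 \<Longrightarrow> D (q * z) = D z / (q ^ 2 * z ^ 4)"
  using q0 by (simp add: D_prod P_shift P_wrap mult_ac)

lemma thetapart_shift:
  assumes "z \<noteq> 0"
  shows "thetapart (q * z) = thetapart z / (q * z\<^sup>2)"
proof -
  have n: "norm (q\<^sup>2) < 1" by (rule norm_pow) simp
  have e: "- (q * (q * z)\<^sup>2) = q\<^sup>2 * (- (q * z\<^sup>2))" "- (q\<^sup>2 * (q * z)\<^sup>2) = q\<^sup>2 * (- (q\<^sup>2 * z\<^sup>2))"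
    by (simp_all add: power_mult_distrib mult_ac)
  have "jfun (- (q * (q * z)\<^sup>2)) (q\<^sup>2) = jfun (- (q * z\<^sup>2)) (q\<^sup>2) / (q * z\<^sup>2)"
    using jfun_shift[OF n pow_nz, of "- (q * z\<^sup>2)"] assms q0 unfolding e by simp
  moreover have "jfun (- (q\<^sup>2 * (q * z)\<^sup>2)) (q\<^sup>2) = jfun (- (q\<^sup>2 * z\<^sup>2)) (q\<^sup>2) / (q\<^sup>2 * z\<^sup>2)"
    using jfun_shift[OF n pow_nz, of "- (q\<^sup>2 * z\<^sup>2)"] assms q0 unfolding e by simp
  ultimately have "thetapart (q * z) =
      - (eta (q ^ 4) ^ 5 / (eta (q ^ 8) ^ 2 * eta (q ^ 2))) * (jfun (- (q * z\<^sup>2)) (q\<^sup>2) / (q * z\<^sup>2))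
      + eta (q ^ 4) * eta (q ^ 8) ^ 3 / eta (q ^ 16) ^ 2 * (q * z) * (jfun (- (q\<^sup>2 * z\<^sup>2)) (q\<^sup>2) / (q\<^sup>2 * z\<^sup>2))"
    by (simp only: thetapart_def)
  moreover have "- a * (j / (q * z\<^sup>2)) + b * (q * z) * (k / (q\<^sup>2 * z\<^sup>2)) = (- a * j + b * z * k) / (q * z\<^sup>2)" for a b j k
    using q0 assms by (simp add: field_simps power2_eq_square)
  ultimately show ?thesis
    by (simp only: thetapart_def)
qed

text \<open>Inhomogeneous terms arise from \<open>Gam_shift\<close> at \<open>z\<close> and from
  \<open>G_wrap\<close>; the summand with \<open>1 / z ^ 2\<close> in \<open>defect\<close>
  compensates both. With all function values named, a rational identity remains.\<close>

lemma defect_shift: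
  assumes "z \<noteq> 0"
  shows "defect (q * z) = defect z / (q\<^sup>2 * z\<^sup>2)"
proof -
  define a b c d where abcd: "a = P 2 z" "b = P 6 z" "c = P 10 z" "d = P 14 z"
  define A B C E where ABCE: "A = G 2 z" "B = G 6 z" "C = G 10 z" "E = G 14 z"
  define p g where pg: "p = ptheta z q" "g = Gam z q"
  define t where t: "t = thetapart z / (eta q * eta (q ^ 4))"
  have "defect (q * z) = (z\<^sup>2 * g + (1 + z) * p) * (a * b * c * d / (q\<^sup>2 * z ^ 4))
      + (- p / z) * (a * b * c * d / (q\<^sup>2 * z ^ 4)) / (q * z)\<^sup>2
      + (- p / z) * (q\<^sup>2 * (q * z) ^ 3 * B * c * d * (a / (q\<^sup>2 * z ^ 4))
         - q ^ 5 * C * b * d * (a / (q\<^sup>2 * z ^ 4))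
         + q ^ 5 / (q * z) ^ 3 * E * b * c * (a / (q\<^sup>2 * z ^ 4))
         - q\<^sup>2 / (q * z) ^ 6 * (q ^ 4 * z ^ 8 * A + (1 - q\<^sup>2 * z ^ 4) * a) * b * c * d)
      - t / (q * z\<^sup>2) / (q * z)"
    unfolding defect_def D_shift[OF assms] D_prod[OF assms] P_shift G_shift P_wrap[OF assms] G_wrap[OF assms]
      ptheta_shift[OF q1 q0 assms] Gam_shift[OF q1 q0 assms] thetapart_shift[OF assms] abcd ABCE pg t
    by simp
  also have "\<dots> = (g * (a * b * c * d) + p * (a * b * c * d) / z\<^sup>2
      + p * (q\<^sup>2 * z ^ 3 * A * b * c * d - q ^ 5 * B * a * c * d + q ^ 5 / z ^ 3 * C * a * b * d
             - q\<^sup>2 / z ^ 6 * E * a * b * c) - t / z) / (q\<^sup>2 * z\<^sup>2)"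
    using assms q0 by (simp add: divide_simps) algebra
  also have "\<dots> = defect z / (q\<^sup>2 * z\<^sup>2)"
    unfolding defect_def D_prod[OF assms] abcd ABCE pg t by (simp add: mult_ac)
  finally show ?thesis .
qed

lemma holomorphic_arg:
  assumes "f holomorphic_on - {0}"
  shows "(\<lambda>z. f (- (q ^ n * z ^ 4))) holomorphic_on - {0}"
proof -
  have "(f \<circ> (\<lambda>z. - (q ^ n * z ^ 4))) holomorphic_on - {0}"
    using assms by (rule holomorphic_on_compose_gen[rotated]) (use q0 in \<open>auto intro!: holomorphic_intros\<close>)
  then show ?thesis
    by (simp add: o_def)
qed

lemma holomorphic_D: "D holomorphic_on - {0}"
  unfolding D_def by (intro holomorphic_arg holomorphic_ptheta norm_pow) auto

lemma holomorphic_defect: "defect holomorphic_on - {0}"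
proof -
  have P: "P j holomorphic_on - {0}" for j
    unfolding P_def by (intro holomorphic_arg holomorphic_ptheta norm_pow) auto
  have G: "G j holomorphic_on - {0}" for j
    unfolding G_def by (intro holomorphic_arg holomorphic_Gam norm_pow) auto
  have j: "(\<lambda>z. jfun (- (q ^ n * z\<^sup>2)) (q\<^sup>2)) holomorphic_on - {0}" for n
    unfolding jfun_def by (intro holomorphic_intros norm_pow) (use q0 in auto)
  show ?thesis
    unfolding defect_def thetapart_def
    using eta_nz[OF q1] eta_nz[OF norm_pow[of 4]] eta_nz[OF norm_pow[of 8]] eta_nz[OF norm_pow[of 2]]
      eta_nz[OF norm_pow[of 16]] j[of 1]
    by (intro holomorphic_intros holomorphic_D P G j holomorphic_ptheta holomorphic_Gam q1) auto
qed

text \<open>With \<open>u = q * z\<^sup>2\<close> a square root of -1, both theta functions in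
  \<open>thetapart\<close> and both halves of the even/odd splitting of \<open>jfun z q\<close> are
  eta quotients. The coefficients of \<open>thetapart\<close> make the two combinations proportional
  for either \<open>u\<close> and either sign of \<open>z\<close>.\<close>

lemma thetapart_at_pole:
  assumes z: "q\<^sup>2 * z ^ 4 = -1"
  shows "thetapart z = - jfun z q * eta (q ^ 4) ^ 3 / eta (q ^ 16)"
proof -
  define u where "u = q * z\<^sup>2"
  have u: "u\<^sup>2 = -1"
    using z by (simp add: u_def power_mult_distrib flip: power_mult)
  have z0: "z \<noteq> 0"
    using z by auto
  have nz: "eta q \<noteq> 0" "eta (q\<^sup>2) \<noteq> 0" "eta (q ^ 4) \<noteq> 0" "eta (q ^ 8) \<noteq> 0" "eta (q ^ 16) \<noteq> 0"
    by (auto intro!: eta_nz q1 norm_pow)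
  have "jfun (- (q * z\<^sup>2)) (q ^ 4) = (1 + u) * eta (q ^ 16) * eta (q ^ 4) / eta (q ^ 8)"
    using jfun_neg_imaginary_unit[OF norm_pow u, of 4] by (simp add: u_def flip: power_mult)
  moreover have "jfun (- (q ^ 3 * z\<^sup>2)) (q ^ 4) = eta (q ^ 8) ^ 2 / eta (q ^ 16)"
  proof -
    have "q ^ 3 * z\<^sup>2 = q\<^sup>2 * u"
      by (simp add: u_def eval_nat_numeral)
    then show ?thesis
      using jfun_neg_imaginary_unit_mult[OF norm_pow pow_nz u, of 2] by (simp flip: power_mult)
  qed
  ultimately have "jfun z q = (1 + u) * eta (q ^ 16) * eta (q ^ 4) / eta (q ^ 8) - z * (eta (q ^ 8) ^ 2 / eta (q ^ 16))"
    using jfun_even_odd[OF q0 q1 z0] by simp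
  moreover have "jfun (- (q * z\<^sup>2)) (q\<^sup>2) = (1 + u) * eta (q ^ 8) * eta (q\<^sup>2) / eta (q ^ 4)"
    using jfun_neg_imaginary_unit[OF norm_pow u, of 2] by (simp add: u_def flip: power_mult)
  moreover have "jfun (- (q\<^sup>2 * z\<^sup>2)) (q\<^sup>2) = eta (q ^ 4) ^ 2 / eta (q ^ 8)"
  proof -
    have "q\<^sup>2 * z\<^sup>2 = q * u"
      by (simp add: u_def power2_eq_square)
    then show ?thesis
      using jfun_neg_imaginary_unit_mult[OF q1 q0 u] by simp
  qed
  ultimately show ?thesis
    unfolding thetapart_def using nz by (simp add: divide_simps) algebra
qed

text \<open>As \<open>P 2 z\<close> and \<open>D z\<close> vanish, only the term with
  \<open>G 2 z\<close> and the theta part survive. The former is explicit by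
  \<open>cauchy_durfee\<close>, and the two add up to a multiple of
  \<open>q\<^sup>2 * z ^ 4 + 1\<close>.\<close>

lemma defect_at_pole:
  assumes z: "q\<^sup>2 * z ^ 4 = -1"
  shows "defect z = 0"
proof -
  have z0: "z \<noteq> 0"
    using z by auto
  have nz: "eta q \<noteq> 0" "eta (q ^ 4) \<noteq> 0" "eta (q ^ 16) \<noteq> 0"
    by (auto intro!: eta_nz q1 norm_pow)
  have arg: "- (q ^ (2 + j) * z ^ 4) = q ^ j" for j
  proof -
    have "- (q ^ (2 + j) * z ^ 4) = - (q\<^sup>2 * z ^ 4) * q ^ j"
      by (simp add: power_add power2_eq_square)
    then show ?thesis using z by simp
  qed
  note args = arg[of 0, simplified] arg[of 4, simplified] arg[of 8, simplified] arg[of 12, simplified]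
  have P0: "P 2 z = 0"
    unfolding P_def args using norm_pow[of 16] by simp
  have D0: "D z = 0"
    using P0 z0 by (simp add: D_prod)
  have G0: "G 2 z = eta (q ^ 16)"
    unfolding G_def args
    using Phi_Gam[OF norm_pow, of 16 1] cauchy_durfee[OF norm_pow, of 16] norm_pow[of 16]
    by (simp add: eta_def)
  have "P 6 z * P 10 z * P 14 z = (eta (q ^ 4) / eta (q ^ 16)) ^ 2"
  proof -
    have [simp]: "{..<4::nat} = {0, 1, 2, 3}" by auto
    have "eta (q ^ 4) = qpoch_inf (q ^ 4) (q ^ 16) * qpoch_inf (q ^ 8) (q ^ 16) * qpoch_inf (q ^ 12) (q ^ 16) * eta (q ^ 16)"
      using qpoch_inf_dissect[OF norm_pow, of 4 4 "q ^ 4"]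
      by (simp add: eta_def mult_ac flip: power_mult power_add)
    moreover have "q ^ 16 / q ^ 4 = q ^ 12" "q ^ 16 / q ^ 8 = q ^ 8" "q ^ 16 / q ^ 12 = q ^ 4"
      using q0 by (simp_all add: field_simps flip: power_add)
    ultimately show ?thesis
      unfolding P_def args ptheta_def using nz by (simp add: field_simps power2_eq_square)
  qed
  then have "defect z = ptheta z q * (q\<^sup>2 * z ^ 3 * eta (q ^ 16) * (eta (q ^ 4) / eta (q ^ 16)) ^ 2)
      - thetapart z / (z * eta q * eta (q ^ 4))"
    unfolding defect_def P0 D0 G0 by (simp add: mult.assoc)
  also have "\<dots> = ptheta z q * eta (q ^ 4) ^ 2 / (z * eta (q ^ 16)) * (q\<^sup>2 * z ^ 4 + 1)"
    unfolding thetapart_at_pole[OF z] jfun_ptheta eta_def[symmetric] using nz z0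
    by (simp add: field_simps eval_nat_numeral)
  finally show ?thesis
    using z by simp
qed

text \<open>The single vanishing factor is split off; the cofactor \<open>U\<close> takes the
  nonzero value \<open>eta (q ^ 4) ^ 2\<close>.\<close>

lemma D_deriv_at_pole:
  assumes z: "q\<^sup>2 * z ^ 4 = -1"
  shows "deriv D z \<noteq> 0"
proof -
  have z0: "z \<noteq> 0"
    using z by auto
  define U where "U w = qpoch_inf (q ^ 4 * (- (q\<^sup>2 * w ^ 4))) (q ^ 4) * qpoch_inf (q ^ 4 / (- (q\<^sup>2 * w ^ 4))) (q ^ 4)" for w
  have D: "D w = (1 + q\<^sup>2 * w ^ 4) * U w" for w
    using qpoch_inf_shift[OF norm_pow, of 4 "- (q\<^sup>2 * w ^ 4)"]
    by (simp add: D_def ptheta_def U_def)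
  have "U holomorphic_on - {0}"
    unfolding U_def by (intro holomorphic_intros norm_pow) (use q0 in auto)
  then have "(U has_field_derivative deriv U z) (at z)"
    by (rule holomorphic_derivI) (use z0 in auto)
  then have "((\<lambda>w. (1 + q\<^sup>2 * w ^ 4) * U w) has_field_derivative
      (q\<^sup>2 * (4 * z ^ 3)) * U z + (1 + q\<^sup>2 * z ^ 4) * deriv U z) (at z)"
    by (auto intro!: derivative_eq_intros)
  then have "deriv D z = (q\<^sup>2 * (4 * z ^ 3)) * U z"
    using z by (intro DERIV_imp_deriv) (simp add: D[abs_def])
  moreover have "U z = eta (q ^ 4) ^ 2"
    using z by (simp add: U_def eta_def power2_eq_square)
  ultimately show ?thesis
    using z0 q0 eta_nz[OF norm_pow, of 4] by simp
qed

text \<open>Under \<open>z -> q * z\<close> both functions change by nonvanishing factors, and at a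
  zero of \<open>D\<close> the derivative of such a factor drops out of
  \<open>deriv D\<close>.\<close>

lemma zero_transfer:
  assumes "z \<noteq> 0"
  shows "D z = 0 \<and> defect z = 0 \<and> deriv D z \<noteq> 0 \<longleftrightarrow>
         D (q * z) = 0 \<and> defect (q * z) = 0 \<and> deriv D (q * z) \<noteq> 0"
proof -
  have "D (q * z) = 0 \<longleftrightarrow> D z = 0" "defect (q * z) = 0 \<longleftrightarrow> defect z = 0"
    using assms q0 by (simp_all add: D_shift defect_shift)
  moreover have "deriv D (q * z) = 0 \<longleftrightarrow> deriv D z = 0" if Dz: "D z = 0"
  proof -
    have "(D has_field_derivative deriv D (q * z)) (at (q * z))"
      by (rule holomorphic_derivI[OF holomorphic_D]) (use assms q0 in auto)
    moreover have "((\<lambda>w. q * w) has_field_derivative q) (at z)"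
      by (auto intro!: derivative_eq_intros)
    ultimately have 1: "((\<lambda>w. D (q * w)) has_field_derivative deriv D (q * z) * q) (at z)"
      by (rule DERIV_chain2)
    have "(D has_field_derivative deriv D z) (at z)"
      by (rule holomorphic_derivI[OF holomorphic_D]) (use assms in auto)
    then have "((\<lambda>w. D w / (q\<^sup>2 * w ^ 4)) has_field_derivative deriv D z / (q\<^sup>2 * z ^ 4)) (at z)"
      using assms q0 Dz by (auto intro!: derivative_eq_intros simp: field_simps)
    then have 2: "((\<lambda>w. D (q * w)) has_field_derivative deriv D z / (q\<^sup>2 * z ^ 4)) (at z)"
      by (rule has_field_derivative_transform_within_open[where S = "- {0}"])
        (use assms in \<open>auto simp: D_shift\<close>)
    show ?thesis
      using DERIV_unique[OF 1 2] q0 assms by auto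
  qed
  ultimately show ?thesis by auto
qed

lemma D_zero_power: "z \<noteq> 0 \<Longrightarrow> D (q ^ n * z) = 0 \<longleftrightarrow> D z = 0"
  by (induction n) (use q0 in \<open>simp_all add: D_shift mult.assoc\<close>)

lemma zero_transfer_power:
  assumes "z \<noteq> 0"
  shows "D z = 0 \<and> defect z = 0 \<and> deriv D z \<noteq> 0 \<longleftrightarrow>
         D (q ^ n * z) = 0 \<and> defect (q ^ n * z) = 0 \<and> deriv D (q ^ n * z) \<noteq> 0"
proof (induction n)
  case (Suc n)
  have "q ^ n * z \<noteq> 0"
    using assms q0 by simp
  from zero_transfer[OF this] Suc show ?case
    by (simp add: mult.assoc)
qed simp

text \<open>Each zero of \<open>D\<close> is a power of \<open>q\<close> away from a solution of
  \<open>q\<^sup>2 * z ^ 4 = -1\<close>: a zero of the first infinite product reaches it by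
  multiplying with \<open>q ^ i\<close>, one of the second by dividing by
  \<open>q ^ Suc i\<close>.\<close>

lemma D_zero:
  assumes "z \<noteq> 0" "D z = 0"
  shows "defect z = 0 \<and> deriv D z \<noteq> 0"
proof -
  consider i where "(q ^ 4) ^ i * (- (q\<^sup>2 * z ^ 4)) = 1"
    | i where "(q ^ 4) ^ i * (q ^ 4 / (- (q\<^sup>2 * z ^ 4))) = 1"
    using assms(2) norm_pow[of 4] by (auto simp: D_def ptheta_def qpoch_inf_eq_0_iff)
  then show ?thesis
  proof cases
    case 1
    have p4: "(q ^ 4) ^ i = (q ^ i) ^ 4"
      by (simp flip: power_mult add: mult.commute)
    have "q\<^sup>2 * (q ^ i * z) ^ 4 = - ((q ^ 4) ^ i * (- (q\<^sup>2 * z ^ 4)))"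
      unfolding p4 by (simp add: power_mult_distrib)
    also have "\<dots> = -1"
      unfolding 1 ..
    finally have "q\<^sup>2 * (q ^ i * z) ^ 4 = -1" .
    from defect_at_pole[OF this] D_deriv_at_pole[OF this] show ?thesis
      using zero_transfer_power[OF assms(1), of i] D_zero_power[OF assms(1), of i] assms(2) by blast
  next
    case 2
    define w where "w = z / q ^ Suc i"
    have w0: "w \<noteq> 0"
      using assms q0 by (simp add: w_def)
    have "(q ^ 4) ^ i * q ^ 4 = (q ^ 4) ^ Suc i"
      by simp
    also have "\<dots> = (q ^ Suc i) ^ 4"
      by (simp only: power_mult[symmetric] mult.commute)
    finally have "(q ^ 4) ^ i * q ^ 4 = (q ^ Suc i) ^ 4" .
    moreover have "(q ^ 4) ^ i * q ^ 4 / (- (q\<^sup>2 * z ^ 4)) = 1"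
      using 2 by simp
    moreover have "- (q\<^sup>2 * z ^ 4) \<noteq> 0"
      using assms q0 by simp
    ultimately have "(q ^ Suc i) ^ 4 = - (q\<^sup>2 * z ^ 4)"
      using right_inverse_eq by metis
    then have "q\<^sup>2 * w ^ 4 = -1"
      using q0 assms(1) by (simp add: w_def power_divide)
    from defect_at_pole[OF this] D_deriv_at_pole[OF this] show ?thesis
      using zero_transfer_power[OF w0, of "Suc i"] D_zero_power[OF w0, of "Suc i"] assms(2) q0
      by (simp add: w_def)
  qed
qed

theorem defect_eq_0:
  assumes "z \<noteq> 0"
  shows "defect z = 0"
proof -
  obtain h where h: "h holomorphic_on - {0}" "\<And>z. z \<noteq> 0 \<Longrightarrow> defect z = h z * D z"
    using holomorphic_quotient_extend[of "- {0}" defect D] holomorphic_defect holomorphic_D D_zero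
    by auto
  have shift: "h (q * z) = z\<^sup>2 * h z" if z: "z \<noteq> 0" for z
  proof -
    have eq: "h (q * w) = w\<^sup>2 * h w" if "w \<noteq> 0" "D w \<noteq> 0" for w
    proof -
      have "h (q * w) * D (q * w) = h w * D w / (q\<^sup>2 * w\<^sup>2)"
        using h(2)[of "q * w"] h(2)[of w] defect_shift[of w] that q0 by simp
      then show ?thesis
        using that q0 by (simp add: D_shift field_simps eval_nat_numeral)
    qed
    show ?thesis
    proof (cases "D z = 0")
      case False
      then show ?thesis using eq z by simp
    next
      case True
      \<comment> \<open>The relation extends to a zero of \<open>D\<close> by continuity: the zero
        is simple, so nearby points are not zeros.\<close>
      define f where "f w = h (q * w) - w\<^sup>2 * h w" for w
      have "((\<lambda>w. (D w - D z) / (w - z)) \<longlongrightarrow> deriv D z) (at z)"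
        using holomorphic_derivI[OF holomorphic_D, of z] z by (simp add: has_field_derivative_iff open_Compl)
      then have "\<forall>\<^sub>F w in at z. (D w - D z) / (w - z) \<noteq> 0"
        using D_zero[OF z True] by (intro tendsto_imp_eventually_ne) auto
      moreover have "\<forall>\<^sub>F w in at z. w \<noteq> 0"
        using z by (intro eventually_neq_at_within)
      ultimately have "\<forall>\<^sub>F w in at z. 0 = f w"
        by eventually_elim (auto simp: f_def eq True)
      then have "(f \<longlongrightarrow> 0) (at z)"
        by (rule Lim_transform_eventually[OF tendsto_const])
      moreover have "isCont f z"
      proof -
        have "(\<lambda>w. h (q * w)) holomorphic_on - {0}"
          using holomorphic_on_compose_gen[of "\<lambda>w. q * w" "- {0}" h "- {0}"] h(1) q0
          by (auto simp: o_def image_def intro: holomorphic_intros)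
        then have "f holomorphic_on - {0}"
          unfolding f_def using h(1) by (intro holomorphic_intros)
        then show ?thesis
          using z holomorphic_on_imp_continuous_on[of f "- {0}"]
          by (auto simp: continuous_on_eq_continuous_at open_Compl)
      qed
      ultimately have "f z = 0"
        using isContD LIM_unique by blast
      then show ?thesis by (simp add: f_def)
    qed
  qed
  have "h z = 0"
    by (rule quasiperiodic_negative_degree_eq_0[OF q0 q1 h(1) shift assms])
  then show ?thesis
    using h(2)[OF assms] by simp
qed

text \<open>Division of \<open>defect z = 0\<close> by \<open>ptheta z q * D z\<close>; the factors
  of \<open>D z\<close> cancel against the \<open>P\<close> in the numerators.\<close>

theorem gmock_dissection:
  assumes z: "z \<noteq> 0" and P: "ptheta z q \<noteq> 0" and D: "D z \<noteq> 0"
  shows "gmock z q = - 1 / z\<^sup>2 - q\<^sup>2 * z ^ 3 * gmock (- (q\<^sup>2 * z ^ 4)) (q ^ 16)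
     + q ^ 5 * gmock (- (q ^ 6 * z ^ 4)) (q ^ 16) - q ^ 5 / z ^ 3 * gmock (- (q ^ 10 * z ^ 4)) (q ^ 16)
     + q\<^sup>2 / z ^ 6 * gmock (- (q ^ 14 * z ^ 4)) (q ^ 16)
     + thetapart z / (z * jfun z q * jfun (- (q\<^sup>2 * z ^ 4)) (q ^ 4))"
proof -
  have nz: "P 2 z \<noteq> 0" "P 6 z \<noteq> 0" "P 10 z \<noteq> 0" "P 14 z \<noteq> 0"
    using D unfolding D_prod[OF z] by auto
  have g: "gmock (- (q ^ k * z ^ 4)) (q ^ 16) = G k z / P k z" if "P k z \<noteq> 0" for k
    unfolding P_def G_def using that z q0
    by (intro gmock_eq norm_pow) (auto simp: P_def)
  have e: "eta q \<noteq> 0" "eta (q ^ 4) \<noteq> 0"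
    by (auto intro!: eta_nz q1 norm_pow)
  have j: "jfun z q = ptheta z q * eta q" "jfun (- (q\<^sup>2 * z ^ 4)) (q ^ 4) = D z * eta (q ^ 4)"
    by (simp_all add: jfun_ptheta eta_def D_def)
  define t where "t = thetapart z / (eta q * eta (q ^ 4))"
  have t: "thetapart z / (z * jfun z q * jfun (- (q\<^sup>2 * z ^ 4)) (q ^ 4)) = t / (z * ptheta z q * D z)"
    unfolding j t_def by simp
  have "Gam z q * D z + ptheta z q * D z / z\<^sup>2
     + ptheta z q * (q\<^sup>2 * z ^ 3 * G 2 z * P 6 z * P 10 z * P 14 z
                   - q ^ 5 * G 6 z * P 2 z * P 10 z * P 14 z
                   + q ^ 5 / z ^ 3 * G 10 z * P 2 z * P 6 z * P 14 z
                   - q\<^sup>2 / z ^ 6 * G 14 z * P 2 z * P 6 z * P 10 z)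
     - t / z = 0"
    using defect_eq_0[OF z] by (simp add: defect_def t_def mult.assoc)
  then have "Gam z q * D z = - (ptheta z q * D z / z\<^sup>2)
     - ptheta z q * (q\<^sup>2 * z ^ 3 * G 2 z * P 6 z * P 10 z * P 14 z
                   - q ^ 5 * G 6 z * P 2 z * P 10 z * P 14 z
                   + q ^ 5 / z ^ 3 * G 10 z * P 2 z * P 6 z * P 14 z
                   - q\<^sup>2 / z ^ 6 * G 14 z * P 2 z * P 6 z * P 10 z)
     + t / z"
    by algebra
  then have "Gam z q / ptheta z q = (- (ptheta z q * D z / z\<^sup>2)
     - ptheta z q * (q\<^sup>2 * z ^ 3 * G 2 z * P 6 z * P 10 z * P 14 z
                   - q ^ 5 * G 6 z * P 2 z * P 10 z * P 14 z
                   + q ^ 5 / z ^ 3 * G 10 z * P 2 z * P 6 z * P 14 z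
                   - q\<^sup>2 / z ^ 6 * G 14 z * P 2 z * P 6 z * P 10 z)
     + t / z) / (ptheta z q * D z)"
    using P D by (simp add: field_simps)
  also have "\<dots> = - 1 / z\<^sup>2 - q\<^sup>2 * z ^ 3 * (G 2 z / P 2 z) + q ^ 5 * (G 6 z / P 6 z)
     - q ^ 5 / z ^ 3 * (G 10 z / P 10 z) + q\<^sup>2 / z ^ 6 * (G 14 z / P 14 z) + t / (z * ptheta z q * D z)"
  proof -
    have s: "(- (p * (a * b * c * d) / z\<^sup>2) - p * (q\<^sup>2 * z ^ 3 * A * b * c * d - q ^ 5 * B * a * c * d
        + q ^ 5 / z ^ 3 * C * a * b * d - q\<^sup>2 / z ^ 6 * E * a * b * c) + t / z) / (p * (a * b * c * d))
      = - 1 / z\<^sup>2 - q\<^sup>2 * z ^ 3 * (A / a) + q ^ 5 * (B / b) - q ^ 5 / z ^ 3 * (C / c)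
        + q\<^sup>2 / z ^ 6 * (E / d) + t / (z * p * (a * b * c * d))"
      if "p \<noteq> 0" "a \<noteq> 0" "b \<noteq> 0" "c \<noteq> 0" "d \<noteq> 0" for p a b c d A B C E :: complex
      using that z by (simp add: add_divide_distrib diff_divide_distrib mult_ac) 
    show ?thesis
      unfolding D_prod[OF z] by (rule s) (use P nz in auto)
  qed
  finally show ?thesis
    unfolding gmock_eq[OF q1 z P] g[OF nz(1)] g[OF nz(2)] g[OF nz(3)] g[OF nz(4)] by (simp add: t)
qed

end

section \<open>Partitions by largest part\<close>

definition parts_upto :: "nat \<Rightarrow> nat list set" where
  "parts_upto k = {xs. sorted_wrt (\<ge>) xs \<and> set xs \<subseteq> {1..k}}"

definition all_parts :: "nat list set" where
  "all_parts = {xs. sorted_wrt (\<ge>) xs \<and> 0 \<notin> set xs}"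

lemma parts_upto_0: "parts_upto 0 = {[]}"
  by (auto simp: parts_upto_def)

text \<open>Partitions with parts at most \<open>k + 1\<close> are \<open>m\<close> copies of \<open>k + 1\<close> followed by a partition with parts at most \<open>k\<close>.\<close>

lemma inj_replicate_append:
  "inj_on (\<lambda>(m, xs). replicate m (Suc k) @ xs) (UNIV \<times> parts_upto k)"
proof (rule inj_on_inverseI)
  fix p :: "nat \<times> nat list"
  assume "p \<in> UNIV \<times> parts_upto k"
  then obtain m xs where p: "p = (m, xs)" "set xs \<subseteq> {1..k}"
    by (auto simp: parts_upto_def)
  then have "Suc k \<notin> set xs" by auto
  then have tw: "takeWhile (\<lambda>x. x = Suc k) xs = []" "dropWhile (\<lambda>x. x = Suc k) xs = xs"
    by (cases xs; simp)+
  then show "(\<lambda>ys. (length (takeWhile (\<lambda>x. x = Suc k) ys), dropWhile (\<lambda>x. x = Suc k) ys))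
      ((\<lambda>(m, xs). replicate m (Suc k) @ xs) p) = p"
  proof -
    have "takeWhile (\<lambda>x. x = Suc k) (replicate m (Suc k) @ xs)
        = replicate m (Suc k) @ takeWhile (\<lambda>x. x = Suc k) xs"
      "dropWhile (\<lambda>x. x = Suc k) (replicate m (Suc k) @ xs) = dropWhile (\<lambda>x. x = Suc k) xs"
      by (induction m) auto
    with tw show ?thesis by (simp add: p)
  qed
qed

lemma image_replicate_append:
  "(\<lambda>(m, xs). replicate m (Suc k) @ xs) ` (UNIV \<times> parts_upto k) = parts_upto (Suc k)"
proof (intro equalityI subsetI)
  fix ys assume "ys \<in> (\<lambda>(m, xs). replicate m (Suc k) @ xs) ` (UNIV \<times> parts_upto k)"
  then obtain m xs where ys: "ys = replicate m (Suc k) @ xs" "xs \<in> parts_upto k"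
    by auto
  show "ys \<in> parts_upto (Suc k)"
    unfolding ys(1)
  proof (induction m)
    case 0
    then show ?case
      using ys(2) by (auto simp: parts_upto_def)
  next
    case (Suc m)
    then show ?case
      by (auto simp: parts_upto_def)
  qed
next
  fix ys assume "ys \<in> parts_upto (Suc k)"
  then show "ys \<in> (\<lambda>(m, xs). replicate m (Suc k) @ xs) ` (UNIV \<times> parts_upto k)"
  proof (induction ys)
    case Nil
    then show ?case
      by (auto simp: parts_upto_def intro!: image_eqI[of _ _ "(0, [])"])
  next
    case (Cons y ys)
    show ?case
    proof (cases "y = Suc k")
      case True
      have "ys \<in> parts_upto (Suc k)"
        using Cons.prems by (auto simp: parts_upto_def)
      then obtain m xs where "ys = replicate m (Suc k) @ xs" "xs \<in> parts_upto k"
        using Cons.IH by auto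
      then show ?thesis
        using True by (auto intro!: image_eqI[of _ _ "(Suc m, xs)"])
    next
      case False
      then have "y # ys \<in> parts_upto k"
        using Cons.prems by (force simp: parts_upto_def)
      then show ?thesis
        by (auto intro!: image_eqI[of _ _ "(0, y # ys)"])
    qed
  qed
qed

lemma has_sum_parts_upto_Suc:
  "(f has_sum S) (parts_upto (Suc k)) \<longleftrightarrow>
   ((\<lambda>(m, xs). f (replicate m (Suc k) @ xs)) has_sum S) (UNIV \<times> parts_upto k)"
  using has_sum_reindex[OF inj_replicate_append[of k], of f S, unfolded image_replicate_append]
  by (simp add: o_def case_prod_unfold)

lemma geometric_has_sum:
  fixes x :: "'a :: {real_normed_field, banach}"
  assumes "norm x < 1"
  shows "((\<lambda>m. x ^ m) has_sum (1 / (1 - x))) UNIV"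
  using assms geometric_sums[OF assms]
  by (intro norm_summable_imp_has_sum) (auto simp: norm_power intro!: summable_geometric)

lemma norm_power_Suc_less_1:
  fixes q :: "'a :: real_normed_div_algebra"
  assumes "norm q < 1"
  shows "norm (q ^ Suc k) < 1"
proof -
  have "norm q ^ k * norm q \<le> 1 * norm q"
    using assms by (intro mult_right_mono power_le_one) auto
  with assms show ?thesis
    by (simp add: norm_mult norm_power mult.commute)
qed

lemma sum_replicate_append: "sum_list (replicate m (Suc k) @ xs) = Suc k * m + sum_list xs"
  by (simp add: sum_list_replicate)

text \<open>For nonnegative terms iterated summability is enough. This provides the majorant that
  justifies the iterated summation in \<open>parts_upto_gf\<close>.\<close>

lemma summable_parts_upto:
  fixes r :: real
  assumes r: "0 \<le> r" "r < 1"
  shows "(\<lambda>xs. r ^ sum_list xs) summable_on parts_upto k"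
proof (induction k)
  case 0
  then show ?case by (simp add: parts_upto_0)
next
  case (Suc k)
  have "(\<lambda>(m, xs). r ^ sum_list (replicate m (Suc k) @ xs)) summable_on UNIV \<times> parts_upto k"
  proof (rule summable_on_SigmaI)
    show "((\<lambda>xs. case (m, xs) of (m, xs) \<Rightarrow> r ^ sum_list (replicate m (Suc k) @ xs))
        has_sum (r ^ Suc k) ^ m * (\<Sum>\<^sub>\<infinity>xs\<in>parts_upto k. r ^ sum_list xs)) (parts_upto k)" for m
    proof -
      have "r ^ sum_list (replicate m (Suc k) @ xs) = (r ^ Suc k) ^ m * r ^ sum_list xs" for xs
        by (simp only: sum_replicate_append power_add power_mult)
      then show ?thesis
        using has_sum_cmult_right[OF has_sum_infsum[OF Suc.IH], of "(r ^ Suc k) ^ m"] by simp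
    qed
    show "(\<lambda>m. (r ^ Suc k) ^ m * (\<Sum>\<^sub>\<infinity>xs\<in>parts_upto k. r ^ sum_list xs)) summable_on UNIV"
      using geometric_has_sum[OF norm_power_Suc_less_1, of r k] r
      by (intro summable_on_cmult_left) (auto simp: summable_on_def)
  qed (use r in auto)
  then show ?case
    using has_sum_parts_upto_Suc[of "\<lambda>xs. r ^ sum_list xs"] by (auto simp: summable_on_def)
qed

text \<open>The variable \<open>y\<close> marks the number of parts; the multiplicity of the part
  \<open>Suc k\<close> contributes one geometric series.\<close>

lemma parts_upto_gf:
  fixes q y :: "'a :: {real_normed_field, banach}"
  assumes q: "norm q < 1" and y: "norm y \<le> 1"
  shows "((\<lambda>xs. y ^ length xs * q ^ sum_list xs) has_sum (1 / (\<Prod>i<k. 1 - q ^ Suc i * y))) (parts_upto k)"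
proof (induction k)
  case 0
  then show ?case
    using has_sum_finite[of "{[]}" "\<lambda>xs::nat list. y ^ length xs * q ^ sum_list xs"] by (simp add: parts_upto_0)
next
  case (Suc k)
  let ?S = "1 / (\<Prod>i<k. 1 - q ^ Suc i * y)"
  have "norm (q ^ Suc k * y) \<le> norm (q ^ Suc k)"
    using y by (simp add: norm_mult mult_left_le)
  then have qy: "norm (q ^ Suc k * y) < 1"
    using norm_power_Suc_less_1[OF q, of k] by linarith
  have "(\<lambda>xs. y ^ length xs * q ^ sum_list xs) summable_on parts_upto (Suc k)"
  proof (rule abs_summable_summable[OF summable_on_comparison_test])
    show "(\<lambda>xs. norm q ^ sum_list xs) summable_on parts_upto (Suc k)"
      using q by (intro summable_parts_upto) auto
    show "norm (y ^ length xs * q ^ sum_list xs) \<le> norm q ^ sum_list xs" for xs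
      using y by (simp add: norm_mult norm_power mult_left_le_one_le power_le_one)
  qed auto
  then have "(\<lambda>(m, xs). y ^ length (replicate m (Suc k) @ xs) * q ^ sum_list (replicate m (Suc k) @ xs))
      summable_on UNIV \<times> parts_upto k"
    using has_sum_parts_upto_Suc[of "\<lambda>xs. y ^ length xs * q ^ sum_list xs"] by (auto simp: summable_on_def)
  moreover have "((\<lambda>xs. case (m, xs) of (m, xs) \<Rightarrow>
        y ^ length (replicate m (Suc k) @ xs) * q ^ sum_list (replicate m (Suc k) @ xs))
      has_sum (q ^ Suc k * y) ^ m * ?S) (parts_upto k)" for m
  proof -
    have "y ^ length (replicate m (Suc k) @ xs) * q ^ sum_list (replicate m (Suc k) @ xs)
        = (q ^ Suc k * y) ^ m * (y ^ length xs * q ^ sum_list xs)" for xs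
      by (simp only: sum_replicate_append length_append length_replicate power_add power_mult power_mult_distrib)
        (simp only: mult_ac)
    then show ?thesis
      using has_sum_cmult_right[OF Suc.IH, of "(q ^ Suc k * y) ^ m"] by simp
  qed
  moreover have "((\<lambda>m. (q ^ Suc k * y) ^ m * ?S) has_sum (1 / (1 - q ^ Suc k * y) * ?S)) UNIV"
    by (intro has_sum_cmult_left geometric_has_sum qy)
  ultimately have "((\<lambda>(m, xs). y ^ length (replicate m (Suc k) @ xs) * q ^ sum_list (replicate m (Suc k) @ xs))
      has_sum (1 / (1 - q ^ Suc k * y) * ?S)) (UNIV \<times> parts_upto k)"
    by (intro has_sum_SigmaI) auto
  then show ?case
    using has_sum_parts_upto_Suc[of "\<lambda>xs. y ^ length xs * q ^ sum_list xs"] by (simp add: mult_ac)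
qed

lemma qpoch_conv_parts: "qpoch (q * y) q k = (\<Prod>i<k. 1 - q ^ Suc i * y)"
  by (simp add: qpoch_def mult_ac)

text \<open>Every factor has norm at least \<open>1 - r ^ Suc i\<close>, so the reciprocals are
  dominated by those of \<open>(r; r)_n\<close>, which converge because the infinite product is not
  0.\<close>

lemma inverse_qpoch_bounded:
  assumes r: "0 \<le> r" "r < 1"
  shows "\<exists>K>0. (\<forall>k. 1 / (\<Prod>i<k. 1 - r ^ Suc i) \<le> K) \<and>
    (\<forall>q x k. norm q \<le> r \<longrightarrow> norm x \<le> r \<longrightarrow> norm (1 / qpoch x q k) \<le> K)"
proof -
  define c :: complex where "c = of_real r"
  have c: "norm c < 1" using r by (simp add: c_def)
  have "(\<lambda>k. 1 / qpoch c c k) \<longlonglongrightarrow> 1 / qpoch_inf c c"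
    by (intro tendsto_intros qpoch_tendsto qpoch_inf_self_nz c)
  then have "Bseq (\<lambda>n. 1 / qpoch c c n)"
    by (intro convergent_imp_Bseq convergentI)
  then obtain K where K: "K > 0" "\<forall>n. norm (1 / qpoch c c n) \<le> K"
    unfolding Bseq_def by blast
  have fac: "0 < 1 - r ^ Suc i" for i
    using power_Suc_less_one[of r i] r by (cases "r = 0") auto
  have "qpoch c c n = of_real (\<Prod>i<n. 1 - r ^ Suc i)" for n
    by (simp add: qpoch_def c_def mult.commute)
  moreover have pos: "(\<Prod>i<n. 1 - r ^ Suc i) > 0" for n
    using fac by (intro prod_pos) auto
  ultimately have "norm (1 / qpoch c c n) = 1 / (\<Prod>i<n. 1 - r ^ Suc i)" for n
    by (simp only: norm_divide norm_one norm_of_real abs_of_pos)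
  with K(2) have K1: "1 / (\<Prod>i<n. 1 - r ^ Suc i) \<le> K" for n
    by metis
  have "norm (1 / qpoch x q k) \<le> K" if "norm q \<le> r" "norm x \<le> r" for q x :: complex and k
  proof -
    have "(\<Prod>i<k. 1 - r ^ Suc i) \<le> norm (qpoch x q k)"
      unfolding qpoch_def prod_norm[symmetric]
    proof (intro prod_mono conjI)
      fix i
      have "norm (q ^ i * x) \<le> r ^ i * r"
        unfolding norm_mult norm_power using that r by (intro mult_mono power_mono) auto
      moreover have "norm (1 :: complex) - norm (q ^ i * x) \<le> norm (1 - q ^ i * x)"
        by (rule norm_triangle_ineq2)
      ultimately show "1 - r ^ Suc i \<le> norm (1 - q ^ i * x)"
        by (simp add: mult.commute)
    qed (use fac in \<open>auto intro: less_imp_le\<close>)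
    then have "norm (1 / qpoch x q k) \<le> 1 / (\<Prod>i<k. 1 - r ^ Suc i)"
      using pos[of k] by (simp add: norm_divide frac_le)
    with K1 show ?thesis by (rule order_trans[rotated])
  qed
  with K(1) K1 show ?thesis by blast
qed

text \<open>A finite set of partitions has bounded parts, and the generating functions with bounded
  parts have a common bound.\<close>

lemma summable_all_parts:
  fixes r :: real
  assumes r: "0 \<le> r" "r < 1"
  shows "(\<lambda>xs. r ^ sum_list xs) summable_on all_parts"
proof (rule nonneg_bdd_above_summable_on)
  obtain K where K: "\<forall>k. 1 / (\<Prod>i<k. 1 - r ^ Suc i) \<le> K"
    using inverse_qpoch_bounded[OF r] by auto
  have "sum (\<lambda>xs. r ^ sum_list xs) F \<le> K" if F: "F \<subseteq> all_parts" "finite F" for F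
  proof -
    \<comment> \<open>A crude bound for every part: the total size of all partitions in
      \<open>F\<close>.\<close>
    define k where "k = (\<Sum>xs\<in>F. sum_list xs)"
    have "F \<subseteq> parts_upto k"
    proof
      fix xs assume xs: "xs \<in> F"
      have "x \<le> k" if "x \<in> set xs" for x
        using member_le_sum_list[OF that] member_le_sum[OF xs, of sum_list] F by (simp add: k_def)
      moreover have "0 \<notin> set xs" "sorted_wrt (\<ge>) xs"
        using xs F by (auto simp: all_parts_def)
      then have "1 \<le> x" if "x \<in> set xs" for x
        using that by (cases x) auto
      ultimately show "xs \<in> parts_upto k"
        using \<open>sorted_wrt (\<ge>) xs\<close> by (auto simp: parts_upto_def)
    qed
    moreover have "((\<lambda>xs. r ^ sum_list xs) has_sum (1 / (\<Prod>i<k. 1 - r ^ Suc i))) (parts_upto k)"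
      using parts_upto_gf[of r 1 k] r by simp
    ultimately have "sum (\<lambda>xs. r ^ sum_list xs) F \<le> 1 / (\<Prod>i<k. 1 - r ^ Suc i)"
      using r F by (intro finite_sum_le_has_sum) auto
    then show ?thesis using K[rule_format, of k] by linarith
  qed
  then show "bdd_above (sum (\<lambda>xs. r ^ sum_list xs) ` {F. F \<subseteq> all_parts \<and> finite F})"
    by (intro bdd_aboveI2) auto
qed (use r in auto)

text \<open>Here \<open>k\<close> is the largest part minus 1, so the rank becomes \<open>k\<close>
  minus the number of remaining parts.\<close>

lemma all_parts_decompose:
  "all_parts = insert [] ((\<lambda>(k, xs). Suc k # xs) ` (SIGMA k:UNIV. parts_upto (Suc k)))"
proof (intro equalityI subsetI)
  fix ys assume ys: "ys \<in> all_parts"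
  show "ys \<in> insert [] ((\<lambda>(k, xs). Suc k # xs) ` (SIGMA k:UNIV. parts_upto (Suc k)))"
  proof (cases ys)
    case (Cons x xs)
    then have "x \<noteq> 0" using ys by (auto simp: all_parts_def)
    then obtain k where k: "x = Suc k" by (cases x) auto
    have "xs \<in> parts_upto (Suc k)"
      using ys unfolding Cons k all_parts_def parts_upto_def
      by (auto simp: Suc_le_eq intro: gr0I)
    then show ?thesis
      unfolding Cons k by (auto intro!: image_eqI[of _ _ "(k, xs)"])
  qed simp
next
  fix ys assume "ys \<in> insert [] ((\<lambda>(k, xs). Suc k # xs) ` (SIGMA k:UNIV. parts_upto (Suc k)))"
  then consider "ys = []" | k xs where "ys = Suc k # xs" "xs \<in> parts_upto (Suc k)"
    by auto
  then show "ys \<in> all_parts"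
  proof cases
    case 1
    then show ?thesis by (simp add: all_parts_def)
  next
    case (2 k xs)
    have sub: "set xs \<subseteq> {1..Suc k}" and sorted: "sorted_wrt (\<ge>) xs"
      using 2(2) by (simp_all add: parts_upto_def)
    have "0 \<notin> set xs"
      using subsetD[OF sub, of 0] by auto
    moreover have "\<forall>x\<in>set xs. x \<le> Suc k"
      using subsetD[OF sub] by auto
    ultimately show ?thesis
      using sorted unfolding all_parts_def 2(1) by simp
  qed
qed

lemma prank_Nil: "prank [] = 0"
  by (simp add: prank_def)

lemma prank_Cons:
  assumes "xs \<in> parts_upto (Suc k)"
  shows "prank (Suc k # xs) = int k - int (length xs)"
proof -
  have "Max (insert 0 (set (Suc k # xs))) = Suc k"
    using assms by (intro Max_eqI) (auto simp: parts_upto_def)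
  then show ?thesis
    by (simp add: prank_def)
qed

text \<open>For largest part \<open>Suc k\<close> the remaining parts are counted by
  \<open>parts_upto_gf\<close> with \<open>y = 1 / z\<close>. On the unit circle
  \<open>z powi prank xs\<close> has norm 1, so absolute summability is that of the partition
  series.\<close>

lemma rank_gf_largest_part:
  assumes q: "norm q < 1" and z: "norm z = 1"
  shows "((\<lambda>xs. z powi prank xs * q ^ sum_list xs)
      has_sum (1 + (\<Sum>k. z ^ k * q ^ Suc k / qpoch (q / z) q (Suc k)))) all_parts"
proof -
  let ?f = "\<lambda>xs. z powi prank xs * q ^ sum_list xs"
  define g where "g k = z ^ k * q ^ Suc k / qpoch (q / z) q (Suc k)" for k
  have z0: "z \<noteq> 0" using z by auto
  have sum: "?f summable_on all_parts"
  proof (rule abs_summable_summable[OF summable_on_comparison_test])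
    show "(\<lambda>xs. norm q ^ sum_list xs) summable_on all_parts"
      using q by (intro summable_all_parts) auto
    show "norm (z powi prank xs * q ^ sum_list xs) \<le> norm q ^ sum_list xs" for xs
      using z by (simp add: norm_mult norm_power norm_power_int)
  qed auto
  have inj: "inj_on (\<lambda>(k, xs). Suc k # xs) (SIGMA k:UNIV. parts_upto (Suc k))"
    by (auto simp: inj_on_def)
  have rest: "?f summable_on (\<lambda>(k, xs). Suc k # xs) ` (SIGMA k:UNIV. parts_upto (Suc k))"
    by (rule summable_on_subset_banach[OF sum]) (auto simp: all_parts_decompose)
  then have S: "(\<lambda>(k, xs). ?f (Suc k # xs)) summable_on (SIGMA k:UNIV. parts_upto (Suc k))"
    using summable_on_reindex[OF inj, of ?f] by (simp add: o_def case_prod_unfold)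
  have inner: "((\<lambda>xs. case (k, xs) of (k, xs) \<Rightarrow> ?f (Suc k # xs)) has_sum g k) (parts_upto (Suc k))" for k
  proof -
    have "((\<lambda>xs. (1 / z) ^ length xs * q ^ sum_list xs) has_sum (1 / qpoch (q / z) q (Suc k))) (parts_upto (Suc k))"
      using parts_upto_gf[OF q, of "1 / z" "Suc k"] qpoch_conv_parts[of q "1 / z" "Suc k"] z
      by (simp add: norm_divide)
    from has_sum_cmult_right[OF this, of "z ^ k * q ^ Suc k"]
    have "((\<lambda>xs. z ^ k * q ^ Suc k * ((1 / z) ^ length xs * q ^ sum_list xs)) has_sum g k) (parts_upto (Suc k))"
      by (simp add: g_def)
    also have "?this \<longleftrightarrow> ?thesis"
      using z0 by (intro has_sum_cong) (simp add: prank_Cons power_int_diff power_add power_one_over)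
    finally show ?thesis .
  qed
  obtain T where T: "((\<lambda>(k, xs). ?f (Suc k # xs)) has_sum T) (SIGMA k:UNIV. parts_upto (Suc k))"
    using S by (auto simp: summable_on_def)
  have "(g has_sum T) UNIV"
    by (rule has_sum_SigmaD[OF T]) (use inner in auto)
  then have "T = (\<Sum>k. g k)"
    using has_sum_imp_sums sums_unique by blast
  moreover have "(?f has_sum T) ((\<lambda>(k, xs). Suc k # xs) ` (SIGMA k:UNIV. parts_upto (Suc k)))"
    using T has_sum_reindex[OF inj, of ?f T] by (simp add: o_def case_prod_unfold)
  then have "(?f has_sum (?f [] + T)) all_parts"
    unfolding all_parts_decompose by (intro has_sum_insert) auto
  ultimately show ?thesis
    by (simp add: prank_Nil g_def)
qed

section \<open>The rank generating function\<close>

text \<open>Fine's function \<open>F(a, b; t)\<close> at \<open>a = 0\<close>.\<close>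

definition fine_sum :: "complex \<Rightarrow> complex \<Rightarrow> complex \<Rightarrow> complex" where
  "fine_sum q b t = (\<Sum>n. t ^ n / qpoch (b * q) q n)"

lemma qpoch_nz:
  assumes "norm q < 1" "norm x < 1"
  shows "qpoch x q n \<noteq> 0"
proof -
  have "q ^ i * x \<noteq> 1" for i
  proof -
    have "norm (q ^ i * x) \<le> norm x"
      using assms by (simp add: norm_mult norm_power mult_left_le_one_le power_le_one)
    then show ?thesis using assms by auto
  qed
  then show ?thesis
    by (auto simp: qpoch_def eq_commute[of "1 :: complex"])
qed

lemma summable_fine:
  assumes q: "norm q < 1" and b: "norm b \<le> 1" and t: "norm t < 1"
  shows "summable (\<lambda>n. norm (t ^ n / qpoch (b * q) q n))"
    and "\<exists>K. \<forall>b t. norm b \<le> 1 \<longrightarrow> norm t < 1 \<longrightarrow> norm (fine_sum q b t) \<le> K / (1 - norm t)"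
proof -
  obtain K where K: "K > 0" "\<forall>p x k. norm p \<le> norm q \<longrightarrow> norm x \<le> norm q \<longrightarrow> norm (1 / qpoch x p k) \<le> K"
    using inverse_qpoch_bounded[of "norm q"] q by auto
  have term_le: "norm (t ^ n / qpoch (b * q) q n) \<le> norm t ^ n * K" if b: "norm b \<le> 1" for b t n
  proof -
    have "norm (b * q) \<le> norm q"
      using b by (simp add: norm_mult mult_left_le_one_le)
    then have "norm (1 / qpoch (b * q) q n) \<le> K"
      using K(2) by blast
    then have "norm (t ^ n) * norm (1 / qpoch (b * q) q n) \<le> norm t ^ n * K"
      by (intro mult_mono) (auto simp: norm_power)
    then show ?thesis
      by (simp add: norm_divide norm_mult)
  qed
  have sK: "summable (\<lambda>n. norm t ^ n * K)" if "norm t < 1" for t :: complex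
    using that by (intro summable_mult2 summable_geometric) auto
  have sn: "summable (\<lambda>n. norm (t ^ n / qpoch (b * q) q n))" if "norm b \<le> 1" "norm t < 1" for b t
    by (rule summable_comparison_test'[OF sK[OF that(2)], of 0]) (use term_le that in auto)
  then show "summable (\<lambda>n. norm (t ^ n / qpoch (b * q) q n))"
    using b t by blast
  have "norm (fine_sum q b t) \<le> K / (1 - norm t)" if "norm b \<le> 1" "norm t < 1" for b t
  proof -
    have "norm (fine_sum q b t) \<le> (\<Sum>n. norm (t ^ n / qpoch (b * q) q n))"
      unfolding fine_sum_def using sn[OF that] by (rule summable_norm)
    also have "\<dots> \<le> (\<Sum>n. norm t ^ n * K)"
      using term_le that by (intro suminf_le sn sK) auto
    also have "\<dots> = K / (1 - norm t)"
      using that by (simp add: suminf_mult2[symmetric] suminf_geometric summable_geometric)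
    finally show ?thesis .
  qed
  then show "\<exists>K. \<forall>b t. norm b \<le> 1 \<longrightarrow> norm t < 1 \<longrightarrow> norm (fine_sum q b t) \<le> K / (1 - norm t)"
    by blast
qed

text \<open>In \<open>f (Suc n) - t * f n\<close> the last denominator factor leaves
  \<open>1 - (1 - b * q ^ Suc n)\<close>, and the resulting power of \<open>q\<close> turns the
  series into one at \<open>b * q\<close> and \<open>t * q\<close>.\<close>

lemma fine_step:
  assumes q: "norm q < 1" and b: "norm b \<le> 1" and t: "norm t < 1"
  shows "fine_sum q b t = 1 / (1 - t) + b * t * q / ((1 - t) * (1 - b * q)) * fine_sum q (b * q) (t * q)"
proof -
  have bq: "norm (b * q) < 1" "norm (b * q) \<le> 1" "norm (t * q) < 1"
    using q b t mult_mono[of "norm b" 1 "norm q" "norm q"] mult_mono[of "norm t" 1 "norm q" "norm q"]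
    by (auto simp: norm_mult)
  define f where "f n = t ^ n / qpoch (b * q) q n" for n
  have f: "f sums fine_sum q b t"
    unfolding f_def fine_sum_def
    by (rule summable_sums[OF summable_norm_cancel[OF summable_fine(1)[OF q b t]]])
  then have "(\<lambda>n. f (Suc n)) sums (fine_sum q b t - 1)"
    using sums_Suc_iff[of f "fine_sum q b t - 1"] by (simp add: f_def)
  then have "(\<lambda>n. f (Suc n) - t * f n) sums (fine_sum q b t - 1 - t * fine_sum q b t)"
    by (intro sums_diff sums_mult f)
  moreover have "f (Suc n) - t * f n = b * t * q / (1 - b * q) * ((t * q) ^ n / qpoch (b * q * q) q n)" for n
  proof -
    have nz: "qpoch (b * q) q n \<noteq> 0" "qpoch (b * q) q (Suc n) \<noteq> 0"
      using qpoch_nz[OF q bq(1)] by auto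
    have "f (Suc n) - t * f n = t ^ Suc n * (1 - (1 - q ^ n * (b * q))) / qpoch (b * q) q (Suc n)"
      using nz by (simp add: f_def qpoch_Suc field_simps)
    also have "\<dots> = b * t * q * (t * q) ^ n / qpoch (b * q) q (Suc n)"
      by (simp add: power_mult_distrib mult_ac)
    also have "qpoch (b * q) q (Suc n) = (1 - b * q) * qpoch (b * q * q) q n"
      by (simp add: qpoch_Suc_shift mult_ac)
    finally show ?thesis by simp
  qed
  moreover have "(\<lambda>n. b * t * q / (1 - b * q) * ((t * q) ^ n / qpoch (b * q * q) q n))
      sums (b * t * q / (1 - b * q) * fine_sum q (b * q) (t * q))"
    unfolding fine_sum_def
    by (intro sums_mult summable_sums summable_norm_cancel[OF summable_fine(1)[OF q bq(2,3)]])
  ultimately have "fine_sum q b t - 1 - t * fine_sum q b t = b * t * q / (1 - b * q) * fine_sum q (b * q) (t * q)"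
    using sums_unique2 by force
  then have "(1 - t) * fine_sum q b t = 1 + b * t * q / (1 - b * q) * fine_sum q (b * q) (t * q)"
    by (simp add: algebra_simps)
  moreover have "t \<noteq> 1" using t by auto
  ultimately have "fine_sum q b t = (1 + b * t * q / (1 - b * q) * fine_sum q (b * q) (t * q)) / (1 - t)"
    by (simp add: field_simps)
  then show ?thesis
    by (simp add: add_divide_distrib mult.commute)
qed

lemma fine_iterate:
  assumes q: "norm q < 1" and b: "norm b \<le> 1" and t: "norm t < 1"
  shows "fine_sum q b t = (\<Sum>n<N. b ^ n * t ^ n * q ^ (n\<^sup>2) / (qpoch (b * q) q n * qpoch t q (Suc n)))
     + b ^ N * t ^ N * q ^ (N\<^sup>2) / (qpoch (b * q) q N * qpoch t q N) * fine_sum q (b * q ^ N) (t * q ^ N)"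
proof (induction N)
  case (Suc N)
  have qN: "norm q ^ N \<le> 1"
    using q by (simp add: power_le_one)
  have bN: "norm (b * q ^ N) \<le> 1"
    using mult_mono[OF b qN] by (simp add: norm_mult norm_power)
  have tN: "norm (t * q ^ N) < 1"
    using t mult_left_le[OF qN, of "norm t"] by (simp add: norm_mult norm_power)
  have e: "fine_sum q (b * q ^ N) (t * q ^ N) = 1 / (1 - t * q ^ N)
      + (b * q ^ N) * (t * q ^ N) * q / ((1 - t * q ^ N) * (1 - b * q ^ N * q))
        * fine_sum q (b * q ^ Suc N) (t * q ^ Suc N)"
    using fine_step[OF q bN tN] by (simp add: mult_ac)
  have "q ^ ((Suc N)\<^sup>2) = q ^ (N\<^sup>2) * (q ^ N * q ^ N * q)"
    by (simp add: power2_eq_square power_add)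
  then have num: "b ^ N * t ^ N * q ^ (N\<^sup>2) * (b * t * (q ^ N * q ^ N * q))
      = b ^ Suc N * t ^ Suc N * q ^ ((Suc N)\<^sup>2)"
    by (simp add: mult_ac)
  have den: "qpoch (b * q) q N * (1 - b * q ^ N * q) = qpoch (b * q) q (Suc N)"
      "qpoch t q N * (1 - t * q ^ N) = qpoch t q (Suc N)"
    by (simp_all add: qpoch_Suc mult_ac)
  have "A / (B * C) * (1 / c + (b * Q) * (t * Q) * q / (c * d) * F)
      = A / (B * (C * c)) + A * (b * t * (Q * Q * q)) / ((B * d) * (C * c)) * F" for A B C c d F Q
    by (simp add: distrib_left mult_ac)
  from this[of "b ^ N * t ^ N * q ^ (N\<^sup>2)" "qpoch (b * q) q N" "qpoch t q N"]
  have "b ^ N * t ^ N * q ^ (N\<^sup>2) / (qpoch (b * q) q N * qpoch t q N) * fine_sum q (b * q ^ N) (t * q ^ N)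
      = b ^ N * t ^ N * q ^ (N\<^sup>2) / (qpoch (b * q) q N * qpoch t q (Suc N))
        + b ^ Suc N * t ^ Suc N * q ^ ((Suc N)\<^sup>2) / (qpoch (b * q) q (Suc N) * qpoch t q (Suc N))
          * fine_sum q (b * q ^ Suc N) (t * q ^ Suc N)"
    unfolding e num[symmetric] den[symmetric] .
  then show ?case
    using Suc.IH by simp
qed simp

text \<open>The case \<open>a = 0\<close> of the Rogers-Fine identity: iterate
  \<open>fine_step\<close>; the remainder tends to 0 because the bound on \<open>fine_sum\<close> is
  uniform in \<open>b\<close> and \<open>t\<close> while its prefactor decays like
  \<open>norm t ^ N\<close>.\<close>

lemma rogers_fine:
  assumes q: "norm q < 1" and b: "norm b \<le> 1" and t: "norm t < 1"
  shows "(\<lambda>n. b ^ n * t ^ n * q ^ (n\<^sup>2) / (qpoch (b * q) q n * qpoch t q (Suc n))) sums fine_sum q b t"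
proof -
  obtain K where K: "\<And>b t. norm b \<le> 1 \<Longrightarrow> norm t < 1 \<Longrightarrow> norm (fine_sum q b t) \<le> K / (1 - norm t)"
    using summable_fine(2)[OF assms] by blast
  define m where "m = max (norm q) (norm t)"
  have m: "0 \<le> m" "m < 1" "norm q \<le> m" "norm t \<le> m"
    using q t by (auto simp: m_def le_max_iff_disj)
  obtain M where M: "M > 0" "\<forall>p x k. norm p \<le> m \<longrightarrow> norm x \<le> m \<longrightarrow> norm (1 / qpoch x p k) \<le> M"
    using inverse_qpoch_bounded[OF m(1,2)] by auto
  have bq: "norm (b * q) \<le> m"
    using mult_mono[OF b m(3)] by (simp add: norm_mult)
  define R where "R N = b ^ N * t ^ N * q ^ (N\<^sup>2) / (qpoch (b * q) q N * qpoch t q N) * fine_sum q (b * q ^ N) (t * q ^ N)" for N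
  have "norm (R N) \<le> norm t ^ N * (M * M * (K / (1 - norm t)))" for N
  proof -
    have qN: "norm q ^ N \<le> 1"
      using q by (simp add: power_le_one)
    have bN: "norm (b * q ^ N) \<le> 1"
      using mult_mono[OF b qN] by (simp add: norm_mult norm_power)
    have tN: "norm (t * q ^ N) \<le> norm t"
      using mult_left_le[OF qN, of "norm t"] by (simp add: norm_mult norm_power)
    have K0: "0 \<le> K"
      using order_trans[OF norm_ge_zero K[of 0 0]] by simp
    have "norm (fine_sum q (b * q ^ N) (t * q ^ N)) \<le> K / (1 - norm (t * q ^ N))"
      using bN tN t by (intro K) auto
    also have "\<dots> \<le> K / (1 - norm t)"
      using tN t K0 by (intro divide_left_mono mult_pos_pos) auto
    finally have F: "norm (fine_sum q (b * q ^ N) (t * q ^ N)) \<le> K / (1 - norm t)" .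
    have "norm (b ^ N * t ^ N * q ^ (N\<^sup>2)) \<le> 1 * norm t ^ N * 1"
      unfolding norm_mult norm_power using b q
      by (intro mult_mono power_le_one mult_nonneg_nonneg) auto
    then have "norm (b ^ N * t ^ N * q ^ (N\<^sup>2)) * (norm (1 / qpoch (b * q) q N) * norm (1 / qpoch t q N))
        * norm (fine_sum q (b * q ^ N) (t * q ^ N)) \<le> norm t ^ N * (M * M) * (K / (1 - norm t))"
      using M(2) bq m F M(1) by (intro mult_mono F mult_nonneg_nonneg) auto
    then show ?thesis
      by (simp add: R_def norm_mult norm_divide mult_ac)
  qed
  moreover have "(\<lambda>N. norm t ^ N * (M * M * (K / (1 - norm t)))) \<longlonglongrightarrow> 0 * (M * M * (K / (1 - norm t)))"
    using t by (intro tendsto_mult LIMSEQ_power_zero tendsto_const) auto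
  ultimately have "R \<longlonglongrightarrow> 0"
    by (intro Lim_null_comparison[of R]) auto
  then have "(\<lambda>N. fine_sum q b t - R N) \<longlonglongrightarrow> fine_sum q b t - 0"
    by (intro tendsto_intros)
  moreover have "fine_sum q b t - R N = (\<Sum>n<N. b ^ n * t ^ n * q ^ (n\<^sup>2) / (qpoch (b * q) q n * qpoch t q (Suc n)))" for N
    using fine_iterate[OF assms, of N] by (simp add: R_def)
  ultimately show ?thesis
    by (simp add: sums_def)
qed

text \<open>The series \<open>r\<close> is evaluated twice: by Rogers-Fine it equals the sum over
  largest parts, and in terms of tails it is \<open>Phi\<close> divided by a product, hence an
  expression in \<open>gmock\<close>.\<close>

lemma rank_gf:
  assumes q: "norm q < 1" and z: "norm z = 1" "z \<noteq> 1"
  shows "((\<lambda>xs. z powi prank xs * q ^ sum_list xs) has_sum ((1 - z) * (1 + z * gmock z q))) all_parts"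
proof -
  have z0: "z \<noteq> 0" using z by auto
  have nq: "norm (q / z) < 1" "norm (z * q) < 1" "norm (q / z) \<le> 1"
    using q z by (simp_all add: norm_mult norm_divide)
  have nz: "qpoch (q / z) q n \<noteq> 0" "qpoch (z * q) q n \<noteq> 0" for n
    using qpoch_nz[OF q nq(1)] qpoch_nz[OF q nq(2)] by auto
  define r where "r n = q ^ (n\<^sup>2) / (qpoch (z * q) q n * qpoch (q / z) q n)" for n
  have one: "1 - q / z \<noteq> 0"
    using nz(1)[of 1] by (simp add: qpoch_def)
  have shift: "qpoch (q / z) q (Suc k) = (1 - q / z) * qpoch (q / z * q) q k" for k
    by (simp add: qpoch_Suc_shift mult_ac)
  \<comment> \<open>With \<open>b = q / z\<close> and \<open>t = z * q\<close> one has
    \<open>b * t = q\<^sup>2\<close>, so together with the prefactor \<open>q\<close> the exponent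
    is \<open>(n + 1)\<^sup>2\<close>: the series is \<open>r\<close> without its first
    term.\<close>
  have "(\<lambda>n. q / (1 - q / z) * ((q / z) ^ n * (z * q) ^ n * q ^ (n\<^sup>2) / (qpoch (q / z * q) q n * qpoch (z * q) q (Suc n))))
      sums (q / (1 - q / z) * fine_sum q (q / z) (z * q))"
    by (intro sums_mult rogers_fine q nq)
  moreover have "q / (1 - q / z) * ((q / z) ^ n * (z * q) ^ n * q ^ (n\<^sup>2) / (qpoch (q / z * q) q n * qpoch (z * q) q (Suc n)))
      = r (Suc n)" for n
  proof -
    have "(q / z) ^ n * (z * q) ^ n = q ^ n * q ^ n"
      using z0 by (simp add: power_mult_distrib power_divide)
    moreover have "q ^ ((Suc n)\<^sup>2) = q * (q ^ n * q ^ n * q ^ (n\<^sup>2))"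
      by (simp add: power2_eq_square power_add)
    ultimately show ?thesis
      unfolding r_def shift by (simp add: mult_ac)
  qed
  ultimately have rs: "(\<lambda>n. r (Suc n)) sums (q / (1 - q / z) * fine_sum q (q / z) (z * q))"
    by simp
  have "(\<Sum>k. z ^ k * q ^ Suc k / qpoch (q / z) q (Suc k)) = q / (1 - q / z) * fine_sum q (q / z) (z * q)"
  proof -
    have "(\<lambda>k. q / (1 - q / z) * ((z * q) ^ k / qpoch (q / z * q) q k)) sums (q / (1 - q / z) * fine_sum q (q / z) (z * q))"
      unfolding fine_sum_def
      by (intro sums_mult summable_sums summable_norm_cancel[OF summable_fine(1)[OF q nq(3,2)]])
    moreover have "q / (1 - q / z) * ((z * q) ^ k / qpoch (q / z * q) q k) = z ^ k * q ^ Suc k / qpoch (q / z) q (Suc k)" for k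
      unfolding shift by (simp add: power_mult_distrib mult_ac)
    ultimately show ?thesis
      by (simp add: sums_iff)
  qed
  moreover have "r sums (q / (1 - q / z) * fine_sum q (q / z) (z * q) + r 0)"
    using rs by (simp add: sums_Suc_iff)
  then have "r sums (1 + q / (1 - q / z) * fine_sum q (q / z) (z * q))"
    by (simp add: r_def add.commute)
  moreover have "r sums ((1 - z) * (1 + z * gmock z q))"
  proof -
    have nt: "qtail z q 1 \<noteq> 0" "qtail (1 / z) q 1 \<noteq> 0"
    proof -
      have "q ^ i * (z * q) \<noteq> 1" "q ^ i * (q / z) \<noteq> 1" for i
      proof -
        have "norm (q ^ i * (z * q)) < 1" "norm (q ^ i * (q / z)) < 1"
          using z norm_power_Suc_less_1[OF q, of i]
          by (simp_all add: norm_mult norm_divide norm_power mult.commute)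
        then show "q ^ i * (z * q) \<noteq> 1" "q ^ i * (q / z) \<noteq> 1"
          by (metis norm_one less_irrefl)+
      qed
      then show "qtail z q 1 \<noteq> 0" "qtail (1 / z) q 1 \<noteq> 0"
        using z0 by (simp_all add: qtail_def qpoch_inf_eq_0_iff[OF q])
    qed
    have P: "ptheta z q = (1 - z) * (qtail z q 1 * qtail (1 / z) q 1)"
      using qtail_step[OF q, of z 0] by (simp add: ptheta_qtail)
    have r: "r n = (q ^ (n\<^sup>2) * (qtail z q (Suc n) * qtail (1 / z) q (Suc n))) / (qtail z q 1 * qtail (1 / z) q 1)" for n
    proof -
      have "qtail z q 1 = qpoch (z * q) q n * qtail z q (Suc n)"
        "qtail (1 / z) q 1 = qpoch (q / z) q n * qtail (1 / z) q (Suc n)"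
        using qpoch_inf_split[OF q, of "z * q" n] qpoch_inf_split[OF q, of "q / z" n]
        by (simp_all add: qtail_def mult_ac)
      with nt nz show ?thesis
        by (simp add: r_def)
    qed
    have "r sums (Phi z q / (qtail z q 1 * qtail (1 / z) q 1))"
      unfolding r Phi_def by (intro sums_divide summable_sums summable_Phi q)
    also have "Phi z q / (qtail z q 1 * qtail (1 / z) q 1) = (1 - z) * (1 + z * gmock z q)"
    proof -
      have "ptheta z q \<noteq> 0"
        unfolding P using nt z by simp
      then have G: "Gam z q = gmock z q * ptheta z q"
        using gmock_eq[OF q z0] by simp
      have "Phi z q = (1 - z) * (1 + z * gmock z q) * (qtail z q 1 * qtail (1 / z) q 1)"
        unfolding Phi_Gam[OF q z0] G P by (simp add: algebra_simps)
      with nt show ?thesis by simp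
    qed
    finally show ?thesis .
  qed
  ultimately have "1 + (\<Sum>k. z ^ k * q ^ Suc k / qpoch (q / z) q (Suc k)) = (1 - z) * (1 + z * gmock z q)"
    using sums_unique2 by metis
  then show ?thesis
    using rank_gf_largest_part[OF q z(1)] by simp
qed

section \<open>Regrouping partitions by size\<close>

lemma finite_partitions: "finite (partitions n)"
proof (rule finite_subset)
  show "partitions n \<subseteq> {xs. set xs \<subseteq> {..n} \<and> length xs \<le> n}"
  proof
    fix xs assume xs: "xs \<in> partitions n"
    have "length xs \<le> sum_list xs" if "0 \<notin> set xs" for xs :: "nat list"
      using that by (induction xs) (auto simp: Suc_le_eq)
    moreover have "x \<le> sum_list xs" if "x \<in> set xs" for x
      using member_le_sum_list[OF that] by simp
    ultimately show "xs \<in> {xs. set xs \<subseteq> {..n} \<and> length xs \<le> n}"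
      using xs by (auto simp: partitions_def)
  qed
qed (rule finite_lists_length_le, simp)

lemma sums_partitions:
  assumes "((\<lambda>xs. f xs * q ^ sum_list xs) has_sum S) all_parts"
  shows "(\<lambda>n. (\<Sum>xs\<in>partitions n. f xs) * q ^ n) sums (S :: complex)"
proof -
  have "all_parts = snd ` (SIGMA n:UNIV. partitions n)"
    by (force simp: all_parts_def partitions_def)
  moreover have inj: "inj_on snd (SIGMA n:UNIV. partitions n)"
    by (auto simp: inj_on_def partitions_def)
  ultimately have *: "((\<lambda>(n, xs). f xs * q ^ sum_list xs) has_sum S) (SIGMA n:UNIV. partitions n)"
    using assms has_sum_reindex[OF inj, of "\<lambda>xs. f xs * q ^ sum_list xs" S] by (simp add: o_def case_prod_unfold)
  have "((\<lambda>n. (\<Sum>xs\<in>partitions n. f xs) * q ^ n) has_sum S) UNIV"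
  proof (rule has_sum_SigmaD[OF *])
    fix n
    have "(\<Sum>xs\<in>partitions n. f xs) * q ^ n = (\<Sum>xs\<in>partitions n. f xs * q ^ sum_list xs)"
      unfolding sum_distrib_right by (intro sum.cong) (auto simp: partitions_def)
    then show "((\<lambda>xs. case (n, xs) of (n, xs) \<Rightarrow> f xs * q ^ sum_list xs) has_sum
        (\<Sum>xs\<in>partitions n. f xs) * q ^ n) (partitions n)"
      using finite_partitions by (intro has_sum_finiteI) auto
  qed
  then show ?thesis by (rule has_sum_imp_sums)
qed

section \<open>Products of theta functions\<close>

lemma has_sum_times:
  fixes f :: "'a \<Rightarrow> complex" and g :: "'b \<Rightarrow> complex"
  assumes f: "(f has_sum a) A" "(\<lambda>x. norm (f x)) summable_on A"
    and g: "(g has_sum b) B" "(\<lambda>x. norm (g x)) summable_on B"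
  shows "((\<lambda>(x, y). f x * g y) has_sum (a * b)) (A \<times> B)"
proof (rule has_sum_SigmaI)
  show "((\<lambda>y. case (x, y) of (x, y) \<Rightarrow> f x * g y) has_sum f x * b) B" for x
    using has_sum_cmult_right[OF g(1), of "f x"] by simp
  show "((\<lambda>x. f x * b) has_sum a * b) A"
    by (rule has_sum_cmult_left[OF f(1)])
  have "(\<lambda>(x, y). norm (f x) * norm (g y)) summable_on A \<times> B"
  proof (rule summable_on_SigmaI)
    show "((\<lambda>y. case (x, y) of (x, y) \<Rightarrow> norm (f x) * norm (g y)) has_sum norm (f x) * (\<Sum>\<^sub>\<infinity>y\<in>B. norm (g y))) B" for x
      using has_sum_cmult_right[OF has_sum_infsum[OF g(2)], of "norm (f x)"] by simp
    show "(\<lambda>x. norm (f x) * (\<Sum>\<^sub>\<infinity>y\<in>B. norm (g y))) summable_on A"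
      by (intro summable_on_cmult_left f)
  qed auto
  moreover have "(\<lambda>(x, y). norm (f x) * norm (g y)) = (\<lambda>p. norm (case p of (x, y) \<Rightarrow> f x * g y))"
    by (auto simp: norm_mult)
  ultimately show "(\<lambda>(x, y). f x * g y) summable_on A \<times> B"
    by (intro abs_summable_summable[of "\<lambda>(x, y). f x * g y"]) simp
qed

lemma even_pronic: "even (k * (k - 1 :: int))"
  by simp

text \<open>The change of indices \<open>(m, n) = (s - t, s + t)\<close> separates the quadratic
  exponents.\<close>

lemma triangular_sum_even:
  "(s - t) * (s - t - 1) div 2 + (s + t) * (s + t - 1) div 2 = 2 * (s * (s - 1) div 2) + (2 * (t * (t - 1) div 2) + (t::int))"
proof -
  have "even (s * (s - 1))" "even (t * (t - 1))" "even ((s - t) * (s - t - 1))" "even ((s + t) * (s + t - 1))"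
    by (rule even_pronic)+
  then obtain a b c d where *: "s * (s - 1) = 2 * a" "t * (t - 1) = 2 * b"
    "(s - t) * (s - t - 1) = 2 * c" "(s + t) * (s + t - 1) = 2 * d"
    by (elim evenE) blast
  have "(s - t) * (s - t - 1) + (s + t) * (s + t - 1) = 2 * (s * (s - 1)) + 2 * (t * (t - 1)) + 2 * t"
    by (simp add: algebra_simps)
  then show ?thesis
    unfolding * by simp
qed

lemma triangular_sum_odd:
  "(s + 1 - t) * (s + 1 - t - 1) div 2 + (s + t) * (s + t - 1) div 2
    = (2 * (s * (s - 1) div 2) + s) + 2 * (t * (t - 1) div (2::int))"
proof -
  have "even (s * (s - 1))" "even (t * (t - 1))" "even ((s + 1 - t) * (s + 1 - t - 1))" "even ((s + t) * (s + t - 1))"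
    by (rule even_pronic)+
  then obtain a b c d where *: "s * (s - 1) = 2 * a" "t * (t - 1) = 2 * b"
    "(s + 1 - t) * (s + 1 - t - 1) = 2 * c" "(s + t) * (s + t - 1) = 2 * d"
    by (elim evenE) blast
  have "(s + 1 - t) * (s + 1 - t - 1) + (s + t) * (s + t - 1) = 2 * (s * (s - 1)) + 2 * (t * (t - 1)) + 2 * s"
    by (simp add: algebra_simps)
  then show ?thesis
    unfolding * by simp
qed

lemma jterm_mult_even:
  assumes "q \<noteq> 0" "x \<noteq> 0" "y \<noteq> 0"
  shows "jterm x q (s - t) * jterm y q (s + t) = jterm (- (x * y)) (q\<^sup>2) s * jterm (- (q * y / x)) (q\<^sup>2) t"
proof -
  have sgn: "(-1 :: complex) powi (s - t) * (-1) powi (s + t) = 1"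
    by (simp flip: power_int_add)
  have sgn': "(-1 :: complex) powi k * (-1) powi k = 1" for k
    by (simp flip: power_int_mult_distrib)
  have neg: "jterm (- w) (q\<^sup>2) k = (q\<^sup>2) powi (k * (k - 1) div 2) * w powi k" for w k
    using power_int_mult_distrib[of "-1" w k] sgn'[of k] by (simp add: jterm_def)
  define a b where ab: "a = s * (s - 1) div 2" "b = t * (t - 1) div 2"
  have "jterm x q (s - t) * jterm y q (s + t)
     = ((-1) powi (s - t) * (-1) powi (s + t)) * q powi ((s - t) * (s - t - 1) div 2 + (s + t) * (s + t - 1) div 2)
       * (x powi (s - t) * y powi (s + t))"
    using assms by (simp add: jterm_def power_int_add)
  also have "\<dots> = q powi (2 * a) * (q powi (2 * b) * q powi t) * ((x * y) powi s * (y / x) powi t)"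
    unfolding sgn triangular_sum_even ab[symmetric] using assms
    by (simp add: power_int_add power_int_diff power_int_mult_distrib power_int_divide_distrib)
  also have "\<dots> = jterm (- (x * y)) (q\<^sup>2) s * jterm (- (q * y / x)) (q\<^sup>2) t"
    unfolding neg ab[symmetric] using assms
    by (simp add: power_int_mult power_int_mult_distrib power_int_divide_distrib)
  finally show ?thesis .
qed

lemma jterm_mult_odd:
  assumes "q \<noteq> 0" "x \<noteq> 0" "y \<noteq> 0"
  shows "jterm x q (s + 1 - t) * jterm y q (s + t) = - x * (jterm (- (q * x * y)) (q\<^sup>2) s * jterm (- (y / x)) (q\<^sup>2) t)"
proof -
  have sgn: "(-1 :: complex) powi (s + 1 - t) * (-1) powi (s + t) = -1"
  proof -
    have "(s + 1 - t) + (s + t) = 2 * s + 1" by simp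
    then show ?thesis
      by (simp add: power_int_add power_int_mult flip: power_int_add)
  qed
  have sgn': "(-1 :: complex) powi k * (-1) powi k = 1" for k
    by (simp flip: power_int_mult_distrib)
  have neg: "jterm (- w) (q\<^sup>2) k = (q\<^sup>2) powi (k * (k - 1) div 2) * w powi k" for w k
    using power_int_mult_distrib[of "-1" w k] sgn'[of k] by (simp add: jterm_def)
  define a b where ab: "a = s * (s - 1) div 2" "b = t * (t - 1) div 2"
  have "jterm x q (s + 1 - t) * jterm y q (s + t)
     = ((-1) powi (s + 1 - t) * (-1) powi (s + t)) * q powi ((s + 1 - t) * (s + 1 - t - 1) div 2 + (s + t) * (s + t - 1) div 2)
       * (x powi (s + 1 - t) * y powi (s + t))"
    using assms by (simp add: jterm_def power_int_add)
  also have "\<dots> = - x * ((q powi (2 * a) * q powi s) * q powi (2 * b) * ((x * y) powi s * (y / x) powi t))"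
    unfolding sgn triangular_sum_odd ab[symmetric] using assms
    by (simp add: power_int_add power_int_diff power_int_mult_distrib power_int_divide_distrib)
  also have "\<dots> = - x * (jterm (- (q * x * y)) (q\<^sup>2) s * jterm (- (y / x)) (q\<^sup>2) t)"
    unfolding neg ab[symmetric] using assms
    by (simp add: power_int_mult power_int_mult_distrib power_int_divide_distrib)
  finally show ?thesis .
qed

text \<open>Multiply the two series and sort the index pairs \<open>(m, n)\<close> by the parity of
  \<open>m + n\<close>: even pairs are \<open>(s - t, s + t)\<close>, odd ones
  \<open>(s + 1 - t, s + t)\<close>, and on each class the double sum factors.\<close>

theorem jfun_mult:
  assumes q: "q \<noteq> 0" "norm q < 1" and x: "x \<noteq> 0" and y: "y \<noteq> 0"
  shows "jfun x q * jfun y q = jfun (- (x * y)) (q\<^sup>2) * jfun (- (q * y / x)) (q\<^sup>2)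
           - x * (jfun (- (q * x * y)) (q\<^sup>2) * jfun (- (y / x)) (q\<^sup>2))"
proof -
  have q2: "q\<^sup>2 \<noteq> 0" "norm (q\<^sup>2) < 1"
    using q norm_power_less_1[of q 2] by auto
  note H = jacobi_triple_product[OF q2] and S = abs_summable_jterm[OF q2]
  let ?f = "\<lambda>(m, n). jterm x q m * jterm y q n"
  have tot: "(?f has_sum (jfun x q * jfun y q)) (UNIV \<times> UNIV)"
    using q x y by (intro has_sum_times jacobi_triple_product abs_summable_jterm)
  have "((\<lambda>(s, t). jterm (- (x * y)) (q\<^sup>2) s * jterm (- (q * y / x)) (q\<^sup>2) t)
      has_sum (jfun (- (x * y)) (q\<^sup>2) * jfun (- (q * y / x)) (q\<^sup>2))) (UNIV \<times> UNIV)"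
    using q x y by (intro has_sum_times H S) auto
  then have "((\<lambda>p. ?f (fst p - snd p, fst p + snd p))
      has_sum (jfun (- (x * y)) (q\<^sup>2) * jfun (- (q * y / x)) (q\<^sup>2))) UNIV"
    by (simp add: case_prod_unfold jterm_mult_even[OF q(1) x y])
  then have e: "(?f has_sum (jfun (- (x * y)) (q\<^sup>2) * jfun (- (q * y / x)) (q\<^sup>2)))
      (range (\<lambda>p::int \<times> int. (fst p - snd p, fst p + snd p)))"
    by (subst has_sum_reindex) (auto simp: inj_on_def o_def)
  have "((\<lambda>(s, t). jterm (- (q * x * y)) (q\<^sup>2) s * jterm (- (y / x)) (q\<^sup>2) t)
      has_sum (jfun (- (q * x * y)) (q\<^sup>2) * jfun (- (y / x)) (q\<^sup>2))) (UNIV \<times> UNIV)"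
    using q x y by (intro has_sum_times H S) auto
  from has_sum_cmult_right[OF this, of "- x"]
  have "((\<lambda>p. ?f (fst p + 1 - snd p, fst p + snd p))
      has_sum (- x * (jfun (- (q * x * y)) (q\<^sup>2) * jfun (- (y / x)) (q\<^sup>2)))) UNIV"
    by (simp add: case_prod_unfold jterm_mult_odd[OF q(1) x y])
  then have o: "(?f has_sum (- x * (jfun (- (q * x * y)) (q\<^sup>2) * jfun (- (y / x)) (q\<^sup>2))))
      (range (\<lambda>p::int \<times> int. (fst p + 1 - snd p, fst p + snd p)))"
    by (subst has_sum_reindex) (auto simp: inj_on_def o_def)
  have disj: "range (\<lambda>p::int \<times> int. (fst p - snd p, fst p + snd p)) \<inter> range (\<lambda>p. (fst p + 1 - snd p, fst p + snd p)) = {}"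
    by auto presburger
  have "(m, n) \<in> range (\<lambda>p::int \<times> int. (fst p - snd p, fst p + snd p)) \<union> range (\<lambda>p. (fst p + 1 - snd p, fst p + snd p))" for m n :: int
  proof (cases "even (m + n)")
    case True
    then obtain s where "m + n = 2 * s" by (elim evenE)
    then have "(m, n) = (fst (s, n - s) - snd (s, n - s), fst (s, n - s) + snd (s, n - s))"
      by simp
    then show ?thesis by blast
  next
    case False
    then obtain s where "m + n = 2 * s + 1" by (elim oddE)
    then have "(m, n) = (fst (s, n - s) + 1 - snd (s, n - s), fst (s, n - s) + snd (s, n - s))"
      by simp
    then show ?thesis by blast
  qed
  then have "UNIV \<times> UNIV = range (\<lambda>p::int \<times> int. (fst p - snd p, fst p + snd p)) \<union> range (\<lambda>p. (fst p + 1 - snd p, fst p + snd p))"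
    by auto
  with has_sum_Un_disjoint[OF e o disj]
  have "(?f has_sum (jfun (- (x * y)) (q\<^sup>2) * jfun (- (q * y / x)) (q\<^sup>2)
      + - x * (jfun (- (q * x * y)) (q\<^sup>2) * jfun (- (y / x)) (q\<^sup>2)))) (UNIV \<times> UNIV)"
    by simp
  from has_sum_unique[OF tot this] show ?thesis by simp
qed

section \<open>Theta functions at eighth roots of unity\<close>

lemma jfun_neg_one:
  assumes "norm q < 1" "q \<noteq> 0"
  shows "jfun (-1) q = 2 * eta (q\<^sup>2) ^ 2 / eta q"
proof -
  have "jfun (-1) q = 2 * (qpoch_inf (- q) q)\<^sup>2 * eta q"
    using qpoch_inf_shift[OF assms(1), of "-1"] by (simp add: jfun_def eta_def power2_eq_square)
  then show ?thesis
    using eta_nz[OF assms(1)] by (simp add: qpoch_inf_neg_eta[OF assms(1)] power2_eq_square)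
qed

lemma jfun_theta_minus:
  assumes "norm q < 1" "q \<noteq> 0"
  shows "jfun q (q\<^sup>2) = eta q ^ 2 / eta (q\<^sup>2)"
proof -
  have "q\<^sup>2 / q = q" using assms by (simp add: power2_eq_square)
  then have "jfun q (q\<^sup>2) = (qpoch_inf q (q\<^sup>2))\<^sup>2 * eta (q\<^sup>2)"
    by (simp add: jfun_def eta_def power2_eq_square[of "qpoch_inf _ _"])
  then show ?thesis
    unfolding qpoch_inf_odd_eta[OF assms(1)] using eta_nz[OF norm_power_less_1[OF assms(1), of 2]]
    by (simp add: power_divide power2_eq_square)
qed

lemma jfun_theta_plus:
  assumes "norm q < 1" "q \<noteq> 0"
  shows "jfun (- q) (q\<^sup>2) = eta (q\<^sup>2) ^ 5 / (eta q ^ 2 * eta (q ^ 4) ^ 2)"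
proof -
  have "q\<^sup>2 / (- q) = - q" using assms by (simp add: power2_eq_square)
  then have "jfun (- q) (q\<^sup>2) = (qpoch_inf (- q) (q\<^sup>2))\<^sup>2 * eta (q\<^sup>2)"
    by (simp add: jfun_def eta_def power2_eq_square[of "qpoch_inf _ _"])
  also have "\<dots> = (eta (q\<^sup>2) ^ 2) ^ 2 * eta (q\<^sup>2) / (eta q ^ 2 * eta (q ^ 4) ^ 2)"
    unfolding qpoch_inf_neg_odd_eta[OF assms(1)] by (simp add: power_divide power_mult_distrib)
  also have "(x ^ 2) ^ 2 * x = x ^ 5" for x :: complex
    by (simp add: eval_nat_numeral)
  finally show ?thesis .
qed

lemma jfun_theta_split:
  assumes "norm q < 1" "q \<noteq> 0"
  shows "jfun (- q) (q\<^sup>2) = jfun (- (q ^ 4)) (q ^ 8) + q * jfun (-1) (q ^ 8)"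
    and "jfun q (q\<^sup>2) = jfun (- (q ^ 4)) (q ^ 8) - q * jfun (-1) (q ^ 8)"
proof -
  have q2: "q\<^sup>2 \<noteq> 0" "norm (q\<^sup>2) < 1"
    using assms norm_power_less_1[of q 2] by auto
  have r: "jfun (- (q ^ 8)) (q ^ 8) = jfun (-1) (q ^ 8)"
    using jfun_reflect[of "q ^ 8" "-1"] assms by simp
  have "jfun x (q\<^sup>2) = jfun (- (q ^ 4)) (q ^ 8) - x * jfun (- (q ^ 8)) (q ^ 8)" if "x\<^sup>2 = q\<^sup>2" for x
  proof -
    have "x \<noteq> 0" using that q2 by auto
    then show ?thesis
      using jfun_even_odd[OF q2, of x] that by (simp flip: power_mult power_add)
  qed
  from this[of "- q"] this[of q] show
    "jfun (- q) (q\<^sup>2) = jfun (- (q ^ 4)) (q ^ 8) + q * jfun (-1) (q ^ 8)"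
    "jfun q (q\<^sup>2) = jfun (- (q ^ 4)) (q ^ 8) - q * jfun (-1) (q ^ 8)"
    unfolding r by simp_all
qed

text \<open>Two even/odd splittings, \<open>q \<rightarrow> q\<^sup>4 \<rightarrow> q\<^bsup>16\<^esup>\<close>; then \<open>x\<^sup>4 = e = \<plusminus>1\<close> pairs up the four parts.\<close>

lemma jfun_fourth_root:
  assumes q: "norm q < 1" "q \<noteq> 0" and x: "x ^ 4 = e" "e\<^sup>2 = 1"
  shows "jfun x q = (1 - x) * jfun (- (q ^ 6 * e)) (q ^ 16) + q * x\<^sup>2 * (1 - e * x) * jfun (- (q\<^sup>2 * e)) (q ^ 16)"
proof -
  have e0: "e \<noteq> 0" using x by auto
  then have x0: "x \<noteq> 0" using x by auto
  have e1: "1 / e = e" using x e0 by (simp add: field_simps power2_eq_square)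
  have q4: "q ^ 4 \<noteq> 0" "norm (q ^ 4) < 1" and q16: "q ^ 16 \<noteq> 0" "norm (q ^ 16) < 1"
    using q norm_power_less_1[of q 4] norm_power_less_1[of q 16] by auto
  have split: "jfun (- (q ^ k * x\<^sup>2)) (q ^ 4) = jfun (- (q ^ (4 + 2 * k) * e)) (q ^ 16)
      + q ^ k * x\<^sup>2 * jfun (- (q ^ (12 + 2 * k) * e)) (q ^ 16)" for k
  proof -
    have "(- (q ^ k * x\<^sup>2))\<^sup>2 = q ^ (2 * k) * e"
      by (simp add: power_mult_distrib x(1)[symmetric] mult.commute flip: power_mult)
    then show ?thesis
      using jfun_even_odd[OF q4, of "- (q ^ k * x\<^sup>2)"] q x0
      by (simp add: power_add mult.assoc flip: power_mult)
  qed
  \<comment> \<open>Since \<open>1 / e = e\<close>, reflection identifies the exponents 10 with 6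
    and 14 with 2; the exponent 18 is brought back to 2 by a full period.\<close>
  have refl: "jfun (- (q ^ (16 - k) * e)) (q ^ 16) = jfun (- (q ^ k * e)) (q ^ 16)" if "k \<le> 16" for k
  proof -
    have "q ^ 16 / (- (q ^ k * e)) = - (q ^ (16 - k) * (1 / e))"
      using that q e0 by (simp add: power_diff)
    then show ?thesis
      using jfun_reflect[OF q16(1), of "- (q ^ k * e)"] q e0 e1 by simp
  qed
  have "jfun (- (q ^ 18 * e)) (q ^ 16) = jfun (q ^ 16 * (- (q\<^sup>2 * e))) (q ^ 16)"
    by (simp flip: power_add)
  also have "\<dots> = jfun (- (q\<^sup>2 * e)) (q ^ 16) / (q\<^sup>2 * e)"
    using jfun_shift[OF q16(2,1), of "- (q\<^sup>2 * e)"] q e0 by simp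
  also have "\<dots> = e * jfun (- (q\<^sup>2 * e)) (q ^ 16) / q\<^sup>2"
    using x e0 q by (simp add: field_simps power2_eq_square)
  finally have wrap: "jfun (- (q ^ 18 * e)) (q ^ 16) = e * jfun (- (q\<^sup>2 * e)) (q ^ 16) / q\<^sup>2" .
  have "jfun x q = jfun (- (q ^ 6 * e)) (q ^ 16) + q * x\<^sup>2 * jfun (- (q ^ 14 * e)) (q ^ 16)
      - x * (jfun (- (q ^ 10 * e)) (q ^ 16) + q ^ 3 * x\<^sup>2 * jfun (- (q ^ 18 * e)) (q ^ 16))"
    using jfun_even_odd[OF q(2,1) x0] split[of 1] split[of 3] by simp
  also have "\<dots> = (1 - x) * jfun (- (q ^ 6 * e)) (q ^ 16) + q * x\<^sup>2 * (1 - e * x) * jfun (- (q\<^sup>2 * e)) (q ^ 16)"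
    using refl[of 2] refl[of 6] wrap q by (simp add: field_simps power2_eq_square eval_nat_numeral)
  finally show ?thesis .
qed

context nome
begin

text \<open>\<open>B + qC\<close> is \<open>\<Sum> q\<^bsup>n\<^sup>2\<^esup>\<close> split by the parity of \<open>n\<close>, and \<open>A0 + A1 + A3 + A6\<close> is
  \<open>\<Sum> q\<^bsup>k(k+1)/2\<^esup>\<close> over \<open>k \<ge> 0\<close>, split by the leading exponents \<open>0, 1, 3, 6\<close> of the classes of \<open>k\<close> modulo 8.\<close>

definition "B = jfun (- (q ^ 4)) (q ^ 8)"
definition "C = jfun (-1) (q ^ 8)"
definition "A0 = jfun (- (q ^ 28)) (q ^ 64)"
definition "A1 = q * jfun (- (q ^ 20)) (q ^ 64)"
definition "A3 = q ^ 3 * jfun (- (q ^ 52)) (q ^ 64)"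
definition "A6 = q ^ 6 * jfun (- (q ^ 60)) (q ^ 64)"

lemma eta_pow_nz: "n > 0 \<Longrightarrow> eta (q ^ n) \<noteq> 0"
  by (intro eta_nz norm_pow)

text \<open>A third even/odd splitting. Squaring removes \<open>e\<close> from the new arguments, so
  it survives only as a sign.\<close>

lemma split_16:
  assumes "e\<^sup>2 = 1"
  shows "jfun (- (q ^ 6 * e)) (q ^ 16) = A0 + e * A6"
    and "q * jfun (- (q\<^sup>2 * e)) (q ^ 16) = A1 + e * A3"
proof -
  have e0: "e \<noteq> 0" using assms by auto
  have n: "q ^ 16 \<noteq> 0" "norm (q ^ 16) < 1"
    using norm_pow[of 16] pow_nz by auto
  have "(- (q ^ 6 * e))\<^sup>2 = q ^ 12" "(- (q\<^sup>2 * e))\<^sup>2 = q ^ 4"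
    using assms by (simp_all add: power_mult_distrib flip: power_mult)
  then have "jfun (- (q ^ 6 * e)) (q ^ 16) = jfun (- (q ^ 28)) (q ^ 64) + q ^ 6 * e * jfun (- (q ^ 60)) (q ^ 64)"
    and 2: "jfun (- (q\<^sup>2 * e)) (q ^ 16) = jfun (- (q ^ 20)) (q ^ 64) + q\<^sup>2 * e * jfun (- (q ^ 52)) (q ^ 64)"
    using jfun_even_odd[OF n, of "- (q ^ 6 * e)"] jfun_even_odd[OF n, of "- (q\<^sup>2 * e)"] q0 e0
    by (simp_all flip: power_mult power_add)
  then show "jfun (- (q ^ 6 * e)) (q ^ 16) = A0 + e * A6"
    by (simp add: A0_def A6_def)
  have "q * (x + q\<^sup>2 * e * y) = q * x + e * (q ^ 3 * y)" for x y
    by (simp add: eval_nat_numeral algebra_simps)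
  then show "q * jfun (- (q\<^sup>2 * e)) (q ^ 16) = A1 + e * A3"
    unfolding 2 A1_def A3_def .
qed

lemma jfun_root_of_unity:
  assumes "x ^ 4 = e" "e\<^sup>2 = 1"
  shows "jfun x q = (1 - x) * (A0 + e * A6) + x\<^sup>2 * (1 - e * x) * (A1 + e * A3)"
  unfolding split_16[OF assms(2), symmetric] using jfun_fourth_root[OF q1 q0 assms] by (simp add: mult_ac)

text \<open>The evaluation at \<open>x = -1\<close>, \<open>e = 1\<close>.\<close>

lemma sum_A: "A0 + A1 + A3 + A6 = eta (q\<^sup>2) ^ 2 / eta q"
proof -
  have "2 * (A0 + A1 + A3 + A6) = jfun (-1) q"
    using jfun_root_of_unity[of "-1" 1] by (simp add: algebra_simps)
  also have "\<dots> = 2 * (eta (q\<^sup>2) ^ 2 / eta q)"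
    using jfun_neg_one[OF q1 q0] by simp
  finally show ?thesis
    unfolding mult_cancel_left by simp
qed

lemma alt_sum_A: "A0 - A1 - A3 + A6 = eta (q ^ 4) * eta q / eta (q\<^sup>2)"
proof -
  have "jfun \<i> q = (1 - \<i>) * (A0 + A6 - (A1 + A3))"
    using jfun_root_of_unity[of \<i> 1] by (simp add: algebra_simps)
  moreover have "jfun \<i> q = (1 - \<i>) * eta (q ^ 4) * eta q / eta (q\<^sup>2)"
    using jfun_neg_imaginary_unit[OF q1, of "- \<i>"] by simp
  moreover have "1 - \<i> \<noteq> 0"
    by (simp add: complex_eq_iff)
  ultimately have "(1 - \<i>) * (A0 + A6 - (A1 + A3)) = (1 - \<i>) * (eta (q ^ 4) * eta q / eta (q\<^sup>2))"
    by (simp only: times_divide_eq_right mult.assoc)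
  with \<open>1 - \<i> \<noteq> 0\<close> show ?thesis
    unfolding mult_cancel_left by (simp add: algebra_simps)
qed

lemma B_eta: "B = eta (q ^ 8) ^ 5 / (eta (q ^ 4) ^ 2 * eta (q ^ 16) ^ 2)"
  using jfun_theta_plus[OF norm_pow pow_nz, of 4] by (simp add: B_def flip: power_mult)

lemma theta_BC: "jfun (- q) (q\<^sup>2) = B + q * C" "jfun q (q\<^sup>2) = B - q * C"
  using jfun_theta_split[OF q1 q0] by (simp_all add: B_def C_def)

lemma theta_2_eta: "jfun (- (q\<^sup>2)) (q ^ 4) = eta (q ^ 4) ^ 5 / (eta (q\<^sup>2) ^ 2 * eta (q ^ 8) ^ 2)"
  using jfun_theta_plus[OF norm_pow pow_nz, of 2] by (simp flip: power_mult)

text \<open>For \<open>e = -1\<close> the splittings involve only these differences; they equal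
  \<open>jfun (q ^ 6) (q ^ 16)\<close> and \<open>q * jfun (q\<^sup>2) (q ^ 16)\<close>.\<close>

definition "a = A0 - A6"
definition "b = A1 - A3"
text \<open>The even and odd halves of theta functions of nome \<open>q ^ 8\<close>:
  \<open>u - v\<close> and \<open>u + v\<close> are \<open>jfun\<close> at \<open>q\<^sup>2\<close>
  and at \<open>- (q\<^sup>2)\<close>.\<close>

definition "u = jfun (- (q ^ 12)) (q ^ 32)"
definition "v = q\<^sup>2 * jfun (- (q ^ 4)) (q ^ 32)"

lemma uv_eta: "u - v = eta (q\<^sup>2) * eta (q ^ 8) / eta (q ^ 4)" "u + v = eta (q ^ 4) ^ 2 / eta (q\<^sup>2)"
proof -
  have n8: "q ^ 8 \<noteq> 0" "norm (q ^ 8) < 1" and n32: "q ^ 32 \<noteq> 0" "norm (q ^ 4) < 1"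
    using norm_pow pow_nz by auto
  have r: "jfun (- (q ^ 28)) (q ^ 32) = jfun (- (q ^ 4)) (q ^ 32)"
    using jfun_reflect[OF n32(1), of "- (q ^ 4)"] q0 by (simp add: power_diff[symmetric])
  have s: "jfun x (q ^ 8) = u - x * jfun (- (q ^ 4)) (q ^ 32)" if "x\<^sup>2 = q ^ 4" for x
  proof -
    have "x \<noteq> 0" using that q0 by auto
    then show ?thesis
      using jfun_even_odd[OF n8, of x] that r by (simp add: u_def flip: power_mult power_add)
  qed
  have 4: "(q\<^sup>2)\<^sup>2 = q ^ 4" "(- (q\<^sup>2))\<^sup>2 = q ^ 4"
    by (simp_all flip: power_mult)
  \<comment> \<open>The two products of \<open>jfun x (q ^ 8)\<close> are the two residue classes of
    a single product with base \<open>q ^ 4\<close>.\<close>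
  have p: "jfun x (q ^ 8) = qpoch_inf x (q ^ 4) * eta (q ^ 8)" if "x\<^sup>2 = q ^ 4" for x
  proof -
    have x0: "x \<noteq> 0" using that q0 by auto
    have "q ^ 8 = x * x * q ^ 4"
      using that by (simp flip: power_add power2_eq_square)
    then have "q ^ 8 / x = x * q ^ 4"
      using x0 by simp
    then show ?thesis
      using qpoch_inf_dissect_2[OF n32(2), of x] by (simp add: jfun_def eta_def flip: power_mult)
  qed
  have "u - v = qpoch_inf (q\<^sup>2) (q ^ 4) * eta (q ^ 8)"
    using s[OF 4(1)] p[OF 4(1)] by (simp add: v_def)
  also have "qpoch_inf (q\<^sup>2) (q ^ 4) = eta (q\<^sup>2) / eta (q ^ 4)"
    using qpoch_inf_odd_eta[OF norm_pow, of 2] by (simp flip: power_mult)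
  finally show "u - v = eta (q\<^sup>2) * eta (q ^ 8) / eta (q ^ 4)" by simp
  have "u + v = qpoch_inf (- (q\<^sup>2)) (q ^ 4) * eta (q ^ 8)"
    using s[OF 4(2)] p[OF 4(2)] by (simp add: v_def)
  also have "qpoch_inf (- (q\<^sup>2)) (q ^ 4) = eta (q ^ 4) ^ 2 / (eta (q\<^sup>2) * eta (q ^ 8))"
    using qpoch_inf_neg_odd_eta[OF norm_pow, of 2] by (simp flip: power_mult)
  finally show "u + v = eta (q ^ 4) ^ 2 / eta (q\<^sup>2)"
    using eta_pow_nz[of 8] by simp
qed

text \<open>By \<open>jfun_mult\<close> the squares of \<open>a\<close> and \<open>b\<close> are
  bilinear in \<open>u\<close>, \<open>v\<close> and the halves \<open>Bp\<close>, \<open>Cp\<close>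
  of \<open>B\<close>, and \<open>a * b\<close> contains the factor \<open>u - v\<close>. These
  relations later clear a denominator linear in \<open>a\<close> and \<open>b\<close>.\<close>

lemma ab_quadratic:
  "a\<^sup>2 - b\<^sup>2 = B * (u - v)" "2 * a * b = q * C * (u - v)" "a\<^sup>2 + b\<^sup>2 = jfun (q ^ 4) (q ^ 8) * (u + v)"
proof -
  have n16: "q ^ 16 \<noteq> 0" "norm (q ^ 16) < 1" and n32: "q ^ 32 \<noteq> 0" "norm (q ^ 32) < 1"
    using norm_pow pow_nz by auto
  have refl: "jfun (- (q ^ (32 - k))) (q ^ 32) = jfun (- (q ^ k)) (q ^ 32)" if "k \<le> 32" for k
    using jfun_reflect[OF n32(1), of "- (q ^ k)"] that q0 by (simp add: power_diff)
  define Bp where "Bp = jfun (- (q ^ 16)) (q ^ 32)"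
  define Cp where "Cp = jfun (-1) (q ^ 32)"
  have aa: "a = jfun (q ^ 6) (q ^ 16)" and bb: "b = q * jfun (q\<^sup>2) (q ^ 16)"
    using split_16[of "-1"] by (simp_all add: a_def b_def)
  have "a\<^sup>2 = u * Bp - q ^ 4 * v * Cp"
  proof -
    have "a\<^sup>2 = jfun (- (q ^ 12)) (q ^ 32) * Bp - q ^ 6 * (jfun (- (q ^ 28)) (q ^ 32) * Cp)"
      using jfun_mult[OF n16, of "q ^ 6" "q ^ 6"] q0 power_diff[of q 6 22]
      by (simp add: aa Bp_def Cp_def power2_eq_square[of "jfun _ _"] flip: power_mult power_add)
    also have "jfun (- (q ^ 28)) (q ^ 32) = jfun (- (q ^ 4)) (q ^ 32)"
      using refl[of 4] by simp
    finally show ?thesis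
      unfolding u_def v_def by algebra
  qed
  moreover have "b\<^sup>2 = v * Bp - q ^ 4 * u * Cp"
  proof -
    have "jfun (q\<^sup>2) (q ^ 16) * jfun (q\<^sup>2) (q ^ 16) = jfun (- (q ^ 4)) (q ^ 32) * Bp - q\<^sup>2 * (jfun (- (q ^ 20)) (q ^ 32) * Cp)"
      using jfun_mult[OF n16, of "q\<^sup>2" "q\<^sup>2"] q0 power_diff[of q 2 18]
      by (simp add: Bp_def Cp_def flip: power_mult power_add)
    moreover have "jfun (- (q ^ 20)) (q ^ 32) = u"
      using refl[of 12] by (simp add: u_def)
    moreover have "b\<^sup>2 = q\<^sup>2 * (jfun (q\<^sup>2) (q ^ 16) * jfun (q\<^sup>2) (q ^ 16))"
      by (simp add: bb power2_eq_square)
    ultimately show ?thesis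
      unfolding v_def by algebra
  qed
  moreover have "B = Bp + q ^ 4 * Cp" "jfun (q ^ 4) (q ^ 8) = Bp - q ^ 4 * Cp"
    using jfun_theta_split[OF norm_pow pow_nz, of 4] by (simp_all add: B_def Bp_def Cp_def flip: power_mult)
  ultimately show "a\<^sup>2 - b\<^sup>2 = B * (u - v)" "a\<^sup>2 + b\<^sup>2 = jfun (q ^ 4) (q ^ 8) * (u + v)"
    by (simp_all only: left_diff_distrib distrib_left distrib_right right_diff_distrib mult_ac) simp_all
  have "jfun (q\<^sup>2) (q ^ 16) * jfun (q ^ 6) (q ^ 16)
      = jfun (- (q ^ 8)) (q ^ 32) * jfun (- (q ^ 20)) (q ^ 32) - q\<^sup>2 * (jfun (- (q ^ 24)) (q ^ 32) * jfun (- (q ^ 4)) (q ^ 32))"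
  proof -
    have "q ^ 16 * q ^ 6 / q\<^sup>2 = q ^ 20" "q ^ 6 / q\<^sup>2 = q ^ 4"
      using q0 by (simp_all add: field_simps flip: power_add)
    then show ?thesis
      using jfun_mult[OF n16, of "q\<^sup>2" "q ^ 6"] q0 by (simp flip: power_mult power_add)
  qed
  then have ab: "a * b = q * jfun (- (q ^ 8)) (q ^ 32) * (u - v)"
  proof -
    have r: "jfun (- (q ^ 24)) (q ^ 32) = jfun (- (q ^ 8)) (q ^ 32)"
      "jfun (- (q ^ 20)) (q ^ 32) = jfun (- (q ^ 12)) (q ^ 32)"
      using refl[of 8] refl[of 12] by simp_all
    show ?thesis
      using \<open>jfun (q\<^sup>2) (q ^ 16) * jfun (q ^ 6) (q ^ 16) = _\<close>
      unfolding aa bb u_def v_def r by algebra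
  qed
  have "C = 2 * jfun (- (q ^ 8)) (q ^ 32)"
    using jfun_even_odd[OF pow_nz norm_pow, of 8 "-1"] refl[of 8] by (simp add: C_def flip: power_mult)
  with ab show "2 * a * b = q * C * (u - v)"
    by simp
qed

text \<open>In the product formula for the squares of the theta functions at \<open>q\<close> and
  \<open>- q\<close> the second term is odd in the argument and cancels on addition.\<close>

lemma BC_square: "B\<^sup>2 + (q * C)\<^sup>2 = jfun (- (q\<^sup>2)) (q ^ 4) ^ 2"
proof -
  have n: "q\<^sup>2 \<noteq> 0" "norm (q\<^sup>2) < 1"
    using norm_pow pow_nz by auto
  have "jfun x (q\<^sup>2) * jfun x (q\<^sup>2) = jfun (- (q\<^sup>2)) (q ^ 4) ^ 2 - x * (jfun (- (q ^ 4)) (q ^ 4) * jfun (-1) (q ^ 4))"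
    if "x * x = q\<^sup>2" for x
  proof -
    have "x \<noteq> 0" using that q0 by auto
    then show ?thesis
      using jfun_mult[OF n, of x x] that by (simp add: mult.assoc power2_eq_square[of "jfun _ _"] flip: power_mult power_add)
  qed
  from this[of q] this[of "- q"] show ?thesis
    unfolding theta_BC by (simp add: power2_eq_square) algebra
qed

end

section \<open>The rank generating function at eighth roots of unity\<close>

lemma gmock_reflect:
  assumes "q \<noteq> 0" "norm q < 1" "x \<noteq> 0" "ptheta x q \<noteq> 0"
  shows "gmock (q / x) q = gmock x q"
  using assms gmock_eq[of q x] gmock_eq[of q "q / x"] Gam_reflect[of q x] ptheta_reflect[of q x] by simp

context nome
begin

definition "rank_fun z = (1 - z) * (1 + z * gmock z q)"

lemma norm_1_of_power:
  fixes z :: complex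
  assumes "norm (z ^ n) = 1" "n > 0"
  shows "norm z = 1"
  using assms power_eq_imp_eq_base[of "norm z" n 1] by (simp add: norm_power)

lemma powi_neq_1:
  fixes r :: real
  assumes "0 < r" "r < 1" "n \<noteq> 0"
  shows "r powi n \<noteq> 1"
proof (cases "n > 0")
  case True
  then have "r ^ nat n < 1"
    using assms by (simp add: power_less_one_iff)
  then show ?thesis
    using True by (simp add: power_int_def)
next
  case False
  then have "r ^ nat (- n) < 1"
    using assms by (simp add: power_less_one_iff)
  then show ?thesis
    using False assms by (simp add: power_int_def power_inverse)
qed

text \<open>Zeros are recognised by their modulus: those of \<open>ptheta z q\<close> are powers of
  \<open>q\<close>, and a zero of \<open>D\<close> on the unit circle would need
  \<open>4 * n = 2\<close>.\<close>

lemma norm_1_nz: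
  assumes "norm z = 1"
  shows "z \<noteq> 1 \<Longrightarrow> ptheta z q \<noteq> 0" and "D z \<noteq> 0"
proof -
  have z0: "z \<noteq> 0" using assms by auto
  have r: "0 < norm q" "norm q < 1" using q0 q1 by auto
  show "ptheta z q \<noteq> 0" if "z \<noteq> 1"
  proof (rule ptheta_nz[OF q1 q0 z0])
    fix n
    show "z \<noteq> q powi n"
    proof
      assume z: "z = q powi n"
      then have "norm q powi n = 1"
        using assms by (simp add: norm_power_int)
      then have "n = 0"
        using powi_neq_1[OF r] by blast
      then show False using z that by simp
    qed
  qed
  have "- (q ^ 2 * z ^ 4) \<noteq> (q ^ 4) powi n" for n
  proof
    assume eq: "- (q ^ 2 * z ^ 4) = (q ^ 4) powi n"
    have "norm q ^ 2 = norm q powi (4 * n)"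
      using arg_cong[OF eq, of norm] assms by (simp add: norm_mult norm_power norm_power_int power_int_mult)
    then have "norm q powi (2 - 4 * n) = 1"
      using q0 by (simp add: power_int_diff)
    moreover have "2 - 4 * n \<noteq> 0" by presburger
    ultimately show False
      using powi_neq_1[OF r] by blast
  qed
  then show "D z \<noteq> 0"
    unfolding D_def using z0 q0 by (intro ptheta_nz norm_pow pow_nz) auto
qed

text \<open>The reflection of \<open>g\<close> at nome \<open>q ^ 16\<close>, with
  \<open>1 / e = e\<close>, merges the terms 14 with 2 and 10 with 6.\<close>

lemma rank_fun_dissection:
  assumes z: "norm z = 1" "z \<noteq> 1" "z ^ 4 = e" "e\<^sup>2 = 1"
  shows "rank_fun z = (2 - z - 1 / z) * (1 - e * q\<^sup>2 * gmock (- (q\<^sup>2 * e)) (q ^ 16))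
    + (z - z\<^sup>2 - 1 / z\<^sup>2 + 1 / z) * (q ^ 5 * gmock (- (q ^ 6 * e)) (q ^ 16))
    + (1 - z) * thetapart z / (jfun z q * jfun (- (q\<^sup>2 * e)) (q ^ 4))"
proof -
  have z0: "z \<noteq> 0" using z by auto
  have e0: "e \<noteq> 0"
    using z(4) by auto
  then have e1: "1 / e = e"
    using z(4) by (metis nonzero_eq_divide_eq power2_eq_square)
  have Dz: "D z \<noteq> 0"
    using norm_1_nz(2)[OF z(1)] .
  have g: "gmock (- (q ^ (16 - k) * e)) (q ^ 16) = gmock (- (q ^ k * e)) (q ^ 16)"
    if "k \<le> 16" "P k z \<noteq> 0" for k
  proof -
    have "q ^ 16 / (- (q ^ k * e)) = - (q ^ (16 - k) * (1 / e))"
      using that q0 e0 by (simp add: power_diff)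
    moreover have "ptheta (- (q ^ k * e)) (q ^ 16) \<noteq> 0"
      using that(2) by (simp add: P_def z(3))
    ultimately show ?thesis
      using gmock_reflect[OF pow_nz norm_pow, of 16 "- (q ^ k * e)"] q0 e0 e1 by simp
  qed
  have P: "P 2 z \<noteq> 0" "P 6 z \<noteq> 0"
    using Dz unfolding D_prod[OF z0] by auto
  define t where "t = thetapart z / (jfun z q * jfun (- (q\<^sup>2 * e)) (q ^ 4))"
  define g1 g2 where "g1 = gmock (- (q\<^sup>2 * e)) (q ^ 16)" "g2 = gmock (- (q ^ 6 * e)) (q ^ 16)"
  have "gmock z q = - 1 / z\<^sup>2 - q\<^sup>2 * z ^ 3 * g1 + q ^ 5 * g2 - q ^ 5 / z ^ 3 * g2 + q\<^sup>2 / z ^ 6 * g1 + t / z"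
    using gmock_dissection[OF z0 norm_1_nz(1)[OF z(1,2)] Dz] g[of 2] g[of 6] P
    by (simp add: z(3) t_def g1_g2_def)
  then have "z * gmock z q = z * (- 1 / z\<^sup>2 - q\<^sup>2 * z ^ 3 * g1 + q ^ 5 * g2 - q ^ 5 / z ^ 3 * g2 + q\<^sup>2 / z ^ 6 * g1 + t / z)"
    by simp
  also have "\<dots> = - 1 / z - q\<^sup>2 * z ^ 4 * g1 + q ^ 5 * z * g2 - q ^ 5 / z\<^sup>2 * g2 + q\<^sup>2 * (1 / z ^ 4) / z * g1 + t"
    using z0 by (simp add: divide_simps) algebra
  also have "\<dots> = - 1 / z - q\<^sup>2 * e * g1 + q ^ 5 * z * g2 - q ^ 5 / z\<^sup>2 * g2 + q\<^sup>2 * e / z * g1 + t"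
    unfolding z(3) e1 by simp
  finally have "rank_fun z = (1 - z) * (1 - 1 / z - q\<^sup>2 * e * g1 + q ^ 5 * z * g2 - q ^ 5 / z\<^sup>2 * g2 + q\<^sup>2 * e / z * g1 + t)"
    by (simp add: rank_fun_def)
  also have "\<dots> = (2 - z - 1 / z) * (1 - e * q\<^sup>2 * g1) + (z - z\<^sup>2 - 1 / z\<^sup>2 + 1 / z) * (q ^ 5 * g2) + (1 - z) * t"
    using z0 by (simp add: divide_simps) algebra
  finally show ?thesis
    unfolding t_def g1_g2_def by simp
qed

lemma rank_fun_minus_1:
  "rank_fun (-1) = 4 * (1 - q\<^sup>2 * gmock (- (q\<^sup>2)) (q ^ 16)) - 4 * (q ^ 5 * gmock (- (q ^ 6)) (q ^ 16))
     - (3 * B + q * C) * (A0 - A1 - A3 + A6) / eta (q ^ 4)"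
proof -
  note nz = eta_nz[OF q1] eta_pow_nz[of 2, simplified] eta_pow_nz[of 4, simplified]
    eta_pow_nz[of 8, simplified] eta_pow_nz[of 16, simplified]
  have j1: "jfun (- (q\<^sup>2)) (q\<^sup>2) = 2 * eta (q ^ 4) ^ 2 / eta (q\<^sup>2)"
    using jfun_reflect[OF pow_nz, of "-1" 2] jfun_neg_one[OF norm_pow pow_nz, of 2] by (simp flip: power_mult)
  have "thetapart (-1) = - (eta (q ^ 4) ^ 5 / (eta (q ^ 8) ^ 2 * eta (q\<^sup>2))) * (B + q * C)
      - eta (q ^ 4) * eta (q ^ 8) ^ 3 / eta (q ^ 16) ^ 2 * (2 * eta (q ^ 4) ^ 2 / eta (q\<^sup>2))"
    by (simp add: thetapart_def theta_BC j1)
  \<comment> \<open>By \<open>B_eta\<close> the last term is the common prefactor times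
    \<open>- 2 * B\<close>.\<close>
  also have "\<dots> = - (eta (q ^ 4) ^ 5 / (eta (q ^ 8) ^ 2 * eta (q\<^sup>2))) * (3 * B + q * C)"
    unfolding B_eta using nz by (simp add: divide_simps) algebra
  finally have t: "thetapart (-1) = - (eta (q ^ 4) ^ 5 / (eta (q ^ 8) ^ 2 * eta (q\<^sup>2))) * (3 * B + q * C)" .
  have "2 * thetapart (-1) / (jfun (-1) q * jfun (- (q\<^sup>2)) (q ^ 4)) = - ((3 * B + q * C) * (A0 - A1 - A3 + A6) / eta (q ^ 4))"
    unfolding t jfun_neg_one[OF q1 q0] theta_2_eta alt_sum_A using nz by (simp add: divide_simps)
  then show ?thesis
    using rank_fun_dissection[of "-1" 1] by simp
qed

lemma rank_fun_imaginary_unit: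
  assumes z: "z\<^sup>2 = -1"
  shows "rank_fun z = 2 * (1 - q\<^sup>2 * gmock (- (q\<^sup>2)) (q ^ 16)) + 2 * (q ^ 5 * gmock (- (q ^ 6)) (q ^ 16))
     - (B - q * C) * (A0 + A1 + A3 + A6) / eta (q ^ 4)"
proof -
  note nz = eta_nz[OF q1] eta_pow_nz[of 2, simplified] eta_pow_nz[of 4, simplified]
    eta_pow_nz[of 8, simplified] eta_pow_nz[of 16, simplified]
  have z4: "z ^ 4 = 1"
  proof -
    have "z ^ 4 = (z\<^sup>2)\<^sup>2" by (simp flip: power_mult)
    then show ?thesis using z by simp
  qed
  have n: "norm z = 1"
    by (rule norm_1_of_power[of z 4]) (simp_all add: z4)
  have z1: "z \<noteq> 1" and z0: "z \<noteq> 0" using z by auto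
  have inv: "1 / z = - z"
    using z z0 by (simp add: field_simps power2_eq_square)
  have jz: "jfun z q = (1 - z) * eta (q ^ 4) * eta q / eta (q\<^sup>2)"
    using jfun_neg_imaginary_unit[OF q1, of "- z"] z by simp
  \<comment> \<open>As \<open>z\<^sup>2 = -1\<close>, this is the second theta function of
    \<open>thetapart\<close>; only the first one contributes.\<close>
  have "jfun (q\<^sup>2) (q\<^sup>2) = 0"
    using ptheta_reflect[of "q\<^sup>2" 1] pow_nz norm_pow[of 2] q0 by (simp add: jfun_ptheta)
  then have t: "thetapart z = - (eta (q ^ 4) ^ 5 / (eta (q ^ 8) ^ 2 * eta (q\<^sup>2))) * (eta q ^ 2 / eta (q\<^sup>2))"
    by (simp add: thetapart_def z jfun_theta_minus[OF q1 q0])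
  have BC: "B - q * C = eta q ^ 2 / eta (q\<^sup>2)"
    using theta_BC(2) jfun_theta_minus[OF q1 q0] by simp
  have "(1 - z) * thetapart z / (jfun z q * jfun (- (q\<^sup>2)) (q ^ 4)) = thetapart z / (eta (q ^ 4) * eta q / eta (q\<^sup>2) * jfun (- (q\<^sup>2)) (q ^ 4))"
    unfolding jz using z1 by simp
  also have "\<dots> = - ((B - q * C) * (A0 + A1 + A3 + A6) / eta (q ^ 4))"
    unfolding t BC sum_A theta_2_eta using nz by (simp add: divide_simps)
  finally have K: "(1 - z) * thetapart z / (jfun z q * jfun (- (q\<^sup>2)) (q ^ 4)) = - ((B - q * C) * (A0 + A1 + A3 + A6) / eta (q ^ 4))" .
  have "2 - z - 1 / z = 2" "z - z\<^sup>2 - 1 / z\<^sup>2 + 1 / z = 2"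
    unfolding inv z by simp_all
  with rank_fun_dissection[OF n z1 z4] K show ?thesis
    by simp
qed

text \<open>The denominator contains \<open>a - (1 + s) * b\<close> with
  \<open>s\<^sup>2 = 2\<close>. Multiplied by it, the claimed numerator \<open>W\<close> becomes
  quadratic in \<open>a\<close> and \<open>b\<close> and reduces to eta quotients by
  \<open>ab_quadratic\<close> and \<open>BC_square\<close>.\<close>

lemma rank_fun_eighth_root:
  assumes z: "z ^ 4 = -1" and s: "s = z + 1 / z"
  shows "rank_fun z = (2 - s) * (1 + q\<^sup>2 * gmock (q\<^sup>2) (q ^ 16)) + s * (q ^ 5 * gmock (q ^ 6) (q ^ 16))
     + (- B * (a + b) + q * C * (a - b) + s * (B * a + q * C * b)) / eta (q ^ 4)"
proof -
  note nz = eta_nz[OF q1] eta_pow_nz[of 2, simplified] eta_pow_nz[of 4, simplified]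
    eta_pow_nz[of 8, simplified] eta_pow_nz[of 16, simplified]
  have n: "norm z = 1"
    by (rule norm_1_of_power[of z 4]) (simp_all add: z)
  have z1: "z \<noteq> 1" and z0: "z \<noteq> 0" using z by auto
  have inv: "1 / z = - (z ^ 3)"
    using z z0 by (simp add: field_simps eval_nat_numeral)
  have inv2: "1 / z\<^sup>2 = - z\<^sup>2"
    using z z0 by (simp add: field_simps eval_nat_numeral)
  have s2: "s\<^sup>2 = 2"
  proof -
    have "s = z - z ^ 3" using s inv by simp
    then show ?thesis using z by algebra
  qed
  have u: "(z\<^sup>2)\<^sup>2 = -1"
    using z by (simp flip: power_mult)
  have j1: "jfun (- (q * z\<^sup>2)) (q\<^sup>2) = eta (q ^ 4) ^ 2 / eta (q ^ 8)"
    by (rule jfun_neg_imaginary_unit_mult[OF q1 q0 u])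
  have j2: "z * jfun (- (q\<^sup>2 * z\<^sup>2)) (q\<^sup>2) = s * (eta (q ^ 8) * eta (q\<^sup>2) / eta (q ^ 4))"
  proof -
    have "jfun (- (q\<^sup>2 * z\<^sup>2)) (q\<^sup>2) = jfun (- (z\<^sup>2)) (q\<^sup>2) / z\<^sup>2"
      using jfun_shift[OF norm_pow pow_nz, of 2 "- (z\<^sup>2)"] z0 by simp
    also have "jfun (- (z\<^sup>2)) (q\<^sup>2) = (1 + z\<^sup>2) * eta (q ^ 8) * eta (q\<^sup>2) / eta (q ^ 4)"
      using jfun_neg_imaginary_unit[OF norm_pow u, of 2] by (simp flip: power_mult)
    finally have "z * jfun (- (q\<^sup>2 * z\<^sup>2)) (q\<^sup>2)
        = z * (1 + z\<^sup>2) / z\<^sup>2 * (eta (q ^ 8) * eta (q\<^sup>2) / eta (q ^ 4))"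
      by (simp add: mult_ac)
    also have "z * (1 + z\<^sup>2) / z\<^sup>2 = s"
      using z0 by (simp add: s field_simps power2_eq_square)
    finally show ?thesis .
  qed
  have t: "thetapart z = - (eta (q ^ 4) ^ 7) / (eta (q ^ 8) ^ 3 * eta (q\<^sup>2)) + s * (eta (q ^ 8) ^ 4 * eta (q\<^sup>2) / eta (q ^ 16) ^ 2)"
  proof -
    have "thetapart z = - (eta (q ^ 4) ^ 5 / (eta (q ^ 8) ^ 2 * eta (q\<^sup>2))) * jfun (- (q * z\<^sup>2)) (q\<^sup>2)
     + eta (q ^ 4) * eta (q ^ 8) ^ 3 / eta (q ^ 16) ^ 2 * (z * jfun (- (q\<^sup>2 * z\<^sup>2)) (q\<^sup>2))"
      by (simp add: thetapart_def)
    then show ?thesis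
      unfolding j1 j2 using nz by (simp add: divide_simps) algebra
  qed
  have jz: "jfun z q = (1 - z) * (a - (1 + s) * b)"
  proof -
    have "jfun z q = (1 - z) * a + z\<^sup>2 * (1 + z) * b"
      using jfun_root_of_unity[OF z] by (simp add: a_def b_def)
    moreover have "(1 - z) * (1 + s) = - (z\<^sup>2 * (1 + z))"
      unfolding s inv using z by algebra
    ultimately show ?thesis
      by algebra
  qed
  define W where "W = - B * (a + b) + q * C * (a - b) + s * (B * a + q * C * b)"
  define c where "c = u - v"
  have "W * (a - (1 + s) * b) = - B * (a\<^sup>2 - b\<^sup>2 + 2 * a * b) + q * C * (a\<^sup>2 - b\<^sup>2 - 2 * a * b) + s * (B * (a\<^sup>2 + b\<^sup>2))"
  proof -
    have "W * (a - (1 + s) * b) = - B * (a\<^sup>2 - b\<^sup>2 + 2 * a * b) + q * C * (a\<^sup>2 - b\<^sup>2 - 2 * a * b) + s * (B * (a\<^sup>2 + b\<^sup>2))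
        - (s\<^sup>2 - 2) * (b * (B * a + q * C * b))"
      unfolding W_def by (simp add: algebra_simps power2_eq_square)
    then show ?thesis by (simp add: s2)
  qed
  \<comment> \<open>The mixed terms in \<open>B * (q * C)\<close> cancel, leaving the sum of squares
    known from \<open>BC_square\<close>.\<close>
  also have "\<dots> = - c * (B\<^sup>2 + (q * C)\<^sup>2) + s * (B * (jfun (q ^ 4) (q ^ 8) * (u + v)))"
    unfolding ab_quadratic c_def by (simp add: algebra_simps power2_eq_square)
  also have "\<dots> * jfun (q\<^sup>2) (q ^ 4) = eta (q ^ 4) * thetapart z"
  proof -
    have j: "jfun (q ^ 4) (q ^ 8) = eta (q ^ 4) ^ 2 / eta (q ^ 8)" "jfun (q\<^sup>2) (q ^ 4) = eta (q\<^sup>2) ^ 2 / eta (q ^ 4)"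
      using jfun_theta_minus[OF norm_pow pow_nz, of 4] jfun_theta_minus[OF norm_pow pow_nz, of 2]
      by (simp_all flip: power_mult)
    show ?thesis
      unfolding BC_square unfolding theta_2_eta t B_eta uv_eta c_def j using nz by (simp add: divide_simps) algebra
  qed
  finally have key: "W * (a - (1 + s) * b) * jfun (q\<^sup>2) (q ^ 4) = eta (q ^ 4) * thetapart z" .
  have jnz: "a - (1 + s) * b \<noteq> 0" "jfun (q\<^sup>2) (q ^ 4) \<noteq> 0"
  proof -
    have "jfun z q \<noteq> 0"
      unfolding jfun_ptheta using norm_1_nz(1)[OF n z1] nz by (simp add: eta_def)
    then show "a - (1 + s) * b \<noteq> 0"
      unfolding jz by auto
    have "jfun (q\<^sup>2) (q ^ 4) = D z * eta (q ^ 4)"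
      by (simp add: jfun_ptheta eta_def D_def z)
    then show "jfun (q\<^sup>2) (q ^ 4) \<noteq> 0"
      using norm_1_nz(2)[OF n] nz by simp
  qed
  have "(1 - z) * thetapart z / (jfun z q * jfun (q\<^sup>2) (q ^ 4)) = thetapart z / ((a - (1 + s) * b) * jfun (q\<^sup>2) (q ^ 4))"
    unfolding jz using z1 by simp
  also have "\<dots> = W / eta (q ^ 4)"
  proof -
    have "t / (x * y) = w / e" if "w * x * y = e * t" "x \<noteq> 0" "y \<noteq> 0" "e \<noteq> 0" for t x y w e :: complex
      using that by (simp add: field_simps)
    from this[OF key jnz] show ?thesis
      using nz by simp
  qed
  finally have K: "(1 - z) * thetapart z / (jfun z q * jfun (q\<^sup>2) (q ^ 4)) = W / eta (q ^ 4)" .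
  have "2 - z - 1 / z = 2 - s" "z - z\<^sup>2 - 1 / z\<^sup>2 + 1 / z = s"
    unfolding s inv2 by simp_all
  with rank_fun_dissection[OF n z1 z] K show ?thesis
    unfolding W_def by simp
qed

end

section \<open>Rank deviations\<close>

lemma powi_eighth_root:
  fixes w :: complex
  assumes "w ^ 4 = -1"
  shows "w powi k = w ^ nat (k mod 8)"
proof -
  have w0: "w \<noteq> 0" using assms by auto
  have w8: "w ^ 8 = 1"
    using assms power_mult[of w 4 2] by simp
  have "w powi k = w powi (8 * (k div 8) + k mod 8)"
    by simp
  also have "\<dots> = w powi (8 * (k div 8)) * w powi (k mod 8)"
    using w0 by (intro power_int_add) auto
  also have "w powi (8 * (k div 8)) = (w powi 8) powi (k div 8)"
    by (rule power_int_mult)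
  also have "w powi 8 = w ^ 8"
    by simp
  finally show ?thesis
    unfolding w8 by (simp add: power_int_def)
qed

lemma sum_1_7: "(\<Sum>j=1..7. f j) = f 1 + f 2 + f 3 + f 4 + f 5 + f 6 + f (7::nat)"
  for f :: "nat \<Rightarrow> 'a :: comm_monoid_add"
proof -
  have "{1..7::nat} = {1, 2, 3, 4, 5, 6, 7}" by auto
  then show ?thesis by (simp add: add.assoc)
qed

lemma eighth_root_neq_1:
  fixes w :: complex
  assumes w: "w ^ 4 = -1" and that: "j \<in> {1..7}"
  shows "w ^ j \<noteq> 1"
proof
  assume j: "w ^ j = 1"
  have "(w ^ 4) ^ j = (w ^ j) ^ 4"
    by (simp only: power_mult[symmetric] mult.commute)
  then have "even j"
    by (auto simp: w j minus_one_power_iff split: if_splits)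
  with that have "j \<in> {2, 4, 6}"
    by (auto elim!: evenE)
  then consider "j = 2" | "j = 4" | "j = 6"
    by auto
  then show False
  proof cases
    case 1
    then show ?thesis using j w power_mult[of w 2 2] by simp
  next
    case 2
    then show ?thesis using j w by simp
  next
    case 3
    then show ?thesis using j w power_mult[of w 6 2] power_mult[of w 4 3] by simp
  qed
qed

lemma eighth_root_orthogonality:
  fixes w :: complex
  assumes w: "w ^ 4 = -1"
  shows "1 + (\<Sum>j=1..7. w powi (int j * k)) = (if k mod 8 = 0 then 8 else 0)"
proof -
  define r where "r = nat (k mod 8)"
  have "r < 8" "k mod 8 = int r"
    by (auto simp: r_def nat_less_iff)
  have "w powi (int j * k) = (w ^ r) ^ j" for j
  proof -
    have "w powi (int j * k) = (w powi k) ^ j"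
      by (simp add: power_int_mult mult.commute)
    then show ?thesis
      using powi_eighth_root[OF w, of k] by (simp add: r_def)
  qed
  then have "1 + (\<Sum>j=1..7. w powi (int j * k))
      = 1 + (w ^ r) ^ 1 + (w ^ r) ^ 2 + (w ^ r) ^ 3 + (w ^ r) ^ 4 + (w ^ r) ^ 5 + (w ^ r) ^ 6 + (w ^ r) ^ 7"
    by (simp only: sum_1_7 add.assoc)
  also have "\<dots> = (if r = 0 then 8 else 0)"
  proof (cases "r = 0")
    case False
    have "(w ^ r) ^ 8 = (w ^ 4) ^ (2 * r)"
      by (simp only: power_mult[symmetric]) (simp add: mult.commute)
    then have "(w ^ r) ^ 8 = 1"
      by (simp add: w)
    moreover have "(x - 1) * (1 + x ^ 1 + x ^ 2 + x ^ 3 + x ^ 4 + x ^ 5 + x ^ 6 + x ^ 7) = x ^ 8 - 1" for x :: complex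
      by algebra
    moreover have "w ^ r \<noteq> 1"
      using False \<open>r < 8\<close> by (intro eighth_root_neq_1[OF w]) auto
    ultimately show ?thesis
      using False by (metis cancel_comm_monoid_add_class.diff_cancel mult_eq_0_iff right_minus_eq)
  qed simp
  finally show ?thesis
    using \<open>k mod 8 = int r\<close> by simp
qed

context nome
begin

text \<open>Leaving out \<open>j = 0\<close> lowers the character sum from 8 or 0 to 7 or -1; summed
  over partitions, the missing 1 is \<open>pcount n\<close>.\<close>

lemma rank_dev_eq:
  assumes w: "w ^ 4 = -1"
  shows "rank_dev q m 8 = (\<Sum>j=1..7. w powi (- (int j * m)) * rank_fun (w ^ j)) / 8"
proof -
  have w0: "w \<noteq> 0" using w by auto
  have nw: "norm w = 1"
    by (rule norm_1_of_power[of w 4]) (simp_all add: w)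
  have s: "(\<lambda>n. (\<Sum>xs\<in>partitions n. (w ^ j) powi prank xs) * q ^ n) sums rank_fun (w ^ j)" if "j \<in> {1..7}" for j
    unfolding rank_fun_def using eighth_root_neq_1[OF w that] nw
    by (intro sums_partitions rank_gf q1) (auto simp: norm_power)
  have "(\<lambda>n. \<Sum>j=1..7. w powi (- (int j * m)) * ((\<Sum>xs\<in>partitions n. (w ^ j) powi prank xs) * q ^ n))
      sums (\<Sum>j=1..7. w powi (- (int j * m)) * rank_fun (w ^ j))"
    by (intro sums_sum sums_mult s)
  then have "(\<lambda>n. (\<Sum>j=1..7. w powi (- (int j * m)) * ((\<Sum>xs\<in>partitions n. (w ^ j) powi prank xs) * q ^ n)) / 8)
      sums ((\<Sum>j=1..7. w powi (- (int j * m)) * rank_fun (w ^ j)) / 8)"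
    by (rule sums_divide)
  moreover have "(\<Sum>j=1..7. w powi (- (int j * m)) * ((\<Sum>xs\<in>partitions n. (w ^ j) powi prank xs) * q ^ n)) / 8
      = (of_nat (NrankMod m 8 n) - of_nat (pcount n) / of_nat 8) * q ^ n" for n
  proof -
    have shift: "w powi (- (int j * m)) * (w ^ j) powi k = w powi (int j * (k - m))" for j k
    proof -
      have "int j * (k - m) = - (int j * m) + int j * k"
        by (simp add: algebra_simps)
      then have "w powi (int j * (k - m)) = w powi (- (int j * m)) * w powi (int j * k)"
        using w0 by (simp only: power_int_add simp_thms)
      also have "w powi (int j * k) = (w ^ j) powi k"
        by (simp add: power_int_mult)
      finally show ?thesis by simp
    qed
    have "(\<Sum>j=1..7. w powi (- (int j * m)) * ((\<Sum>xs\<in>partitions n. (w ^ j) powi prank xs) * q ^ n))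
        = (\<Sum>j=1..7. \<Sum>xs\<in>partitions n. w powi (int j * (prank xs - m))) * q ^ n"
      unfolding sum_distrib_right sum_distrib_left using w0
      by (intro sum.cong refl) (simp add: shift[symmetric])
    also have "(\<Sum>j=1..7. \<Sum>xs\<in>partitions n. w powi (int j * (prank xs - m)))
        = (\<Sum>xs\<in>partitions n. \<Sum>j=1..7. w powi (int j * (prank xs - m)))"
      by (rule sum.swap)
    also have "\<dots> = (\<Sum>xs\<in>partitions n. (if prank xs mod 8 = m mod 8 then 8 else 0) - 1)"
    proof (intro sum.cong refl)
      fix xs
      have "(prank xs - m) mod 8 = 0 \<longleftrightarrow> prank xs mod 8 = m mod 8"
        by (metis mod_0_imp_dvd dvd_imp_mod_0 mod_eq_dvd_iff)
      then show "(\<Sum>j=1..7. w powi (int j * (prank xs - m))) = (if prank xs mod 8 = m mod 8 then 8 else 0) - 1"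
        using eighth_root_orthogonality[OF w, of "prank xs - m"] by (simp add: algebra_simps)
    qed
    also have "\<dots> = 8 * of_nat (NrankMod m 8 n) - of_nat (pcount n)"
      using finite_partitions[of n]
      by (simp add: sum_subtractf NrankMod_def pcount_def sum.If_cases Int_def)
    finally show ?thesis
      by (simp add: diff_divide_distrib left_diff_distrib)
  qed
  ultimately show ?thesis
    unfolding rank_dev_def by (simp add: sums_iff)
qed

text \<open>Each product in \<open>theta8\<close> is \<open>B\<close> or \<open>q * C\<close> times
  one of the \<open>A\<close>: the powers \<open>q\<close>, \<open>q ^ 3\<close>,
  \<open>q ^ 6\<close> belong to \<open>A1\<close>, \<open>A3\<close>, \<open>A6\<close>, and
  \<open>C\<close> always brings one more \<open>q\<close>.\<close>

lemma theta8_eq: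
  "theta8 q a0 a1 a2 a3 a4 a5 a6 a7 =
     (a0 * (B * A0) + a1 * (q * C * A3) + a2 * (B * A1) + a3 * (q * C * A0) + a4 * (q * C * A1)
      + a5 * (B * A6) + a6 * (B * A3) + a7 * (q * C * A6)) / eta (q ^ 4) / 8"
proof -
  have "Jm q 4 = eta (q ^ 4)"
  proof -
    have n: "norm (q ^ 4) < 1" by (rule norm_pow) simp
    have "{..<3::nat} = {0, 1, 2}" by auto
    then have "eta (q ^ 4) = qpoch_inf (q ^ 4) (q ^ 12) * qpoch_inf (q ^ 8) (q ^ 12) * qpoch_inf (q ^ 12) (q ^ 12)"
      using qpoch_inf_dissect[OF n, of 3 "q ^ 4"] by (simp add: eta_def mult_ac flip: power_mult power_add)
    moreover have "q ^ 12 / q ^ 4 = q ^ 8"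
      using q0 power_diff[of q 4 12] by simp
    ultimately show ?thesis
      by (simp add: Jm_def Jam_def jfun_def)
  qed
  moreover have "q ^ 4 = q * q ^ 3" "q\<^sup>2 = q * q" "q ^ 7 = q * q ^ 6"
    by (simp_all add: eval_nat_numeral)
  ultimately show ?thesis
    by (simp add: theta8_def Jbar_def B_def C_def A0_def A1_def A3_def A6_def mult_ac)
qed

text \<open>Inverse roots give equal values, so only \<open>F s\<close>, \<open>F (- s)\<close>,
  \<open>I\<close> and \<open>M\<close> occur. As \<open>F\<close> is affine and enters through
  \<open>F s + F (- s)\<close> or \<open>s * F s - s * F (- s)\<close>, the irrational
  \<open>s\<close> disappears by \<open>s * s = 2\<close>.\<close>

theorem rank_deviations_mod_8:
  shows "rank_dev q 0 8 = theta8 q (-9) 7 (-3) 5 (-1) (-1) 5 (-3) + G8 q 1 (-1) 0 0"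
    and "rank_dev q 1 8 = theta8 q 7 (-5) (-3) 1 3 (-1) (-3) 1 + G8 q (-1) 1 1 1 / 2"
    and "rank_dev q 2 8 = theta8 q (-1) (-1) 5 (-3) (-1) (-1) 5 (-3) + G8 q 0 0 0 (-1)"
    and "rank_dev q 3 8 = theta8 q (-1) 3 (-3) 1 (-5) 7 (-3) 1 + G8 q 1 1 (-1) 1 / 2"
    and "rank_dev q 4 8 = theta8 q (-1) (-1) 5 (-3) 7 (-9) (-3) 5 + G8 q (-1) (-1) 0 0"
    and "rank_dev q 5 8 = rank_dev q 3 8" "rank_dev q 6 8 = rank_dev q 2 8" "rank_dev q 7 8 = rank_dev q 1 8"
proof -
  define w where "w = cis (pi / 4)"
  have w: "w ^ 4 = -1"
    using Complex.DeMoivre[of "pi / 4" 4] by (simp add: w_def)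
  have w0: "w \<noteq> 0" using w by auto
  have pows: "w ^ 5 = - w" "w ^ 6 = - (w ^ 2)" "w ^ 7 = - (w ^ 3)"
    using w by algebra+
  \<comment> \<open>This is \<open>w + 1 / w\<close>, as \<open>1 / w = - (w ^ 3)\<close>; the root
    \<open>w ^ 3\<close> gives \<open>- s\<close>.\<close>
  define s where "s = w - w ^ 3"
  have s2: "s * s = 2"
    unfolding s_def using w by algebra
  have w3: "(w ^ 3) ^ 4 = -1" "(- w) ^ 4 = -1" "(- (w ^ 3)) ^ 4 = -1" "(w\<^sup>2)\<^sup>2 = -1" "(- (w\<^sup>2))\<^sup>2 = -1"
    using w by algebra+
  have inv: "1 / w = - (w ^ 3)" "1 / w ^ 3 = - w" "1 / (- w) = w ^ 3" "1 / (- (w ^ 3)) = w"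
    using w w0 by (simp_all add: field_simps eval_nat_numeral)
  define p where "p = 1 / eta (q ^ 4)"
  define g1 g2 g3 g4 where "g1 = q\<^sup>2 * gmock (q\<^sup>2) (q ^ 16)" "g2 = q\<^sup>2 * gmock (- (q\<^sup>2)) (q ^ 16)"
    "g3 = q ^ 5 * gmock (q ^ 6) (q ^ 16)" "g4 = q ^ 5 * gmock (- (q ^ 6)) (q ^ 16)"
  define U where "U = (- B * (a + b) + q * C * (a - b)) * p"
  define V where "V = (B * a + q * C * b) * p"
  define F where "F t = (2 - t) * (1 + g1) + t * g3 + U + t * V" for t
  define I where "I = 2 * (1 - g2) + 2 * g4 - (B - q * C) * (A0 + A1 + A3 + A6) * p"
  define M where "M = 4 * (1 - g2) - 4 * g4 - (3 * B + q * C) * (A0 - A1 - A3 + A6) * p"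
  have F8: "rank_fun z = F (z + 1 / z)" if "z ^ 4 = -1" for z
    unfolding rank_fun_eighth_root[OF that refl] F_def U_def V_def p_def g1_g2_g3_g4_def
    by (simp only: divide_inverse mult_1_left distrib_left distrib_right mult_ac add_ac)
  have R1: "rank_fun w = F s" and R3: "rank_fun (w ^ 3) = F (- s)"
    and R5: "rank_fun (- w) = F (- s)" and R7: "rank_fun (- (w ^ 3)) = F s"
    using F8[OF w] F8[OF w3(1)] F8[OF w3(2)] F8[OF w3(3)] unfolding inv s_def by simp_all
  have R2: "rank_fun (w\<^sup>2) = I" and R6: "rank_fun (- (w\<^sup>2)) = I"
    using rank_fun_imaginary_unit[OF w3(4)] rank_fun_imaginary_unit[OF w3(5)]
    by (simp_all add: I_def p_def g1_g2_g3_g4_def)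
  have R4: "rank_fun (-1) = M"
    using rank_fun_minus_1 by (simp add: M_def p_def g1_g2_g3_g4_def)
  have D: "rank_dev q m 8 = ((w powi (- m) + w powi (- (7 * m))) * F s + (w powi (- (3 * m)) + w powi (- (5 * m))) * F (- s)
      + (w powi (- (2 * m)) + w powi (- (6 * m))) * I + w powi (- (4 * m)) * M) / 8" for m
    unfolding rank_dev_eq[OF w] sum_1_7
    by (simp add: pows w R1 R2 R3 R4 R5 R6 R7 algebra_simps)
  have sF: "F s + F (- s) = 4 * (1 + g1) + 2 * U"
    unfolding F_def by (simp add: algebra_simps)
  have "s * F s - s * F (- s) = 2 * (s * s) * (g3 - 1 - g1 + V)"
    unfolding F_def by (simp add: algebra_simps)
  then have dF: "s * F s - s * F (- s) = 4 * (g3 - 1 - g1 + V)"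
    unfolding s2 by simp
  have D0: "rank_dev q 0 8 = (2 * (F s + F (- s)) + 2 * I + M) / 8"
    unfolding D by simp
  have D1: "rank_dev q 1 8 = ((s * F s - s * F (- s)) - M) / 8"
    unfolding D powi_eighth_root[OF w] by (simp add: pows w s_def algebra_simps)
  have D2: "rank_dev q 2 8 = (M - 2 * I) / 8"
    unfolding D powi_eighth_root[OF w] by (simp add: pows w algebra_simps)
  have D3: "rank_dev q 3 8 = (- (s * F s - s * F (- s)) - M) / 8"
    unfolding D powi_eighth_root[OF w] by (simp add: pows w s_def algebra_simps)
  have D4: "rank_dev q 4 8 = (- 2 * (F s + F (- s)) + 2 * I + M) / 8"
    unfolding D powi_eighth_root[OF w] by (simp add: pows w algebra_simps)
  have th: "theta8 q a0 a1 a2 a3 a4 a5 a6 a7 =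
     (a0 * (B * A0) + a1 * (q * C * A3) + a2 * (B * A1) + a3 * (q * C * A0) + a4 * (q * C * A1)
      + a5 * (B * A6) + a6 * (B * A3) + a7 * (q * C * A6)) * p / 8" for a0 a1 a2 a3 a4 a5 a6 a7
    unfolding theta8_eq p_def by simp
  have G: "G8 q b0 b1 b2 b3 = b0 * (1 + g1) + b1 * (-1 + g2) + b2 * g3 + b3 * g4" for b0 b1 b2 b3
    unfolding G8_def g1_g2_g3_g4_def by simp
  show "rank_dev q 0 8 = theta8 q (-9) 7 (-3) 5 (-1) (-1) 5 (-3) + G8 q 1 (-1) 0 0"
    "rank_dev q 1 8 = theta8 q 7 (-5) (-3) 1 3 (-1) (-3) 1 + G8 q (-1) 1 1 1 / 2"
    "rank_dev q 2 8 = theta8 q (-1) (-1) 5 (-3) (-1) (-1) 5 (-3) + G8 q 0 0 0 (-1)"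
    "rank_dev q 3 8 = theta8 q (-1) 3 (-3) 1 (-5) 7 (-3) 1 + G8 q 1 1 (-1) 1 / 2"
    "rank_dev q 4 8 = theta8 q (-1) (-1) 5 (-3) 7 (-9) (-3) 5 + G8 q (-1) (-1) 0 0"
    unfolding D0 D1 D2 D3 D4 sF dF th G U_def V_def I_def M_def a_def b_def
    by (simp_all add: field_simps)
  show "rank_dev q 5 8 = rank_dev q 3 8" "rank_dev q 6 8 = rank_dev q 2 8" "rank_dev q 7 8 = rank_dev q 1 8"
    unfolding D powi_eighth_root[OF w] by (simp_all add: pows w algebra_simps)
qed

end

theorem theorem4p1:
  fixes q :: complex
  assumes "0 < norm q" and "norm q < 1"
  shows "rank_dev q 0 8 = theta8 q (-9) 7 (-3) 5 (-1) (-1) 5 (-3) + G8 q 1 (-1) 0 0 \<and>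
         rank_dev q 1 8 = rank_dev q 7 8 \<and>
         rank_dev q 1 8 = theta8 q 7 (-5) (-3) 1 3 (-1) (-3) 1 + G8 q (-1) 1 1 1 / 2 \<and>
         rank_dev q 2 8 = rank_dev q 6 8 \<and>
         rank_dev q 2 8 = theta8 q (-1) (-1) 5 (-3) (-1) (-1) 5 (-3) + G8 q 0 0 0 (-1) \<and>
         rank_dev q 3 8 = rank_dev q 5 8 \<and>
         rank_dev q 3 8 = theta8 q (-1) 3 (-3) 1 (-5) 7 (-3) 1 + G8 q 1 1 (-1) 1 / 2 \<and>
         rank_dev q 4 8 = theta8 q (-1) (-1) 5 (-3) 7 (-9) (-3) 5 + G8 q (-1) (-1) 0 0"
proof -
  interpret nome q
    using assms by unfold_locales auto
  show ?thesis
    using rank_deviations_mod_8 by simp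
qed

end
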